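(* Let $1<p<\infty$ and let $w\in A_p$. Let $b=\{b_I\}_{I\in\mathcal{D}}$ and $d=\{d_I\}_{I\in\mathcal{D}}$ be sequences of complex numbers, and suppose that $\|\widehat{S}(b\circ d)\|_{CM}<\infty$ and $\|E(b\circ d)\|_{\ell^\infty}<\infty$. Then the operator $\Pi_b^*\Pi_d$ is bounded on $L^p(w)$, and there is a constant $C$ such that $$\|\Pi_b^*\Pi_d\|_{L^p(w)}\le C\left(\|\widehat{S}(b\circ d)\|_{CM}+\|E(b\circ d)\|_{\ell^\infty}\right)\|\mathcal{A}_{\mathcal{S}}\|_{L^p(w)},$$ where $\mathcal{A}_{\mathcal{S}}$ denotes the sparse operator associated with a sparse collection $\mathcal{S}$.
   Context: $\mathcal{D}$ is the standard dyadic grid of intervals on $\mathbb{R}$. For $I\in\mathcal{D}$, $I^+$ and $I^-$ are the left and right dyadic children of $I$, and $h_I=|I|^{-1/2}(\mathbf{1}_{I^+}-\mathbf{1}_{I^-})$ is the Haar function. For $J\subsetneq I$ in $\mathcal{D}$, $h_I(J)$ denotes the constant value of $h_I$ on $J$. The average of $f$ over $I$ is $\langle f\rangle_I=\frac1{|I|}\int_I f\,dx$. The relation $J\subset I$ allows $J=I$. Weights: a weight is a locally integrable non-negative function $w$ on $\mathbb{R}$, and $L^p(w)$ is the space of functions $f$ with $\|f\|_{L^p(w)}=(\int|f|^pw\,dx)^{1/p}<\infty$. For $1<p<\infty$ with Hölder conjugate $q$, $w\in A_p$ means $$[w]_{A_p}=\sup_{I\subset\mathbb{R}}\left(\frac1{|I|}\int_I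 w\,dx\right)\left(\frac1{|I|}\int_I w^{-q/p}\,dx\right)^{p/q}<\infty,$$ the supremum being over intervals $I\subset\mathbb{R}$. For an operator $T$, $\|T\|_{L^p(w)}$ is its operator norm on $L^p(w)$. Sequences: $b\circ d=\{b_Id_I\}_{I\in\mathcal{D}}$. For a complex sequence $a=\{a_I\}_{I\in\mathcal{D}}$, $$\widehat{S}(a)=\Big\{\sum_{J\subsetneq I}a_Jh_I(J)\Big\}_{I\in\mathcal{D}},\qquad E(a)=\Big\{\frac1{|I|}\sum_{J\subset I}a_J\Big\}_{I\in\mathcal{D}},$$ where the sums are over $J\in\mathcal{D}$, and $$\|a\|_{CM}=\Big(\sup_{I\in\mathcal{D}}\frac1{|I|}\sum_{J\subset I}|a_J|^2\Big)^{1/2},\qquad \|a\|_{\ell^\infty}=\sup_{I\in\mathcal{D}}|a_I|.$$ Operators: the dyadic paraproduct with symbol $d$ is $\Pi_d f=\sum_{I\in\mathcal{D}}d_I\langle f\rangle_I h_I$, and the adjoint paraproduct with symbol $b$ is $\Pi_b^* f=\sum_{I\in\mathcal{D}}b_I\langle f,h_I\rangle\frac{\mathbf{1}_I}{|I|}$, so that $\Pi_b^*\Pi_d f=\sum_{I\in\mathcal{D}}b_Id_I\langle f\rangle_I\frac{\mathbf{1}_I}{|I|}$. Sparse operators: for $0<\eta<1$, a collection $\mathcal{S}\subset\mathcal{D}$ is $\eta$-sparse if for every $Q\in\mathcal{S}$ there is a measurable set $E_Q\subset Q$ with $|E_Q|\ge\eta|Q|$ such that the sets $\{E_Q\}_{Q\in\mathcal{S}}$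 are pairwise disjoint. Given a sparse collection $\mathcal{S}$, the sparse operator is $\mathcal{A}_{\mathcal{S}}f=\sum_{Q\in\mathcal{S}}\langle f\rangle_Q\mathbf{1}_Q$. *)

theory Defs
  imports "HOL-Analysis.Analysis"
begin

section \<open>Dyadic intervals and Haar functions\<close>

text \<open>Dyadic intervals are half-open sets of reals; sequences indexed by them are functions
  on \<^typ>\<open>real set\<close>, of which only the values on dyadic intervals matter.\<close>

definition dyadic :: "real set set" where
  "dyadic = {{of_int k * 2 powi n ..< of_int (k + 1) * 2 powi n} | k n :: int. True}"

abbreviation len :: "real set \<Rightarrow> real" where
  "len I \<equiv> measure lebesgue I"

definition left_child :: "real set \<Rightarrow> real set" where
  "left_child I = {Inf I ..< (Inf I + Sup I) / 2}"

definition right_child :: "real set \<Rightarrow> real set" where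
  "right_child I = {(Inf I + Sup I) / 2 ..< Sup I}"

definition haar :: "real set \<Rightarrow> real \<Rightarrow> real" where
  "haar I x = len I powr (- 1 / 2) * (indicator (left_child I) x - indicator (right_child I) x)"

text \<open>For dyadic J strictly inside I, the function \<^term>\<open>haar I\<close> is constant on J, and the
  left endpoint of J belongs to J.\<close>

definition haar_on :: "real set \<Rightarrow> real set \<Rightarrow> real" where
  "haar_on I J = haar I (Inf J)"

definition avg :: "(real \<Rightarrow> complex) \<Rightarrow> real set \<Rightarrow> complex" where
  "avg f I = (LINT x:I|lebesgue. f x) / of_real (len I)"


section \<open>Weights and weighted spaces\<close>

definition epowr :: "ennreal \<Rightarrow> real \<Rightarrow> ennreal" where
  "epowr x r = (if x = \<infinity> then \<infinity> else ennreal (enn2real x powr r))"  \<comment> \<open>used for r > 0 only\<close>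

definition weight :: "(real \<Rightarrow> real) \<Rightarrow> bool" where
  "weight w \<longleftrightarrow> w \<in> borel_measurable lebesgue \<and> (\<forall>x. 0 \<le> w x) \<and>
     (\<forall>u v. set_integrable lebesgue {u..v} w)"

definition conj_exp :: "real \<Rightarrow> real" where
  "conj_exp p = p / (p - 1)"

definition Ap_const :: "real \<Rightarrow> (real \<Rightarrow> real) \<Rightarrow> ennreal" where
  "Ap_const p w = (let q = conj_exp p in
     SUP (u, v) \<in> {(u, v). u < v}.
       ((\<integral>\<^sup>+x\<in>{u..v}. ennreal (w x) \<partial>lebesgue) / ennreal (v - u)) *
       epowr ((\<integral>\<^sup>+x\<in>{u..v}. ennreal (w x powr (- q / p)) \<partial>lebesgue) / ennreal (v - u)) (p / q))"

text \<open>In HOL, 0 raised to a negative power is 0 rather than infinity. Positivity almost everywhere,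
  which is implicit in the integrability of the negative power of w, therefore has to be
  required separately; without it w = 0 would be an Ap weight.\<close>

definition Ap :: "real \<Rightarrow> (real \<Rightarrow> real) set" where
  "Ap p = {w. weight w \<and> (AE x in lebesgue. 0 < w x) \<and> Ap_const p w < \<infinity>}"

definition Lp_norm :: "real \<Rightarrow> (real \<Rightarrow> real) \<Rightarrow> (real \<Rightarrow> complex) \<Rightarrow> ennreal" where
  "Lp_norm p w f = epowr (\<integral>\<^sup>+x. ennreal (norm (f x) powr p * w x) \<partial>lebesgue) (1 / p)"

definition Lp :: "real \<Rightarrow> (real \<Rightarrow> real) \<Rightarrow> (real \<Rightarrow> complex) set" where
  "Lp p w = {f \<in> borel_measurable lebesgue. Lp_norm p w f < \<infinity>}"

definition op_norm :: "real \<Rightarrow> (real \<Rightarrow> real) \<Rightarrow> ((real \<Rightarrow> complex) \<Rightarrow> (real \<Rightarrow> complex)) \<Rightarrow> ennreal" where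
  "op_norm p w T = (SUP f \<in> {f \<in> Lp p w. Lp_norm p w f \<le> 1}. Lp_norm p w (T f))"

definition bounded_on_Lp :: "real \<Rightarrow> (real \<Rightarrow> real) \<Rightarrow> ((real \<Rightarrow> complex) \<Rightarrow> (real \<Rightarrow> complex)) \<Rightarrow> bool" where
  "bounded_on_Lp p w T \<longleftrightarrow> (\<forall>f \<in> Lp p w. T f \<in> Lp p w) \<and> op_norm p w T < \<infinity>"


section \<open>Sequences indexed by dyadic intervals\<close>

text \<open>All sums over dyadic intervals are unordered sums. For complex terms \<^term>\<open>infsum\<close> is 0 when
  the sum does not converge, so convergence has to be stated separately. The following condition
  says that all sums in \<open>E_seq a\<close> and \<open>S_hat a\<close> converge (on the proper dyadic subintervals of I,
  the Haar function of I has constant modulus).\<close>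

definition locally_summable :: "(real set \<Rightarrow> complex) \<Rightarrow> bool" where
  "locally_summable a \<longleftrightarrow> (\<forall>I\<in>dyadic. a summable_on {J \<in> dyadic. J \<subseteq> I})"

definition S_hat :: "(real set \<Rightarrow> complex) \<Rightarrow> real set \<Rightarrow> complex" where
  "S_hat a I = (\<Sum>\<^sub>\<infinity>J\<in>{J \<in> dyadic. J \<subset> I}. a J * of_real (haar_on I J))"

definition E_seq :: "(real set \<Rightarrow> complex) \<Rightarrow> real set \<Rightarrow> complex" where
  "E_seq a I = (\<Sum>\<^sub>\<infinity>J\<in>{J \<in> dyadic. J \<subseteq> I}. a J) / of_real (len I)"

definition CM_norm :: "(real set \<Rightarrow> complex) \<Rightarrow> ennreal" where
  "CM_norm a = epowr (SUP I\<in>dyadic.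
     (\<Sum>\<^sub>\<infinity>J\<in>{J \<in> dyadic. J \<subseteq> I}. ennreal ((norm (a J))\<^sup>2)) / ennreal (len I)) (1 / 2)"

definition linf_norm :: "(real set \<Rightarrow> complex) \<Rightarrow> ennreal" where
  "linf_norm a = (SUP I\<in>dyadic. ennreal (norm (a I)))"


section \<open>Paraproducts and sparse operators\<close>

text \<open>The paraproduct with symbol d maps f to the Haar series with coefficients
  \<open>paraproduct_coeff d f\<close>, and the adjoint paraproduct with symbol b depends on its argument only
  through the Haar coefficients g of that argument. The two operators are composed at the level
  of Haar coefficients, because d alone need not define a convergent Haar series; this gives the
  series with terms \<open>b I * d I * avg f I * indicator I x / len I\<close>.\<close>

definition paraproduct_coeff :: "(real set \<Rightarrow> complex) \<Rightarrow> (real \<Rightarrow> complex) \<Rightarrow> real set \<Rightarrow> complex" where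
  "paraproduct_coeff d f I = d I * avg f I"

definition adj_paraproduct_term ::
    "(real set \<Rightarrow> complex) \<Rightarrow> (real set \<Rightarrow> complex) \<Rightarrow> real \<Rightarrow> real set \<Rightarrow> complex" where
  "adj_paraproduct_term b g x I = b I * g I * of_real (indicator I x / len I)"

definition paraproduct_comp ::
    "(real set \<Rightarrow> complex) \<Rightarrow> (real set \<Rightarrow> complex) \<Rightarrow> (real \<Rightarrow> complex) \<Rightarrow> real \<Rightarrow> complex" where
  "paraproduct_comp b d f x = (\<Sum>\<^sub>\<infinity>I\<in>dyadic. adj_paraproduct_term b (paraproduct_coeff d f) x I)"

definition paraproduct_comp_converges ::
    "(real set \<Rightarrow> complex) \<Rightarrow> (real set \<Rightarrow> complex) \<Rightarrow> (real \<Rightarrow> complex) \<Rightarrow> bool" where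
  "paraproduct_comp_converges b d f \<longleftrightarrow>
     (AE x in lebesgue. adj_paraproduct_term b (paraproduct_coeff d f) x summable_on dyadic)"

definition sparse_collection :: "real \<Rightarrow> real set set \<Rightarrow> bool" where
  "sparse_collection \<eta> S \<longleftrightarrow> S \<subseteq> dyadic \<and>
     (\<exists>E. (\<forall>Q\<in>S. E Q \<in> sets lebesgue \<and> E Q \<subseteq> Q \<and> len (E Q) \<ge> \<eta> * len Q) \<and>
          disjoint_family_on E S)"

definition sparse_op :: "real set set \<Rightarrow> (real \<Rightarrow> complex) \<Rightarrow> real \<Rightarrow> complex" where
  "sparse_op S f x = (\<Sum>\<^sub>\<infinity>Q\<in>S. avg f Q * indicator Q x)"

end

theory Submission
  imports Defs
begin

text \<open>Put a = b d and write e for the sequence E(a). On a dyadic interval I the quotient of a(I) by |I| is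
  e(I) minus the mean of e over the two children of I, and half the difference of e over the children is
  S(a)(I) divided by the square root of |I|. So the hypotheses say that e is bounded and that its Haar
  differences satisfy a Carleson packing condition.

  Summing a(J) avg(f, J) / |J| along the dyadic chain from a top interval I down to J, and adding avg(f, J) e(J),
  gives a process W(J) whose drift is controlled by these two conditions. Stop the chain when the average of |f|
  exceeds 4 A or |W| exceeds 300 M A, where A is the average of |f| over I. A potential that is a supermartingale
  until stopping shows that the stopped intervals fill at most half of I, and restarting on them dominates
  the operator pointwise by a sparse operator applied to |f|.

  Here the sparse collection depends on f. Sparse operators are bounded on the weighted space uniformly in the
  collection (duality and the weighted Carleson embedding), so the supremum of their norms is finite and a single
  collection whose norm is at least half of it serves for all f.\<close>

text \<open>The hypotheses see a only through sums in which terms cancel: the sum of |a(J)| over J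
  inside I has no bound in terms of |I|, and the differences of e are only square summable. So
  absolute values cannot be taken termwise, and the control of W has to be quadratic. Adding avg(f,
  J) e(J) is a summation by parts: it turns the partial sum into a martingale plus a drift whose
  increment is the half difference of the averages of f times the half difference of e. The
  inequality between geometric and arithmetic means pays for this drift with the energies of both
  factors, which is why the potential carries |f|^2 and the energy of e.

  Domination is proved for finite trees only, and the sparse family changes with the tree. Limits
  are therefore taken in integrals, never in the families. Convergence of the series needs its own
  argument: towards infinity the hypotheses merely bound the coefficients, and summability there
  comes from testing sparse operators on increasing chains of intervals.\<close>

section \<open>Carleson embedding\<close>

lemma nn_integral_powr_from_0:
  fixes a c :: real
  assumes "a > -1" "c \<ge> 0"
  shows "(\<integral>\<^sup>+t. ennreal (t powr a) * indicator {0..c} t \<partial>lborel) = ennreal (c powr (a + 1) / (a + 1))"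
  using nn_integral_has_integral_lebesgue[OF _ has_integral_powr_from_0[OF assms]] assms
  by (simp add: nn_integral_set_ennreal mult.commute)

text \<open>The sets with \<open>t < lam Q\<close> are covered by the maximal ones among them, which
  are disjoint by nestedness. The integral on the right keeps only points where \<open>h\<close>
  exceeds \<open>t / 2\<close>; without this cut the integration over t in
  \<open>carleson_embedding\<close> would diverge at infinity.\<close>

lemma maximal_weak_type:
  fixes h :: "'a \<Rightarrow> real" and lam :: "'a set \<Rightarrow> real"
  assumes h [measurable]: "h \<in> borel_measurable M" and h0: "\<And>x. 0 \<le> h x"
    and S: "finite S" "S \<subseteq> sets M"
    and nested: "\<And>Q R. Q \<in> S \<Longrightarrow> R \<in> S \<Longrightarrow> Q \<subseteq> R \<or> R \<subseteq> Q \<or> Q \<inter> R = {}"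
    and fin: "\<And>Q. Q \<in> S \<Longrightarrow> emeasure M Q < \<infinity>"
    and lam: "\<And>Q. Q \<in> S \<Longrightarrow> ennreal (lam Q) * emeasure M Q \<le> (\<integral>\<^sup>+x\<in>Q. ennreal (h x) \<partial>M)"
    and t: "t > 0"
  shows "emeasure M (\<Union>{Q \<in> S. t < lam Q})
    \<le> ennreal (2 / t) * (\<integral>\<^sup>+x. ennreal (h x) * indicator {t / 2<..} (h x) \<partial>M)"
proof -
  define S' where "S' = {Q \<in> S. t < lam Q}"
  define X where "X = {Q \<in> S'. \<forall>R\<in>S'. Q \<subseteq> R \<longrightarrow> R = Q}"
  have fS': "finite S'" "S' \<subseteq> S" "finite X" "X \<subseteq> S'" using S by (auto simp: S'_def X_def)
  have cover: "\<Union>S' \<subseteq> \<Union>X"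
  proof
    fix x assume "x \<in> \<Union>S'"
    then obtain Q where Q: "Q \<in> S'" "x \<in> Q" by auto
    obtain R where R: "R \<in> S'" "Q \<subseteq> R" "\<forall>T\<in>S'. R \<subseteq> T \<longrightarrow> R = T"
      using finite_has_maximal2[OF fS'(1) Q(1)] by blast
    then show "x \<in> \<Union>X" using Q unfolding X_def by blast
  qed
  have disj: "disjoint_family_on (\<lambda>Q. Q) X"
    unfolding disjoint_family_on_def
  proof (intro ballI impI)
    fix Q R assume QR: "Q \<in> X" "R \<in> X" "Q \<noteq> R"
    then have "Q \<in> S" "R \<in> S" using fS' by auto
    from nested[OF this] QR show "Q \<inter> R = {}" unfolding X_def by auto
  qed
  let ?k = "\<lambda>x. ennreal (h x) * indicator {t / 2<..} (h x)"
  have one: "emeasure M Q \<le> ennreal (2 / t) * (\<integral>\<^sup>+x\<in>Q. ?k x \<partial>M)" if "Q \<in> X" for Q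
  proof -
    have QS: "Q \<in> S" "t < lam Q" and [measurable]: "Q \<in> sets M"
      using that fS' S by (auto simp: X_def S'_def)
    obtain m where m: "emeasure M Q = ennreal m" "m \<ge> 0"
      using fin[OF QS(1)] by (cases "emeasure M Q") auto
    have "ennreal t * emeasure M Q \<le> ennreal (lam Q) * emeasure M Q"
      using QS by (intro mult_right_mono ennreal_leI) auto
    also have "\<dots> \<le> (\<integral>\<^sup>+x\<in>Q. ennreal (h x) \<partial>M)" by (rule lam[OF QS(1)])
    \<comment> \<open>Points of Q with \<open>h x\<close> at most \<open>t / 2\<close> account for
      at most half of \<open>t * emeasure M Q\<close>, which the left side absorbs because Q has
      finite measure.\<close>
    also have "\<dots> \<le> (\<integral>\<^sup>+x. ?k x * indicator Q x + ennreal (t / 2) * indicator Q x \<partial>M)"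
      using t by (intro nn_integral_mono) (auto split: split_indicator intro!: ennreal_leI)
    also have "\<dots> = (\<integral>\<^sup>+x\<in>Q. ?k x \<partial>M) + ennreal (t / 2) * emeasure M Q"
      by (subst nn_integral_add) (auto simp: nn_integral_cmult_indicator)
    finally have le: "ennreal t * emeasure M Q \<le> (\<integral>\<^sup>+x\<in>Q. ?k x \<partial>M) + ennreal (t / 2) * emeasure M Q" .
    show ?thesis
    proof (cases "(\<integral>\<^sup>+x\<in>Q. ?k x \<partial>M)")
      case (real r)
      have "ennreal t * ennreal m \<le> ennreal r + ennreal (t / 2) * ennreal m"
        using le unfolding m real .
      then have "ennreal (t * m) \<le> ennreal (r + t / 2 * m)"
        using real m t by (simp add: ennreal_mult[symmetric] ennreal_plus[symmetric] del: ennreal_plus)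
      then have "t * m \<le> r + t / 2 * m" using real m t by (subst (asm) ennreal_le_iff) auto
      then have "m \<le> 2 / t * r" using t by (simp add: field_simps)
      then show ?thesis using real m t by (simp add: ennreal_mult[symmetric] del: times_divide_eq_left)
    next
      case top
      then show ?thesis using t by (simp add: ennreal_mult_top)
    qed
  qed
  have "emeasure M (\<Union>S') \<le> emeasure M (\<Union>Q\<in>X. Q)"
    using cover fS' S by (intro emeasure_mono) (auto intro!: sets.finite_Union)
  also have "\<dots> \<le> (\<Sum>Q\<in>X. emeasure M Q)"
    using fS' S by (intro emeasure_subadditive_finite) auto
  also have "\<dots> \<le> (\<Sum>Q\<in>X. ennreal (2 / t) * (\<integral>\<^sup>+x\<in>Q. ?k x \<partial>M))"
    by (intro sum_mono one)
  also have "\<dots> = ennreal (2 / t) * (\<integral>\<^sup>+x. (\<Sum>Q\<in>X. ?k x * indicator Q x) \<partial>M)"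
  proof -
    have "(\<lambda>x. ?k x * indicator Q x) \<in> borel_measurable M" if "Q \<in> X" for Q
    proof -
      have [measurable]: "Q \<in> sets M" using that fS' S by auto
      show ?thesis by measurable
    qed
    then show ?thesis by (simp add: nn_integral_sum sum_distrib_left)
  qed
  also have "\<dots> \<le> ennreal (2 / t) * (\<integral>\<^sup>+x. ?k x \<partial>M)"
  proof (intro mult_left_mono nn_integral_mono)
    fix x
    have "(\<Sum>Q\<in>X. ?k x * indicator Q x) = ?k x * indicator (\<Union>Q\<in>X. Q) x"
    proof -
      have "(indicator (\<Union>Q\<in>X. Q) x :: ennreal) = (\<Sum>Q\<in>X. indicator Q x)"
        by (rule indicator_UN_disjoint[OF fS'(3) disj])
      then show ?thesis by (simp only: sum_distrib_left)
    qed
    also have "\<dots> \<le> ?k x" by (auto split: split_indicator)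
    finally show "(\<Sum>Q\<in>X. ?k x * indicator Q x) \<le> ?k x" .
  qed auto
  finally show ?thesis by (simp add: S'_def)
qed

text \<open>This is the maximal function bound in linearized form: \<open>lam Q\<close> is at most
  the average of \<open>h\<close> over Q, and the disjoint parts \<open>E Q\<close> of the sets with
  \<open>t < lam Q\<close> together measure no more than their union. Writing
  \<open>lam Q powr p\<close> as an integral over t and applying the weak type bound gives the
  constant: the integral of 2 p t^(p-2) h over 0 < t < 2h is p 2^p h^p / (p - 1).\<close>

lemma carleson_embedding:
  fixes h :: "'a \<Rightarrow> real" and lam :: "'a set \<Rightarrow> real"
  assumes sf: "sigma_finite_measure M" and p: "1 < p"
    and h [measurable]: "h \<in> borel_measurable M" and h0: "\<And>x. 0 \<le> h x"
    and S: "finite S" "S \<subseteq> sets M"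
    and nested: "\<And>Q R. Q \<in> S \<Longrightarrow> R \<in> S \<Longrightarrow> Q \<subseteq> R \<or> R \<subseteq> Q \<or> Q \<inter> R = {}"
    and fin: "\<And>Q. Q \<in> S \<Longrightarrow> emeasure M Q < \<infinity>"
    and lam0: "\<And>Q. Q \<in> S \<Longrightarrow> 0 \<le> lam Q"
    and lam: "\<And>Q. Q \<in> S \<Longrightarrow> ennreal (lam Q) * emeasure M Q \<le> (\<integral>\<^sup>+x\<in>Q. ennreal (h x) \<partial>M)"
    and E: "\<And>Q. Q \<in> S \<Longrightarrow> E Q \<in> sets M" "\<And>Q. Q \<in> S \<Longrightarrow> E Q \<subseteq> Q" "disjoint_family_on E S"
  shows "(\<Sum>Q\<in>S. ennreal (lam Q powr p) * emeasure M (E Q))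
    \<le> ennreal (p * 2 powr p / (p - 1)) * (\<integral>\<^sup>+x. ennreal (h x powr p) \<partial>M)"
proof -
  interpret sigma_finite_measure M by (rule sf)
  interpret pair_sigma_finite lborel M ..
  define g where "g t x = (if 0 < t \<and> t < 2 * h x then ennreal (2 * p * (t powr (p - 2)) * h x) else 0)" for t x
  have [measurable]: "case_prod g \<in> borel_measurable (lborel \<Otimes>\<^sub>M M)"
    unfolding g_def by measurable
  have lamp: "ennreal (lam Q powr p) = (\<integral>\<^sup>+t. ennreal (p * t powr (p - 1)) * indicator {0<..<lam Q} t \<partial>lborel)"
    if "Q \<in> S" for Q
  proof -
    have "AE t in lborel. t \<noteq> 0 \<and> t \<noteq> lam Q"
      using AE_lborel_singleton[of 0] AE_lborel_singleton[of "lam Q"] by eventually_elim auto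
    then have "AE t in lborel. ennreal (p * t powr (p - 1)) * indicator {0<..<lam Q} t
        = ennreal p * (ennreal (t powr (p - 1)) * indicator {0..lam Q} t)"
      by eventually_elim (use p in \<open>auto simp: ennreal_mult split: split_indicator\<close>)
    then have "(\<integral>\<^sup>+t. ennreal (p * t powr (p - 1)) * indicator {0<..<lam Q} t \<partial>lborel)
      = (\<integral>\<^sup>+t. ennreal p * (ennreal (t powr (p - 1)) * indicator {0..lam Q} t) \<partial>lborel)"
      by (rule nn_integral_cong_AE)
    also have "\<dots> = ennreal p * ennreal (lam Q powr p / p)"
      using p lam0[OF that] nn_integral_powr_from_0[of "p - 1" "lam Q"] by (subst nn_integral_cmult) auto
    finally show ?thesis using p by (simp add: ennreal_mult[symmetric])
  qed
  have "(\<Sum>Q\<in>S. ennreal (lam Q powr p) * emeasure M (E Q))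
     = (\<integral>\<^sup>+t. (\<Sum>Q\<in>S. ennreal (p * t powr (p - 1)) * indicator {0<..<lam Q} t * emeasure M (E Q)) \<partial>lborel)"
    by (subst nn_integral_sum) (auto simp: lamp nn_integral_multc)
  also have "\<dots> \<le> (\<integral>\<^sup>+t. (\<integral>\<^sup>+x. g t x \<partial>M) \<partial>lborel)"
  proof (rule nn_integral_mono)
    fix t :: real
    show "(\<Sum>Q\<in>S. ennreal (p * t powr (p - 1)) * indicator {0<..<lam Q} t * emeasure M (E Q)) \<le> (\<integral>\<^sup>+x. g t x \<partial>M)"
    proof (cases "t > 0")
      case True
      let ?S = "{Q \<in> S. t < lam Q}"
      have "(\<Sum>Q\<in>S. ennreal (p * t powr (p - 1)) * indicator {0<..<lam Q} t * emeasure M (E Q))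
        = (\<Sum>Q\<in>?S. ennreal (p * t powr (p - 1)) * emeasure M (E Q))"
        using True S by (intro sum.mono_neutral_cong_right) (auto simp: indicator_def)
      also have "\<dots> = ennreal (p * t powr (p - 1)) * emeasure M (\<Union>Q\<in>?S. E Q)"
        using S E by (subst sum_emeasure[symmetric]) (auto simp: sum_distrib_left disjoint_family_on_def)
      also have "\<dots> \<le> ennreal (p * t powr (p - 1)) * emeasure M (\<Union>?S)"
        using E S by (intro mult_left_mono emeasure_mono) (auto intro!: sets.finite_Union)
      also have "\<dots> \<le> ennreal (p * t powr (p - 1)) * (ennreal (2 / t) * (\<integral>\<^sup>+x. ennreal (h x) * indicator {t / 2<..} (h x) \<partial>M))"
        by (intro mult_left_mono maximal_weak_type h h0 S nested fin lam True) auto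
      also have "\<dots> = (\<integral>\<^sup>+x. ennreal (p * t powr (p - 1)) * (ennreal (2 / t) * (ennreal (h x) * indicator {t / 2<..} (h x))) \<partial>M)"
        by (simp add: nn_integral_cmult)
      also have "\<dots> = (\<integral>\<^sup>+x. g t x \<partial>M)"
      proof (rule nn_integral_cong)
        fix x
        have "t powr (p - 1) = t powr (p - 2) * t"
          using True powr_add[of t "p - 2" 1] by simp
        then show "ennreal (p * t powr (p - 1)) * (ennreal (2 / t) * (ennreal (h x) * indicator {t / 2<..} (h x))) = g t x"
          using True p h0[of x] by (auto simp: g_def ennreal_mult[symmetric] split: split_indicator intro!: arg_cong[where f=ennreal])
      qed
      finally show ?thesis .
    qed (auto simp: indicator_def)
  qed
  also have "\<dots> = (\<integral>\<^sup>+x. (\<integral>\<^sup>+t. g t x \<partial>lborel) \<partial>M)"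
    by (rule Fubini'[symmetric]) measurable
  also have "\<dots> = (\<integral>\<^sup>+x. ennreal (p * 2 powr p / (p - 1)) * ennreal (h x powr p) \<partial>M)"
  proof (rule nn_integral_cong)
    fix x
    have "AE t in lborel. t \<noteq> 0 \<and> t \<noteq> 2 * h x"
      using AE_lborel_singleton[of 0] AE_lborel_singleton[of "2 * h x"] by eventually_elim auto
    then have "AE t in lborel. g t x = ennreal (2 * p * h x) * (ennreal (t powr (p - 2)) * indicator {0..2 * h x} t)"
      by eventually_elim (use p h0[of x] in \<open>auto simp: g_def ennreal_mult[symmetric] mult_ac split: split_indicator\<close>)
    then have "(\<integral>\<^sup>+t. g t x \<partial>lborel) = (\<integral>\<^sup>+t. ennreal (2 * p * h x) * (ennreal (t powr (p - 2)) * indicator {0..2 * h x} t) \<partial>lborel)"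
      by (rule nn_integral_cong_AE)
    also have "\<dots> = ennreal (2 * p * h x) * ennreal ((2 * h x) powr (p - 1) / (p - 1))"
      using p h0[of x] nn_integral_powr_from_0[of "p - 2" "2 * h x"] by (subst nn_integral_cmult) auto
    also have "\<dots> = ennreal (p * ((2 * h x) * (2 * h x) powr (p - 1)) / (p - 1))"
      using p h0[of x] by (simp add: ennreal_mult[symmetric] mult_ac)
    also have "(2 * h x) * (2 * h x) powr (p - 1) = 2 powr p * h x powr p"
      using h0[of x] p powr_add[of "2 * h x" 1 "p - 1"] by (simp add: powr_mult powr_one_gt_zero_iff)
    finally show "(\<integral>\<^sup>+t. g t x \<partial>lborel) = ennreal (p * 2 powr p / (p - 1)) * ennreal (h x powr p)"
      using p by (simp add: ennreal_mult[symmetric] mult_ac)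
  qed
  also have "\<dots> = ennreal (p * 2 powr p / (p - 1)) * (\<integral>\<^sup>+x. ennreal (h x powr p) \<partial>M)"
    by (simp add: nn_integral_cmult)
  finally show ?thesis .
qed

section \<open>Dyadic intervals\<close>

text \<open>Dyadic intervals of one scale become level sets of a floor. Passing to a coarser scale
  is integer division by a power of two, so the finer floor determines the coarser one; this gives
  nestedness in \<open>dyadic_cases\<close>.\<close>

lemma dyadic_mem_iff_floor:
  fixes k n :: int
  shows "x \<in> {of_int k * 2 powi n ..< of_int (k + 1) * 2 powi n} \<longleftrightarrow> \<lfloor>x / 2 powi n\<rfloor> = k"
proof -
  have "(0::real) < 2 powi n" by simp
  then show ?thesis by (auto simp: floor_eq_iff pos_le_divide_eq pos_divide_less_eq)
qed

lemma dyadicE: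
  assumes "I \<in> dyadic"
  obtains k n :: int where "I = {of_int k * 2 powi n ..< of_int (k + 1) * 2 powi n}"
  using assms by (auto simp: dyadic_def)

lemma dyadicI: "{of_int k * 2 powi n ..< of_int (k + 1) * 2 powi n} \<in> dyadic"
  by (auto simp: dyadic_def)

lemma countable_dyadic: "countable dyadic"
proof -
  have eq: "dyadic = range (\<lambda>(k, n). {of_int k * 2 powi n ..< of_int (k + 1) * 2 powi n})"
    by (auto simp: dyadic_def image_iff)
  show ?thesis by (subst eq) (rule countable_image, rule countableI_type)
qed

lemma dyadic_nonempty: "I \<in> dyadic \<Longrightarrow> I \<noteq> {}"
  by (elim dyadicE) simp

lemma sets_lebesgue_dyadic: "I \<in> dyadic \<Longrightarrow> I \<in> sets lebesgue"
  by (elim dyadicE) simp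

lemma len_dyadic:
  fixes k n :: int
  shows "len {of_int k * 2 powi n ..< of_int (k + 1) * 2 powi n} = 2 powi n"
  by (simp add: algebra_simps)

lemma len_dyadic_pos: "I \<in> dyadic \<Longrightarrow> 0 < len I"
  by (elim dyadicE) (simp only: len_dyadic, simp)

lemma emeasure_dyadic: "I \<in> dyadic \<Longrightarrow> emeasure lebesgue I = ennreal (len I)"
  by (elim dyadicE) (simp add: algebra_simps)

lemma dyadic_cases:
  assumes "I \<in> dyadic" "J \<in> dyadic"
  shows "I \<subseteq> J \<or> J \<subseteq> I \<or> I \<inter> J = {}"
proof -
  have *: "I \<subseteq> J \<or> I \<inter> J = {}"
    if I: "I = {of_int k * 2 powi n ..< of_int (k + 1) * 2 powi n}"
      and J: "J = {of_int l * 2 powi m ..< of_int (l + 1) * 2 powi m}" and nm: "n \<le> m"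
    for I J :: "real set" and k l n m :: int
  proof -
    have eq: "\<lfloor>x / 2 powi m\<rfloor> = \<lfloor>x / 2 powi n\<rfloor> div 2 ^ nat (m - n)" for x :: real
    proof -
      have "(2::real) powi m = 2 powi n * real_of_int (2 ^ nat (m - n))"
        using nm by (simp add: power_int_add[symmetric] flip: power_int_of_nat)
      then have *: "x / 2 powi m = (x / 2 powi n) / real_of_int (2 ^ nat (m - n))"
        by simp
      show ?thesis unfolding * by (rule floor_divide_real_eq_div) simp
    qed
    have "I \<subseteq> J" if "x \<in> I" "x \<in> J" for x
    proof
      fix y assume "y \<in> I"
      then have "\<lfloor>y / (2::real) powi n\<rfloor> = \<lfloor>x / 2 powi n\<rfloor>" using that unfolding I dyadic_mem_iff_floor by simp
      then have "\<lfloor>y / (2::real) powi m\<rfloor> = \<lfloor>x / 2 powi m\<rfloor>" by (simp only: eq)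
      then show "y \<in> J" using that unfolding J dyadic_mem_iff_floor by simp
    qed
    then show ?thesis by auto
  qed
  from assms obtain k n l m :: int where
    I: "I = {of_int k * 2 powi n ..< of_int (k + 1) * 2 powi n}" and
    J: "J = {of_int l * 2 powi m ..< of_int (l + 1) * 2 powi m}"
    by (elim dyadicE)
  show ?thesis
    using *[OF I J] *[OF J I] by (cases "n \<le> m") auto
qed

lemma children_dyadic_interval:
  fixes k n :: int
  assumes "I = {of_int k * 2 powi n ..< of_int (k + 1) * 2 powi n}"
  shows "left_child I = {of_int (2 * k) * 2 powi (n - 1) ..< of_int (2 * k + 1) * 2 powi (n - 1)}"
    and "right_child I = {of_int (2 * k + 1) * 2 powi (n - 1) ..< of_int (2 * k + 1 + 1) * 2 powi (n - 1)}"
proof -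
  have lt: "of_int k * 2 powi n < (of_int (k + 1) * 2 powi n :: real)" by simp
  have p: "(2::real) powi n = 2 * 2 powi (n - 1)"
    by (simp add: power_int_diff)
  show "left_child I = {of_int (2 * k) * 2 powi (n - 1) ..< of_int (2 * k + 1) * 2 powi (n - 1)}"
    unfolding left_child_def assms cInf_atLeastLessThan[OF lt] cSup_atLeastLessThan[OF lt]
    unfolding p by (simp add: algebra_simps add_divide_distrib)
  show "right_child I = {of_int (2 * k + 1) * 2 powi (n - 1) ..< of_int (2 * k + 1 + 1) * 2 powi (n - 1)}"
    unfolding right_child_def assms cInf_atLeastLessThan[OF lt] cSup_atLeastLessThan[OF lt]
    unfolding p by (simp add: algebra_simps add_divide_distrib)
qed

lemma dyadic_children:
  assumes "I \<in> dyadic"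
  shows "left_child I \<in> dyadic" "right_child I \<in> dyadic"
    and "left_child I \<union> right_child I = I" "left_child I \<inter> right_child I = {}"
    and "len (left_child I) = len I / 2" "len (right_child I) = len I / 2"
    and "left_child I \<subset> I" "right_child I \<subset> I"
proof -
  from assms obtain k n :: int where I: "I = {of_int k * 2 powi n ..< of_int (k + 1) * 2 powi n}"
    by (elim dyadicE)
  note ch = children_dyadic_interval[OF I]
  show dy: "left_child I \<in> dyadic" "right_child I \<in> dyadic"
    unfolding ch by (rule dyadicI)+
  have p: "(2::real) powi n = 2 * 2 powi (n - 1)" by (simp add: power_int_diff)
  have p0: "(0::real) < 2 powi (n - 1)" by simp
  show *: "left_child I \<union> right_child I = I" "left_child I \<inter> right_child I = {}"
    unfolding ch unfolding I p using p0 by (auto simp: algebra_simps)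
  show "len (left_child I) = len I / 2" "len (right_child I) = len I / 2"
    unfolding ch unfolding I unfolding len_dyadic unfolding p by simp_all
  show "left_child I \<subset> I" "right_child I \<subset> I"
    using * dyadic_nonempty[OF dy(1)] dyadic_nonempty[OF dy(2)] by auto
qed

lemma len_mono_dyadic: "J \<in> dyadic \<Longrightarrow> I \<in> dyadic \<Longrightarrow> J \<subseteq> I \<Longrightarrow> len J \<le> len I"
  by (rule measure_mono_fmeasurable)
    (auto simp: fmeasurable_def emeasure_dyadic sets_lebesgue_dyadic simp del: emeasure_completion)

lemma Inf_dyadic_mem: "I \<in> dyadic \<Longrightarrow> Inf I \<in> I"
  by (elim dyadicE) (simp add: cInf_atLeastLessThan)

lemma dyadic_psubset_child:
  assumes I: "I \<in> dyadic" and J: "J \<in> dyadic" "J \<subset> I"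
  shows "J \<subseteq> left_child I \<or> J \<subseteq> right_child I"
proof (rule ccontr)
  note ch = dyadic_children[OF I]
  assume not: "\<not> ?thesis"
  then have "left_child I \<subseteq> J \<or> J \<inter> left_child I = {}" "right_child I \<subseteq> J \<or> J \<inter> right_child I = {}"
    using dyadic_cases[OF J(1) ch(1)] dyadic_cases[OF J(1) ch(2)] by auto
  with not ch(3) J(2) have "I \<subseteq> J \<or> J = {}" by blast
  with J dyadic_nonempty show False by auto
qed

lemma dyadic_subset_split:
  assumes I: "I \<in> dyadic"
  shows "{J \<in> dyadic. J \<subset> I} = {J \<in> dyadic. J \<subseteq> left_child I} \<union> {J \<in> dyadic. J \<subseteq> right_child I}"
    and "{J \<in> dyadic. J \<subseteq> I} = insert I {J \<in> dyadic. J \<subset> I}"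
    and "{J \<in> dyadic. J \<subseteq> left_child I} \<inter> {J \<in> dyadic. J \<subseteq> right_child I} = {}"
proof -
  note ch = dyadic_children[OF I]
  show "{J \<in> dyadic. J \<subset> I} = {J \<in> dyadic. J \<subseteq> left_child I} \<union> {J \<in> dyadic. J \<subseteq> right_child I}"
    using dyadic_psubset_child[OF I] ch(7,8) by blast
  show "{J \<in> dyadic. J \<subseteq> I} = insert I {J \<in> dyadic. J \<subset> I}" using I by auto
  show "{J \<in> dyadic. J \<subseteq> left_child I} \<inter> {J \<in> dyadic. J \<subseteq> right_child I} = {}"
    using ch(4) dyadic_nonempty by blast
qed

text \<open>Recursion by depth makes the stopping argument an induction over finite trees, in which
  every sum is finite. Depth 0 is the empty tree, so the truncated sum vanishes there.\<close>

fun descendants :: "nat \<Rightarrow> real set \<Rightarrow> real set set" where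
  "descendants 0 I = {}"
| "descendants (Suc m) I = insert I (descendants m (left_child I) \<union> descendants m (right_child I))"

lemma finite_descendants [simp]: "finite (descendants m I)"
  by (induction m arbitrary: I) auto

text \<open>Generation j below \<open>I\<close> has length \<open>len I / 2 ^ j\<close>, and depth m
  keeps the generations j < m; hence the strict inequality.\<close>

lemma descendants_eq:
  "I \<in> dyadic \<Longrightarrow> descendants m I = {J \<in> dyadic. J \<subseteq> I \<and> len I < 2 ^ m * len J}"
proof (induction m arbitrary: I)
  case 0
  then show ?case using len_mono_dyadic by force
next
  case (Suc m)
  note ch = dyadic_children[OF Suc.prems]
  have "{J \<in> dyadic. J \<subseteq> I \<and> len I < 2 ^ Suc m * len J}
    = {J \<in> {J \<in> dyadic. J \<subseteq> I}. len I < 2 ^ Suc m * len J}" by auto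
  also have "\<dots> = {J. J = I \<and> len I < 2 ^ Suc m * len J}
     \<union> {J \<in> dyadic. J \<subseteq> left_child I \<and> len I < 2 ^ Suc m * len J}
     \<union> {J \<in> dyadic. J \<subseteq> right_child I \<and> len I < 2 ^ Suc m * len J}"
    unfolding dyadic_subset_split(2)[OF Suc.prems] dyadic_subset_split(1)[OF Suc.prems] by blast
  also have "{J. J = I \<and> len I < 2 ^ Suc m * len J} = {I}"
  proof -
    have "1 * len I < 2 ^ Suc m * len I"
      using len_dyadic_pos[OF Suc.prems]
      by (intro mult_strict_right_mono one_less_power) auto
    then show ?thesis by auto
  qed
  finally show ?case
    using Suc.IH[OF ch(1)] Suc.IH[OF ch(2)] ch(5,6) by auto
qed

lemma descendants_dyadic: "I \<in> dyadic \<Longrightarrow> J \<in> descendants m I \<Longrightarrow> J \<in> dyadic \<and> J \<subseteq> I"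
  by (simp add: descendants_eq)

lemma sum_descendants_Suc:
  assumes I: "I \<in> dyadic"
  shows "(\<Sum>J\<in>descendants (Suc m) I. g J) = g I + ((\<Sum>J\<in>descendants m (left_child I). g J)
    + (\<Sum>J\<in>descendants m (right_child I). g J) :: 'b :: comm_monoid_add)"
proof -
  note ch = dyadic_children[OF I]
  have "I \<notin> descendants m (left_child I) \<union> descendants m (right_child I)"
    using descendants_dyadic[OF ch(1)] descendants_dyadic[OF ch(2)] ch(7,8) by blast
  moreover have "descendants m (left_child I) \<inter> descendants m (right_child I) = {}"
    using descendants_dyadic[OF ch(1)] descendants_dyadic[OF ch(2)] dyadic_subset_split(3)[OF I] by blast
  ultimately show ?thesis by (simp add: sum.union_disjoint)
qed

section \<open>Sparse domination by a stopping time\<close>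

lemma cmod_add_sq_le: "(cmod (x + y))\<^sup>2 \<le> 2 * (cmod x)\<^sup>2 + 2 * (cmod y)\<^sup>2"
proof -
  have "(cmod (x + y))\<^sup>2 + (cmod (x - y))\<^sup>2 = 2 * (cmod x)\<^sup>2 + 2 * (cmod y)\<^sup>2"
    unfolding cmod_power2 by (simp add: power2_eq_square algebra_simps)
  then show ?thesis by (smt (verit) zero_le_power2)
qed

text \<open>Here e1, e2 and f1, f2 are the values of e and of the averages on the two children; the two arguments of
  \<open>cmod\<close> on the left are the values of W on the children.\<close>

lemma stopping_increment:
  fixes W f f1 f2 e1 e2 :: complex and A M :: real
  assumes M: "0 \<le> M" "cmod e1 \<le> M" "cmod e2 \<le> M" and A: "0 \<le> A" "cmod f \<le> 4 * A"
    and W: "cmod W \<le> 300 * M * A" and f: "f = (f1 + f2) / 2"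
  shows "((cmod (W - f * ((e1 + e2) / 2) + f1 * e1))\<^sup>2 + (cmod (W - f * ((e1 + e2) / 2) + f2 * e2))\<^sup>2) / 2
    \<le> (cmod W)\<^sup>2 + 303 * M\<^sup>2 * (((cmod f1)\<^sup>2 + (cmod f2)\<^sup>2) / 2 - (cmod f)\<^sup>2) + 332 * A\<^sup>2 * (cmod ((e1 - e2) / 2))\<^sup>2"
proof -
  define d D b where "d = (f1 - f2) / 2" and "D = (e1 - e2) / 2" and "b = (e1 + e2) / 2"
  \<comment> \<open>With each child value written as mean plus or minus half difference, the two new
    values share the drift \<open>d * D\<close> and differ only in the sign of the martingale part
    \<open>f * D + d * b\<close>. The parallelogram identity then removes the cross terms with that
    part.\<close>
  have 1: "W - f * ((e1 + e2) / 2) + f1 * e1 = (W + d * D) + (f * D + d * b)"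
    and 2: "W - f * ((e1 + e2) / 2) + f2 * e2 = (W + d * D) - (f * D + d * b)"
    unfolding d_def D_def b_def f by (simp_all add: field_simps)
  have par: "((cmod (x + y))\<^sup>2 + (cmod (x - y))\<^sup>2) / 2 = (cmod x)\<^sup>2 + (cmod y)\<^sup>2" for x y
    unfolding cmod_power2 by (simp add: power2_eq_square algebra_simps add_divide_distrib diff_divide_distrib)
  have f12: "f1 = f + d" "f2 = f - d" unfolding f d_def by (simp_all add: field_simps)
  have dd: "((cmod f1)\<^sup>2 + (cmod f2)\<^sup>2) / 2 - (cmod f)\<^sup>2 = (cmod d)\<^sup>2"
    unfolding f12 par by simp
  have b: "cmod b \<le> M" using norm_triangle_ineq[of e1 e2] M by (simp add: b_def norm_divide)
  have D: "cmod D \<le> M" using norm_triangle_ineq4[of e1 e2] M by (simp add: D_def norm_divide)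
  have "(cmod (f * D + d * b))\<^sup>2 \<le> 2 * (cmod (f * D))\<^sup>2 + 2 * (cmod (d * b))\<^sup>2"
    by (rule cmod_add_sq_le)
  also have "\<dots> = 2 * (cmod f)\<^sup>2 * (cmod D)\<^sup>2 + 2 * (cmod b)\<^sup>2 * (cmod d)\<^sup>2"
    by (simp add: norm_mult power_mult_distrib)
  also have "\<dots> \<le> 2 * (4 * A)\<^sup>2 * (cmod D)\<^sup>2 + 2 * M\<^sup>2 * (cmod d)\<^sup>2"
    using A b by (intro add_mono mult_right_mono mult_left_mono power_mono) auto
  finally have e1: "(cmod (f * D + d * b))\<^sup>2 \<le> 32 * (A\<^sup>2 * (cmod D)\<^sup>2) + 2 * (M\<^sup>2 * (cmod d)\<^sup>2)"
    by (simp add: power_mult_distrib)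
  have dD: "(cmod (d * D))\<^sup>2 \<le> M\<^sup>2 * (cmod d)\<^sup>2"
    using D by (simp add: norm_mult power_mult_distrib mult.commute mult_right_mono power_mono)
  \<comment> \<open>The only contribution linear in \<open>W\<close> is its cross term with the
    drift. The bound on \<open>W\<close> before stopping, together with 2 x y \<le> x^2 + y^2,
    converts it into the two energies.\<close>
  have "(cmod (W + d * D))\<^sup>2 \<le> (cmod W + cmod (d * D))\<^sup>2"
    by (intro power_mono norm_triangle_ineq) auto
  also have "\<dots> = (cmod W)\<^sup>2 + 2 * (cmod W * cmod (d * D)) + (cmod (d * D))\<^sup>2"
    by (simp add: power2_sum)
  also have "2 * (cmod W * cmod (d * D)) \<le> 2 * (300 * M * A * (cmod d * cmod D))"
    unfolding norm_mult using W by (intro mult_left_mono mult_right_mono) auto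
  also have "\<dots> = 300 * (2 * ((M * cmod d) * (A * cmod D)))" by simp
  also have "\<dots> \<le> 300 * ((M * cmod d)\<^sup>2 + (A * cmod D)\<^sup>2)"
    using sum_squares_bound[of "M * cmod d" "A * cmod D"] by simp
  finally have e2: "(cmod (W + d * D))\<^sup>2 \<le> (cmod W)\<^sup>2 + 301 * (M\<^sup>2 * (cmod d)\<^sup>2) + 300 * (A\<^sup>2 * (cmod D)\<^sup>2)"
    using dD by (simp add: power_mult_distrib)
  show ?thesis
    unfolding 1 2 par dd using e1 e2 by (simp add: D_def)
qed

section \<open>Gluing sparse families\<close>

definition sparse_below :: "real set \<Rightarrow> real set set \<Rightarrow> bool" where
  "sparse_below I S \<longleftrightarrow> finite S \<and> (\<forall>Q\<in>S. Q \<subseteq> I) \<and> sparse_collection (1 / 2) S"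

lemma sparse_below_empty: "sparse_below I {}"
  by (simp add: sparse_below_def sparse_collection_def disjoint_family_on_def)

lemma sparse_below_UN:
  assumes X: "finite X" "disjoint_family_on (\<lambda>K. K) X" and S: "\<And>K. K \<in> X \<Longrightarrow> sparse_below K (S K)"
  shows "sparse_below (\<Union>X) (\<Union>K\<in>X. S K)"
proof -
  have "\<forall>K\<in>X. \<exists>E. (\<forall>Q\<in>S K. E Q \<in> sets lebesgue \<and> E Q \<subseteq> Q \<and> len (E Q) \<ge> 1 / 2 * len Q) \<and> disjoint_family_on E (S K)"
    using S unfolding sparse_below_def sparse_collection_def by blast
  then obtain E where E: "\<And>K Q. K \<in> X \<Longrightarrow> Q \<in> S K \<Longrightarrow> E K Q \<in> sets lebesgue \<and> E K Q \<subseteq> Q \<and> len (E K Q) \<ge> 1 / 2 * len Q"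
    "\<And>K. K \<in> X \<Longrightarrow> disjoint_family_on (E K) (S K)"
    by metis
  \<comment> \<open>\<open>k\<close> assigns every interval to one of the pieces, so that the
    witness sets chosen separately for each \<open>S K\<close> form a single family.\<close>
  define k where "k Q = (SOME K. K \<in> X \<and> Q \<in> S K)" for Q
  have k: "k Q \<in> X \<and> Q \<in> S (k Q)" if "Q \<in> (\<Union>K\<in>X. S K)" for Q
  proof -
    have "\<exists>K. K \<in> X \<and> Q \<in> S K" using that by blast
    from someI_ex[OF this] show ?thesis unfolding k_def .
  qed
  have d: "disjoint_family_on (\<lambda>Q. E (k Q) Q) (\<Union>K\<in>X. S K)"
    unfolding disjoint_family_on_def
  proof (intro ballI impI)
    fix Q R assume QR: "Q \<in> (\<Union>K\<in>X. S K)" "R \<in> (\<Union>K\<in>X. S K)" "Q \<noteq> R"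
    show "E (k Q) Q \<inter> E (k R) R = {}"
    proof (cases "k Q = k R")
      case True
      then show ?thesis
        using E(2)[of "k Q"] k[OF QR(1)] k[OF QR(2)] QR(3) by (simp add: disjoint_family_on_def)
    next
      case False
      have sub: "E (k Q) Q \<subseteq> k Q" if "Q \<in> (\<Union>K\<in>X. S K)" for Q
        using E(1)[of "k Q" Q] k[OF that] S[of "k Q"] unfolding sparse_below_def by blast
      have "k Q \<inter> k R = {}"
        using X(2) False k[OF QR(1)] k[OF QR(2)] by (simp add: disjoint_family_on_def)
      then show ?thesis using sub[OF QR(1)] sub[OF QR(2)] by blast
    qed
  qed
  have e: "\<forall>Q\<in>(\<Union>K\<in>X. S K). E (k Q) Q \<in> sets lebesgue \<and> E (k Q) Q \<subseteq> Q \<and> len (E (k Q) Q) \<ge> 1 / 2 * len Q"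
    using E(1) k by blast
  have "(\<Union>K\<in>X. S K) \<subseteq> dyadic"
    using S unfolding sparse_below_def sparse_collection_def by blast
  then have "sparse_collection (1 / 2) (\<Union>K\<in>X. S K)"
    unfolding sparse_collection_def using d e by (intro conjI exI[of _ "\<lambda>Q. E (k Q) Q"])
  moreover have "finite (\<Union>K\<in>X. S K)" "\<forall>Q\<in>(\<Union>K\<in>X. S K). Q \<subseteq> \<Union>X"
    using X(1) S unfolding sparse_below_def by (simp, blast)
  ultimately show ?thesis unfolding sparse_below_def by blast
qed

text \<open>The part of \<open>I\<close> outside \<open>U\<close> serves as the witness set of
  \<open>I\<close>: it has at least half the length of \<open>I\<close>, and all other witness sets
  lie in \<open>U\<close>.\<close>

lemma sparse_below_insert:
  assumes S: "sparse_below U S" and U: "U \<in> sets lebesgue" "U \<subseteq> I" "len U \<le> len I / 2"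
    and I: "I \<in> dyadic" "I \<notin> S"
  shows "sparse_below I (insert I S)"
proof -
  from S obtain E where E: "\<And>Q. Q \<in> S \<Longrightarrow> E Q \<in> sets lebesgue \<and> E Q \<subseteq> Q \<and> len (E Q) \<ge> 1 / 2 * len Q"
    "disjoint_family_on E S" "finite S" "S \<subseteq> dyadic" "\<And>Q. Q \<in> S \<Longrightarrow> Q \<subseteq> U"
    unfolding sparse_below_def sparse_collection_def by blast
  define E' where "E' = E(I := I - U)"
  have "len (I - U) = len I - len U"
    using I(1) U by (intro measure_Diff) (auto simp: emeasure_dyadic sets_lebesgue_dyadic simp del: emeasure_completion measure_completion)
  then have EI: "1 / 2 * len I \<le> len (I - U)" using U(3) by linarith
  have EU: "E Q \<inter> (I - U) = {}" if "Q \<in> S" for Q using E(1,5)[OF that] by blast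
  have "disjoint_family_on E' (insert I S)"
    unfolding disjoint_family_on_def
  proof (intro ballI impI)
    fix Q R assume QR: "Q \<in> insert I S" "R \<in> insert I S" "Q \<noteq> R"
    then consider "Q = I" "R \<in> S" | "R = I" "Q \<in> S" | "Q \<in> S" "R \<in> S" by blast
    then show "E' Q \<inter> E' R = {}"
    proof cases
      case 1 then show ?thesis using EU[of R] QR(3) by (auto simp: E'_def)
    next
      case 2 then show ?thesis using EU[of Q] QR(3) by (auto simp: E'_def)
    next
      case 3
      then have "Q \<noteq> I" "R \<noteq> I" using I(2) by auto
      then show ?thesis using E(2) 3 QR(3) by (simp add: E'_def disjoint_family_on_def)
    qed
  qed
  moreover have "\<forall>Q\<in>insert I S. E' Q \<in> sets lebesgue \<and> E' Q \<subseteq> Q \<and> len (E' Q) \<ge> 1 / 2 * len Q"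
  proof
    fix Q assume "Q \<in> insert I S"
    then consider "Q = I" | "Q \<in> S" "Q \<noteq> I" using I(2) by blast
    then show "E' Q \<in> sets lebesgue \<and> E' Q \<subseteq> Q \<and> len (E' Q) \<ge> 1 / 2 * len Q"
    proof cases
      case 1
      then show ?thesis using EI U sets_lebesgue_dyadic[OF I(1)] by (simp add: E'_def sets.Diff)
    next
      case 2
      then show ?thesis using E(1)[OF 2(1)] by (simp add: E'_def)
    qed
  qed
  ultimately have "sparse_collection (1 / 2) (insert I S)"
    unfolding sparse_collection_def using E(4) I(1) by blast
  moreover have "\<forall>Q\<in>insert I S. Q \<subseteq> I" using E(5) U(2) by blast
  ultimately show ?thesis using E(3) by (simp add: sparse_below_def)
qed

text \<open>In the application u is the average of |f|, and s I is the normalized sum of the squared Haar differences of e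
  inside I.\<close>

locale dyadic_averages =
  fixes e f :: "real set \<Rightarrow> complex" and u s :: "real set \<Rightarrow> real" and M :: real
  assumes M_pos: "0 < M"
    and e_le: "\<And>I. I \<in> dyadic \<Longrightarrow> cmod (e I) \<le> M"
    and f_split: "\<And>I. I \<in> dyadic \<Longrightarrow> f I = (f (left_child I) + f (right_child I)) / 2"
    and u_split: "\<And>I. I \<in> dyadic \<Longrightarrow> u I = (u (left_child I) + u (right_child I)) / 2"
    and f_le: "\<And>I. I \<in> dyadic \<Longrightarrow> cmod (f I) \<le> u I"
    and s_split: "\<And>I. I \<in> dyadic \<Longrightarrow>
      (cmod ((e (left_child I) - e (right_child I)) / 2))\<^sup>2 + (s (left_child I) + s (right_child I)) / 2 \<le> s I"
    and s_bounds: "\<And>I. I \<in> dyadic \<Longrightarrow> 0 \<le> s I \<and> s I \<le> M\<^sup>2"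
begin

text \<open>For \<open>e = E_seq a\<close> and \<open>f\<close> the averages of a function, this is
  the value on \<open>I\<close> of the summand of the operator, \<open>a I * f I / len I\<close>.
  Expressing it through \<open>e\<close> keeps the stopping argument independent of the
  symbol.\<close>

definition coeff :: "real set \<Rightarrow> complex" where
  "coeff I = f I * (e I - (e (left_child I) + e (right_child I)) / 2)"

definition trunc :: "nat \<Rightarrow> real set \<Rightarrow> real \<Rightarrow> complex" where
  "trunc m I x = (\<Sum>J\<in>descendants m I. coeff J * indicator J x)"

text \<open>The stopping thresholds 4 A and 300 M A give 64 = (2 * 4)^2, since the average of |f| at most doubles in one
  step, and 303 = 300 + 3, 332 = 300 + 2 * 4^2, the constants of \<open>stopping_increment\<close>. The value 300 is large enough
  for the potential at the start to be at most 1 / 2.\<close>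

definition potential :: "real \<Rightarrow> real set \<Rightarrow> complex \<Rightarrow> real" where
  "potential A I W = u I / (4 * A) +
     ((cmod W)\<^sup>2 + 303 * M\<^sup>2 * (64 * A\<^sup>2 - (cmod (f I))\<^sup>2) + 332 * A\<^sup>2 * s I) / (300 * M * A)\<^sup>2"

lemma u_nonneg: "I \<in> dyadic \<Longrightarrow> 0 \<le> u I"
  using f_le[of I] norm_ge_zero[of "f I"] by linarith

lemma trunc_0 [simp]: "trunc 0 I x = 0"
  by (simp add: trunc_def)

lemma trunc_outside:
  assumes "I \<in> dyadic" "x \<notin> I"
  shows "trunc m I x = 0"
  unfolding trunc_def
proof (intro sum.neutral ballI)
  fix J assume "J \<in> descendants m I"
  then have "x \<notin> J" using assms descendants_dyadic by blast
  then show "coeff J * indicator J x = 0" by simp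
qed

lemma trunc_Suc:
  assumes "I \<in> dyadic"
  shows "trunc (Suc m) I x = coeff I * indicator I x + (trunc m (left_child I) x + trunc m (right_child I) x)"
  unfolding trunc_def sum_descendants_Suc[OF assms] ..

text \<open>The two error terms of \<open>stopping_increment\<close> are the mean increase of |f|^2
  and the energy that \<open>s\<close> loses from \<open>I\<close> to its children. The potential
  contains the former with a minus sign and the latter with a plus sign, so both cancel; the term
  with \<open>u\<close> is an exact martingale.\<close>

lemma potential_children:
  assumes I: "I \<in> dyadic" and A: "0 < A" and u: "u I \<le> 4 * A" and W: "cmod W \<le> 300 * M * A"
  defines "V \<equiv> \<lambda>K. W - f I * ((e (left_child I) + e (right_child I)) / 2) + f K * e K"
  shows "(potential A (left_child I) (V (left_child I)) + potential A (right_child I) (V (right_child I))) / 2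
    \<le> potential A I W"
proof -
  note ch = dyadic_children[OF I]
  let ?L = "left_child I" and ?R = "right_child I"
  have inc: "((cmod (V ?L))\<^sup>2 + (cmod (V ?R))\<^sup>2) / 2
    \<le> (cmod W)\<^sup>2 + 303 * M\<^sup>2 * (((cmod (f ?L))\<^sup>2 + (cmod (f ?R))\<^sup>2) / 2 - (cmod (f I))\<^sup>2)
      + 332 * A\<^sup>2 * (cmod ((e ?L - e ?R) / 2))\<^sup>2"
    unfolding V_def
    by (rule stopping_increment[OF less_imp_le[OF M_pos] e_le[OF ch(1)] e_le[OF ch(2)]
      less_imp_le[OF A] order_trans[OF f_le[OF I] u] W f_split[OF I]])
  have s: "332 * A\<^sup>2 * (cmod ((e ?L - e ?R) / 2))\<^sup>2 \<le> 332 * A\<^sup>2 * (s I - (s ?L + s ?R) / 2)"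
    using s_split[OF I] by (intro mult_left_mono) auto
  define N where "N K W = (cmod W)\<^sup>2 + 303 * M\<^sup>2 * (64 * A\<^sup>2 - (cmod (f K))\<^sup>2) + 332 * A\<^sup>2 * s K" for K W
  have "(N ?L (V ?L) + N ?R (V ?R)) / 2 \<le> N I W"
    using inc s unfolding N_def by (simp add: algebra_simps add_divide_distrib diff_divide_distrib)
  then have "((N ?L (V ?L) + N ?R (V ?R)) / 2) / (300 * M * A)\<^sup>2 \<le> N I W / (300 * M * A)\<^sup>2"
    by (rule divide_right_mono) simp
  moreover have pot: "potential A K W = u K / (4 * A) + N K W / (300 * M * A)\<^sup>2" for K W
    by (simp add: potential_def N_def)
  have "(potential A ?L (V ?L) + potential A ?R (V ?R)) / 2
    = u I / (4 * A) + ((N ?L (V ?L) + N ?R (V ?R)) / 2) / (300 * M * A)\<^sup>2"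
    unfolding pot u_split[OF I] by (simp add: add_divide_distrib mult.commute)
  ultimately show ?thesis unfolding pot by linarith
qed

text \<open>Either stopping condition alone lifts its own summand to 1, and the bound on
  \<open>f I\<close> keeps the others nonnegative. Hence the potential dominates the indicator of
  being stopped, which is what bounds the total length of stopped intervals.\<close>

lemma potential_ge:
  assumes I: "I \<in> dyadic" and A: "0 < A" and f: "cmod (f I) \<le> 8 * A"
  shows "0 \<le> potential A I W"
    and "4 * A < u I \<or> 300 * M * A < cmod W \<Longrightarrow> 1 \<le> potential A I W"
proof -
  have "(cmod (f I))\<^sup>2 \<le> (8 * A)\<^sup>2" using f by (intro power_mono) auto
  then have r: "0 \<le> 303 * M\<^sup>2 * (64 * A\<^sup>2 - (cmod (f I))\<^sup>2) + 332 * A\<^sup>2 * s I"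
    using s_bounds[OF I] by (intro add_nonneg_nonneg mult_nonneg_nonneg) (auto simp: power_mult_distrib)
  have MA: "0 < 300 * M * A" using M_pos A by simp
  have "0 \<le> ((cmod W)\<^sup>2 + 303 * M\<^sup>2 * (64 * A\<^sup>2 - (cmod (f I))\<^sup>2) + 332 * A\<^sup>2 * s I) / (300 * M * A)\<^sup>2"
    using r zero_le_power2[of "cmod W"] by (intro divide_nonneg_nonneg) (linarith, simp)
  then show "0 \<le> potential A I W"
    unfolding potential_def using u_nonneg[OF I] A by simp
  assume "4 * A < u I \<or> 300 * M * A < cmod W"
  then show "1 \<le> potential A I W"
  proof
    assume "4 * A < u I"
    then have "1 \<le> u I / (4 * A)" using A by simp
    moreover have "0 \<le> ((cmod W)\<^sup>2 + 303 * M\<^sup>2 * (64 * A\<^sup>2 - (cmod (f I))\<^sup>2) + 332 * A\<^sup>2 * s I) / (300 * M * A)\<^sup>2"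
      using r zero_le_power2[of "cmod W"] by (intro divide_nonneg_nonneg) (linarith, simp)
    ultimately show ?thesis unfolding potential_def by linarith
  next
    assume "300 * M * A < cmod W"
    then have "(300 * M * A)\<^sup>2 \<le> (cmod W)\<^sup>2" using MA by (intro power_mono) auto
    moreover have pos: "0 < (300 * M * A)\<^sup>2" using MA by (intro zero_less_power)
    ultimately have "1 \<le> ((cmod W)\<^sup>2 + 303 * M\<^sup>2 * (64 * A\<^sup>2 - (cmod (f I))\<^sup>2) + 332 * A\<^sup>2 * s I) / (300 * M * A)\<^sup>2"
      unfolding le_divide_eq_1_pos[OF pos] using r by linarith
    moreover have "0 \<le> u I / (4 * A)" using u_nonneg[OF I] A by simp
    ultimately show ?thesis unfolding potential_def by linarith
  qed
qed

text \<open>X consists of the stopped intervals inside J and n K is the depth that remains below K. The complex number W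
  carries the history: \<open>W - f J * e J\<close> is the part of the truncated sum collected strictly above J.\<close>

definition stopping :: "real \<Rightarrow> nat \<Rightarrow> real set \<Rightarrow> complex \<Rightarrow> real set set \<Rightarrow> (real set \<Rightarrow> nat) \<Rightarrow> bool" where
  "stopping A m J W X n \<longleftrightarrow> finite X \<and> X \<subseteq> dyadic \<and> (\<forall>K\<in>X. K \<subseteq> J \<and> n K \<le> m) \<and>
    disjoint_family_on (\<lambda>K. K) X \<and> (\<Sum>K\<in>X. len K) \<le> len J * potential A J W \<and>
    (u J \<le> 4 * A \<and> cmod W \<le> 300 * M * A \<longrightarrow> (\<forall>K\<in>X. n K < m \<and> K \<subset> J)) \<and>
    (\<forall>x\<in>J - \<Union>X. cmod (W - f J * e J + trunc m J x) \<le> 304 * M * A) \<and>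
    (\<forall>K\<in>X. \<forall>x\<in>K. cmod (W - f J * e J + trunc m J x - trunc (n K) K x) \<le> 304 * M * A) \<and>
    (\<forall>K\<in>descendants m J. u K \<le> 4 * A \<or> (\<exists>K'\<in>X. K \<in> descendants (n K') K'))"

text \<open>The last two hypotheses are exactly what an unstopped parent guarantees for a child:
  averages at most double in one step, and the sum collected above \<open>J\<close> is bounded. Thus
  even a stopped \<open>J\<close> satisfies the required estimates, with itself as the only member
  of \<open>X\<close>, and otherwise the families of the two children are united.\<close>

lemma stopping_family:
  assumes "J \<in> dyadic" "0 < A" "cmod (f J) \<le> 8 * A" "cmod (W - f J * e J) \<le> 304 * M * A"
  shows "\<exists>X n. stopping A m J W X n"
  using assms
proof (induction m arbitrary: J W)
  case (0 J W)
  note J = \<open>J \<in> dyadic\<close> and A = \<open>0 < A\<close>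
  show ?case
  proof (cases "4 * A < u J \<or> 300 * M * A < cmod W")
    case True
    then show ?thesis using 0 potential_ge(2)[OF J A 0(3), of W] len_dyadic_pos[OF J]
      by (intro exI[of _ "{J}"] exI[of _ "\<lambda>_. 0"])
        (auto simp: stopping_def disjoint_family_on_def simp del: measure_completion)
  next
    case False
    show ?thesis
      using 0 potential_ge(1)[OF J A 0(3), of W] len_dyadic_pos[OF J]
      by (intro exI[of _ "{}"] exI[of _ "\<lambda>_. 0"])
        (auto simp: stopping_def disjoint_family_on_def simp del: measure_completion)
  qed
next
  case (Suc m J W)
  note J = \<open>J \<in> dyadic\<close> and A = \<open>0 < A\<close>
  note ch = dyadic_children[OF J]
  show ?case
  proof (cases "4 * A < u J \<or> 300 * M * A < cmod W")
    case True
    then show ?thesis using Suc.prems potential_ge(2)[OF J A Suc.prems(3), of W] len_dyadic_pos[OF J]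
      by (intro exI[of _ "{J}"] exI[of _ "\<lambda>_. Suc m"])
        (auto simp: stopping_def disjoint_family_on_def simp del: measure_completion)
  next
    case False
    then have good: "u J \<le> 4 * A" "cmod W \<le> 300 * M * A" by auto
    let ?L = "left_child J" and ?R = "right_child J"
    define b where "b = W - f J * ((e ?L + e ?R) / 2)"
    \<comment> \<open>This is the origin of 304: the threshold gives 300 for \<open>W\<close>, and
      the average of \<open>f\<close> times the mean of \<open>e\<close> adds at most 4.\<close>
    have b: "cmod b \<le> 304 * M * A"
    proof -
      have "cmod ((e ?L + e ?R) / 2) \<le> M"
        using norm_triangle_ineq[of "e ?L" "e ?R"] e_le[OF ch(1)] e_le[OF ch(2)] by (simp add: norm_divide)
      then have "cmod (f J * ((e ?L + e ?R) / 2)) \<le> (4 * A) * M"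
        unfolding norm_mult using f_le[OF J] good A M_pos by (intro mult_mono) auto
      then show ?thesis
        using norm_triangle_ineq4[of W "f J * ((e ?L + e ?R) / 2)"] good unfolding b_def by (simp add: algebra_simps)
    qed
    \<comment> \<open>Adding the summand of \<open>J\<close> merely replaces \<open>e J\<close> by
      the mean of \<open>e\<close> over the children, so both children inherit the same history
      \<open>b\<close>.\<close>
    have bc: "W - f J * e J + coeff J = b" by (simp add: b_def coeff_def algebra_simps)
    have uLR: "u ?L \<le> 8 * A" "u ?R \<le> 8 * A"
      using u_split[OF J] u_nonneg[OF ch(1)] u_nonneg[OF ch(2)] good by auto
    have h1: "cmod (f ?L) \<le> 8 * A" "cmod (b + f ?L * e ?L - f ?L * e ?L) \<le> 304 * M * A"
      using f_le[OF ch(1)] uLR b by auto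
    obtain X1 n1 where stop: "stopping A m ?L (b + f ?L * e ?L) X1 n1"
      using Suc.IH[OF ch(1) A h1] by auto
    have X1: "finite X1" "X1 \<subseteq> dyadic" "\<And>K. K \<in> X1 \<Longrightarrow> K \<subseteq> ?L \<and> n1 K \<le> m"
      "disjoint_family_on (\<lambda>K. K) X1" "(\<Sum>K\<in>X1. len K) \<le> len ?L * potential A ?L (b + f ?L * e ?L)"
      "\<And>x. x \<in> ?L - \<Union>X1 \<Longrightarrow> cmod (b + trunc m ?L x) \<le> 304 * M * A"
      "\<And>K x. K \<in> X1 \<Longrightarrow> x \<in> K \<Longrightarrow> cmod (b + trunc m ?L x - trunc (n1 K) K x) \<le> 304 * M * A"
      "\<And>K. K \<in> descendants m ?L \<Longrightarrow> u K \<le> 4 * A \<or> (\<exists>K'\<in>X1. K \<in> descendants (n1 K') K')"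
      using stop unfolding stopping_def add_diff_cancel_right' by blast+
    have h2: "cmod (f ?R) \<le> 8 * A" "cmod (b + f ?R * e ?R - f ?R * e ?R) \<le> 304 * M * A"
      using f_le[OF ch(2)] uLR b by auto
    obtain X2 n2 where stop: "stopping A m ?R (b + f ?R * e ?R) X2 n2"
      using Suc.IH[OF ch(2) A h2] by auto
    have X2: "finite X2" "X2 \<subseteq> dyadic" "\<And>K. K \<in> X2 \<Longrightarrow> K \<subseteq> ?R \<and> n2 K \<le> m"
      "disjoint_family_on (\<lambda>K. K) X2" "(\<Sum>K\<in>X2. len K) \<le> len ?R * potential A ?R (b + f ?R * e ?R)"
      "\<And>x. x \<in> ?R - \<Union>X2 \<Longrightarrow> cmod (b + trunc m ?R x) \<le> 304 * M * A"
      "\<And>K x. K \<in> X2 \<Longrightarrow> x \<in> K \<Longrightarrow> cmod (b + trunc m ?R x - trunc (n2 K) K x) \<le> 304 * M * A"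
      "\<And>K. K \<in> descendants m ?R \<Longrightarrow> u K \<le> 4 * A \<or> (\<exists>K'\<in>X2. K \<in> descendants (n2 K') K')"
      using stop unfolding stopping_def add_diff_cancel_right' by blast+
    define n where "n K = (if K \<in> X1 then n1 K else n2 K)" for K
    have X12: "X1 \<inter> X2 = {}"
      using X1(2,3) X2(3) ch(4) dyadic_nonempty by fastforce
    have n: "\<And>K. K \<in> X1 \<Longrightarrow> n K = n1 K" "\<And>K. K \<in> X2 \<Longrightarrow> n K = n2 K"
      using X12 by (auto simp: n_def)
    have TL: "W - f J * e J + trunc (Suc m) J x = b + trunc m ?L x" if "x \<in> ?L" for x
    proof -
      have "x \<in> J" "x \<notin> ?R" using that ch(3,4) by auto
      then show ?thesis using trunc_outside[OF ch(2), of x m] by (simp add: trunc_Suc[OF J] bc[symmetric])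
    qed
    have TR: "W - f J * e J + trunc (Suc m) J x = b + trunc m ?R x" if "x \<in> ?R" for x
    proof -
      have "x \<in> J" "x \<notin> ?L" using that ch(3,4) by auto
      then show ?thesis using trunc_outside[OF ch(1), of x m] by (simp add: trunc_Suc[OF J] bc[symmetric])
    qed
    have sub: "n K < Suc m \<and> K \<subset> J" if "K \<in> X1 \<union> X2" for K
    proof (cases "K \<in> X1")
      case True
      then show ?thesis using X1(3)[OF True] n(1)[OF True] subset_psubset_trans[OF _ ch(7), of K] by (simp add: less_Suc_eq_le)
    next
      case False
      then have K: "K \<in> X2" using that by simp
      then show ?thesis using X2(3)[OF K] n(2)[OF K] subset_psubset_trans[OF _ ch(8), of K] by (simp add: less_Suc_eq_le)
    qed
    show ?thesis
      unfolding stopping_def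
    proof (intro exI[of _ "X1 \<union> X2"] exI[of _ n] conjI)
      show "finite (X1 \<union> X2)" "X1 \<union> X2 \<subseteq> dyadic" using X1 X2 by auto
      show "\<forall>K\<in>X1 \<union> X2. K \<subseteq> J \<and> n K \<le> Suc m"
        using sub by (auto simp: less_imp_le)
      show "u J \<le> 4 * A \<and> cmod W \<le> 300 * M * A \<longrightarrow> (\<forall>K\<in>X1 \<union> X2. n K < Suc m \<and> K \<subset> J)"
        using sub by (auto simp: less_imp_le)
      show "disjoint_family_on (\<lambda>K. K) (X1 \<union> X2)"
        unfolding disjoint_family_on_def
      proof (intro ballI impI)
        fix K K' assume K: "K \<in> X1 \<union> X2" "K' \<in> X1 \<union> X2" "K \<noteq> K'"
        then consider "K \<in> X1" "K' \<in> X1" | "K \<in> X2" "K' \<in> X2" | "K \<in> X1" "K' \<in> X2" | "K \<in> X2" "K' \<in> X1"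
          by auto
        then show "K \<inter> K' = {}"
        proof cases
          case 1 then show ?thesis using X1(4) K(3) by (auto simp: disjoint_family_on_def)
        next
          case 2 then show ?thesis using X2(4) K(3) by (auto simp: disjoint_family_on_def)
        next
          case 3 then show ?thesis using X1(3) X2(3) ch(4) by blast
        next
          case 4 then show ?thesis using X1(3) X2(3) ch(4) by blast
        qed
      qed
      have "(\<Sum>K\<in>X1 \<union> X2. len K) = (\<Sum>K\<in>X1. len K) + (\<Sum>K\<in>X2. len K)"
        using X1(1) X2(1) X12 by (rule sum.union_disjoint)
      also have "\<dots> \<le> len J * ((potential A ?L (b + f ?L * e ?L) + potential A ?R (b + f ?R * e ?R)) / 2)"
        using X1(5) X2(5) unfolding ch(5,6) by (simp add: algebra_simps add_divide_distrib)
      also have "\<dots> \<le> len J * potential A J W"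
        using potential_children[OF J A good] len_dyadic_pos[OF J] unfolding b_def
        by (intro mult_left_mono) auto
      finally show "(\<Sum>K\<in>X1 \<union> X2. len K) \<le> len J * potential A J W" .
      show "\<forall>x\<in>J - \<Union>(X1 \<union> X2). cmod (W - f J * e J + trunc (Suc m) J x) \<le> 304 * M * A"
      proof
        fix x assume x: "x \<in> J - \<Union>(X1 \<union> X2)"
        then consider "x \<in> ?L" "x \<in> ?L - \<Union>X1" | "x \<in> ?R" "x \<in> ?R - \<Union>X2" using ch(3) by blast
        then show "cmod (W - f J * e J + trunc (Suc m) J x) \<le> 304 * M * A"
          by cases (simp_all only: TL TR X1(6) X2(6))
      qed
      show "\<forall>K\<in>X1 \<union> X2. \<forall>x\<in>K. cmod (W - f J * e J + trunc (Suc m) J x - trunc (n K) K x) \<le> 304 * M * A"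
      proof (intro ballI)
        fix K x assume "K \<in> X1 \<union> X2" and x: "x \<in> K"
        then consider "K \<in> X1" | "K \<in> X2" by auto
        then show "cmod (W - f J * e J + trunc (Suc m) J x - trunc (n K) K x) \<le> 304 * M * A"
        proof cases
          case 1
          with x X1(3) have "x \<in> ?L" by auto
          then show ?thesis using TL n(1)[OF 1] X1(7)[OF 1 x] by simp
        next
          case 2
          with x X2(3) have "x \<in> ?R" by auto
          then show ?thesis using TR n(2)[OF 2] X2(7)[OF 2 x] by simp
        qed
      qed
      show "\<forall>K\<in>descendants (Suc m) J. u K \<le> 4 * A \<or> (\<exists>K'\<in>X1 \<union> X2. K \<in> descendants (n K') K')"
      proof
        fix K assume "K \<in> descendants (Suc m) J"
        then consider "K = J" | "K \<in> descendants m ?L" | "K \<in> descendants m ?R" by auto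
        then show "u K \<le> 4 * A \<or> (\<exists>K'\<in>X1 \<union> X2. K \<in> descendants (n K') K')"
        proof cases
          case 1 then show ?thesis using good by simp
        next
          case 2 then show ?thesis using X1(8)[OF 2] n(1) by (metis UnI1)
        next
          case 3 then show ?thesis using X2(8)[OF 3] n(2) by (metis UnI2)
        qed
      qed
    qed
  qed
qed

lemma u_zero_descendants:
  assumes "I \<in> dyadic" "u I = 0" "J \<in> descendants m I"
  shows "u J = 0"
  using assms
proof (induction m arbitrary: I)
  case (Suc m)
  note ch = dyadic_children[OF Suc.prems(1)]
  have "u (left_child I) = 0" "u (right_child I) = 0"
    using u_split[OF Suc.prems(1)] u_nonneg[OF ch(1)] u_nonneg[OF ch(2)] Suc.prems(2) by auto
  then show ?case using Suc.IH[OF ch(1)] Suc.IH[OF ch(2)] Suc.prems by auto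
qed simp

text \<open>The induction is on depth: \<open>I\<close> itself does not stop for
  \<open>A = u I\<close>, so every stopped interval restarts with a strictly smaller depth. If
  \<open>u I\<close> is 0 there is no positive threshold, but then everything below \<open>I\<close>
  vanishes. The last conclusion controls the dyadic maximal function and is kept for the convergence
  proof.\<close>

lemma sparse_domination:
  assumes "I \<in> dyadic"
  shows "\<exists>S. sparse_below I S \<and>
    (\<forall>x. cmod (trunc m I x) \<le> 304 * M * (\<Sum>Q\<in>S. u Q * indicator Q x)) \<and>
    (\<forall>K\<in>descendants m I. \<forall>x\<in>K. u K \<le> 4 * (\<Sum>Q\<in>S. u Q * indicator Q x))"
  using assms
proof (induction m arbitrary: I rule: less_induct)
  case (less m I)
  note I = \<open>I \<in> dyadic\<close>
  show ?case
  proof (cases "u I = 0")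
    case True
    have "trunc m I x = 0" for x
      unfolding trunc_def
    proof (intro sum.neutral ballI)
      fix J assume J: "J \<in> descendants m I"
      then have "f J = 0"
        using f_le[of J] u_zero_descendants[OF I True J] descendants_dyadic[OF I J] by simp
      then show "coeff J * indicator J x = 0" by (simp add: coeff_def)
    qed
    then show ?thesis
      using sparse_below_empty u_zero_descendants[OF I True] by (intro exI[of _ "{}"]) auto
  next
    case False
    define A where "A = u I"
    have A: "0 < A" using False u_nonneg[OF I] by (simp add: A_def)
    \<comment> \<open>At the top no sum has been collected yet, so the history
      \<open>W - f I * e I\<close> is 0.\<close>
    define W where "W = f I * e I"
    have fI: "cmod (f I) \<le> A" using f_le[OF I] by (simp add: A_def)
    have W: "cmod W \<le> M * A"
      unfolding W_def norm_mult using fI e_le[OF I] A by (subst mult.commute) (intro mult_mono, auto)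
    have MA: "0 < M * A" using M_pos A by simp
    have "cmod (f I) \<le> 8 * A" "cmod (W - f I * e I) \<le> 304 * M * A"
      using fI A MA by (simp_all add: W_def less_imp_le mult.commute)
    then obtain X n where st: "stopping A m I W X n"
      using stopping_family[OF I A] by blast
    have X: "finite X" "X \<subseteq> dyadic" "disjoint_family_on (\<lambda>K. K) X"
      and sum: "(\<Sum>K\<in>X. len K) \<le> len I * potential A I W"
      using st by (auto simp: stopping_def)
    have "u I \<le> 4 * A \<and> cmod W \<le> 300 * M * A" using A W MA by (simp add: A_def)
    then have small: "\<And>K. K \<in> X \<Longrightarrow> n K < m \<and> K \<subset> I"
      using st by (auto simp: stopping_def)
    have out: "\<And>x. x \<in> I - \<Union>X \<Longrightarrow> cmod (trunc m I x) \<le> 304 * M * A"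
      and inn: "\<And>K x. K \<in> X \<Longrightarrow> x \<in> K \<Longrightarrow> cmod (trunc m I x - trunc (n K) K x) \<le> 304 * M * A"
      and mx: "\<And>K. K \<in> descendants m I \<Longrightarrow> u K \<le> 4 * A \<or> (\<exists>K'\<in>X. K \<in> descendants (n K') K')"
      using st unfolding stopping_def W_def by simp_all
    \<comment> \<open>The term with \<open>u\<close> is exactly 1 / 4. The rest is at most (1 + 303
      * 64 + 332) / 300^2 = 19725 / 90000, which is below 1 / 4.\<close>
    have pot: "potential A I W \<le> 1 / 2"
    proof -
      have 1: "(cmod W)\<^sup>2 \<le> (M * A)\<^sup>2" using W by (intro power_mono) auto
      have "303 * M\<^sup>2 * (64 * A\<^sup>2 - (cmod (f I))\<^sup>2) \<le> 303 * M\<^sup>2 * (64 * A\<^sup>2)"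
        by (intro mult_left_mono) auto
      then have 2: "303 * M\<^sup>2 * (64 * A\<^sup>2 - (cmod (f I))\<^sup>2) \<le> 19392 * (M * A)\<^sup>2"
        by (simp add: power_mult_distrib)
      have "332 * A\<^sup>2 * s I \<le> 332 * A\<^sup>2 * M\<^sup>2"
        using s_bounds[OF I] by (intro mult_left_mono) auto
      then have 3: "332 * A\<^sup>2 * s I \<le> 332 * (M * A)\<^sup>2" by (simp add: power_mult_distrib mult_ac)
      have "(cmod W)\<^sup>2 + 303 * M\<^sup>2 * (64 * A\<^sup>2 - (cmod (f I))\<^sup>2) + 332 * A\<^sup>2 * s I
        \<le> (M * A)\<^sup>2 + 19392 * (M * A)\<^sup>2 + 332 * (M * A)\<^sup>2"
        by (intro add_mono 1 2 3)
      also have "\<dots> \<le> 1 / 4 * (300 * M * A)\<^sup>2" by (simp add: power_mult_distrib)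
      finally have "((cmod W)\<^sup>2 + 303 * M\<^sup>2 * (64 * A\<^sup>2 - (cmod (f I))\<^sup>2) + 332 * A\<^sup>2 * s I) / (300 * M * A)\<^sup>2 \<le> 1 / 4"
        using MA by (subst pos_divide_le_eq) auto
      moreover have "u I / (4 * A) = 1 / 4" using A by (simp add: A_def)
      ultimately show ?thesis unfolding potential_def by linarith
    qed
    have half: "(\<Sum>K\<in>X. len K) \<le> len I / 2"
      using sum mult_left_mono[OF pot, of "len I"] len_dyadic_pos[OF I] by linarith
    have "\<forall>K\<in>X. \<exists>S. sparse_below K S \<and>
      (\<forall>x. cmod (trunc (n K) K x) \<le> 304 * M * (\<Sum>Q\<in>S. u Q * indicator Q x)) \<and>
      (\<forall>K'\<in>descendants (n K) K. \<forall>x\<in>K'. u K' \<le> 4 * (\<Sum>Q\<in>S. u Q * indicator Q x))"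
      using less.IH small X(2) by blast
    from bchoice[OF this] obtain S where "\<forall>K\<in>X. sparse_below K (S K) \<and>
      (\<forall>x. cmod (trunc (n K) K x) \<le> 304 * M * (\<Sum>Q\<in>S K. u Q * indicator Q x)) \<and>
      (\<forall>K'\<in>descendants (n K) K. \<forall>x\<in>K'. u K' \<le> 4 * (\<Sum>Q\<in>S K. u Q * indicator Q x))"
      ..
    then have S: "\<And>K. K \<in> X \<Longrightarrow> sparse_below K (S K)"
      "\<And>K x. K \<in> X \<Longrightarrow> cmod (trunc (n K) K x) \<le> 304 * M * (\<Sum>Q\<in>S K. u Q * indicator Q x)"
      "\<And>K K' x. K \<in> X \<Longrightarrow> K' \<in> descendants (n K) K \<Longrightarrow> x \<in> K' \<Longrightarrow> u K' \<le> 4 * (\<Sum>Q\<in>S K. u Q * indicator Q x)"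
      by blast+
    define SS where "SS = (\<Union>K\<in>X. S K)"
    have U: "\<Union>X \<in> sets lebesgue" using X by (intro sets.finite_Union) (auto intro: sets_lebesgue_dyadic)
    have lenU: "len (\<Union>X) \<le> len I / 2"
    proof -
      have "len (\<Union>K\<in>X. K) \<le> (\<Sum>K\<in>X. len K)"
        using X by (intro measure_UNION_le) (auto intro: sets_lebesgue_dyadic)
      then show ?thesis using half by simp
    qed
    have sSS: "sparse_below (\<Union>X) SS" unfolding SS_def using sparse_below_UN[OF X(1,3)] S(1) by blast
    have ISS: "I \<notin> SS"
      using S(1) small unfolding SS_def sparse_below_def by blast
    have spI: "sparse_below I (insert I SS)"
      using small by (intro sparse_below_insert[OF sSS U _ lenU I ISS]) blast
    have SSdy: "SS \<subseteq> dyadic" and fSS: "finite SS"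
      using sSS by (auto simp: sparse_below_def sparse_collection_def)
    have sumI: "(\<Sum>Q\<in>insert I SS. u Q * indicator Q x) = A * indicator I x + (\<Sum>Q\<in>SS. u Q * indicator Q x)" for x
      unfolding sum.insert[OF fSS ISS] A_def ..
    have sumSS: "(\<Sum>Q\<in>S K. u Q * indicator Q x) \<le> (\<Sum>Q\<in>SS. u Q * indicator Q x)" if "K \<in> X" for K x
      using that fSS SSdy u_nonneg by (intro sum_mono2) (auto simp: SS_def)
    have SS0: "0 \<le> (\<Sum>Q\<in>SS. u Q * indicator Q x)" for x
      using SSdy u_nonneg by (intro sum_nonneg) auto
    have dom: "cmod (trunc m I x) \<le> 304 * M * (\<Sum>Q\<in>insert I SS. u Q * indicator Q x)" for x
    proof -
      consider "x \<notin> I" | "x \<in> I - \<Union>X" | K where "K \<in> X" "x \<in> K" by blast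
      then show ?thesis
      proof cases
        case 1
        then show ?thesis using trunc_outside[OF I 1] SS0 M_pos by (simp add: sumI)
      next
        case 2
        have "304 * M * A \<le> 304 * M * (A + (\<Sum>Q\<in>SS. u Q * indicator Q x))"
          using SS0 M_pos by (intro mult_left_mono) auto
        then show ?thesis using out[OF 2] 2 unfolding sumI by simp
      next
        case 3
        then have x: "x \<in> I" using small by blast
        have "cmod (trunc m I x) \<le> 304 * M * A + cmod (trunc (n K) K x)"
          using inn[OF 3] norm_triangle_sub[of "trunc m I x" "trunc (n K) K x"] by linarith
        also have "\<dots> \<le> 304 * M * A + 304 * M * (\<Sum>Q\<in>S K. u Q * indicator Q x)"
          using S(2)[OF 3(1)] by simp
        also have "\<dots> \<le> 304 * M * A + 304 * M * (\<Sum>Q\<in>SS. u Q * indicator Q x)"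
          using sumSS[OF 3(1)] M_pos by simp
        finally show ?thesis using x unfolding sumI by (simp add: distrib_left)
      qed
    qed
    have "u K \<le> 4 * (\<Sum>Q\<in>insert I SS. u Q * indicator Q x)" if K: "K \<in> descendants m I" and x: "x \<in> K" for K x
    proof -
      have xI: "x \<in> I" using descendants_dyadic[OF I K] x by blast
      from mx[OF K] consider "u K \<le> 4 * A" | K' where "K' \<in> X" "K \<in> descendants (n K') K'" by blast
      then show ?thesis
      proof cases
        case 1
        then show ?thesis using SS0[of x] xI unfolding sumI by simp
      next
        case 2
        then show ?thesis using S(3)[OF 2 x] sumSS[OF 2(1), of x] A xI unfolding sumI by simp
      qed
    qed
    with spI dom show ?thesis by blast
  qed
qed

end

section \<open>Sparse operators on weighted spaces\<close>

lemma sigma_finite_lebesgue: "sigma_finite_measure (lebesgue :: real measure)"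
proof
  obtain A :: "nat \<Rightarrow> real set" where A: "range A \<subseteq> sets lborel" "(\<Union>i. A i) = space lborel" "\<And>i. emeasure lborel (A i) \<noteq> \<infinity>"
    using lborel.sigma_finite by blast
  show "\<exists>A::real set set. countable A \<and> A \<subseteq> sets lebesgue \<and> \<Union>A = space lebesgue \<and> (\<forall>a\<in>A. emeasure lebesgue a \<noteq> \<infinity>)"
    using A by (intro exI[of _ "range A"]) auto
qed

lemma sigma_finite_density_real:
  assumes "v \<in> borel_measurable lebesgue"
  shows "sigma_finite_measure (density lebesgue (\<lambda>x::real. ennreal (v x)))"
  using sigma_finite_measure.sigma_finite_iff_density_finite[OF sigma_finite_lebesgue, of "\<lambda>x. ennreal (v x)"] assms
  by simp

text \<open>The nonnegative integral makes this nonnegative for every argument. An infinite integral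
  would yield 0; \<open>local_integral_finite\<close> excludes that case on dyadic intervals for
  functions in the weighted space.\<close>

definition ravg :: "(real \<Rightarrow> real) \<Rightarrow> real set \<Rightarrow> real" where
  "ravg f Q = enn2real (\<integral>\<^sup>+x\<in>Q. ennreal (f x) \<partial>lebesgue) / len Q"

lemma ravg_nonneg: "0 \<le> ravg f Q"
  by (simp add: ravg_def)

locale Ap_weight =
  fixes p :: real and w :: "real \<Rightarrow> real"
  assumes p: "1 < p" and w: "w \<in> Ap p"
begin

text \<open>The conjugate weight satisfies \<open>w powr (1 / p) * dual_weight powr (1 / q) = 1\<close>, so one has
  \<open>dual_weight powr (1 - p) = w\<close>, which turns functions in the weighted space into functions with the dual weight
  as measure.\<close>

definition q :: real where "q = conj_exp p"
definition dual_weight :: "real \<Rightarrow> real" where "dual_weight x = w x powr (- q / p)"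
definition w_mass :: "real set \<Rightarrow> real" where "w_mass A = enn2real (\<integral>\<^sup>+x\<in>A. ennreal (w x) \<partial>lebesgue)"
definition dual_mass :: "real set \<Rightarrow> real" where "dual_mass A = enn2real (\<integral>\<^sup>+x\<in>A. ennreal (dual_weight x) \<partial>lebesgue)"

lemma q: "1 < q" "1 / p + 1 / q = 1" "p / q = p - 1" "q / p = q - 1" "(p - 1) * q = p" "1 / q = (p - 1) / p" "q / p = 1 / (p - 1)"
  using p unfolding q_def conj_exp_def by (auto simp: field_simps)

lemma w_meas [measurable]: "w \<in> borel_measurable lebesgue" and w_nonneg: "0 \<le> w x"
  and w_pos: "AE x in lebesgue. 0 < w x" and w_int: "set_integrable lebesgue {a..b} w"
  using w by (auto simp: Ap_def weight_def)

lemma dual_weight_meas [measurable]: "dual_weight \<in> borel_measurable lebesgue" and dual_weight_nonneg: "0 \<le> dual_weight x"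
  unfolding dual_weight_def by measurable

lemma dyadic_Icc:
  assumes "Q \<in> dyadic"
  obtains a b where "a < b" "Q = {a..<b}" "len Q = b - a"
  using assms
proof (elim dyadicE)
  fix k n :: int assume Q: "Q = {of_int k * 2 powi n ..< of_int (k + 1) * 2 powi n}"
  show ?thesis
    by (rule that[OF _ Q]) (simp_all only: Q len_dyadic, simp_all add: algebra_simps)
qed

lemma powr_product_one: "0 < w x \<Longrightarrow> w x powr (1 / p) * dual_weight x powr (1 / q) = 1"
  using q p by (simp add: dual_weight_def powr_powr powr_add[symmetric] powr_minus[symmetric] field_simps)

lemma w_mass_finite: "Q \<in> dyadic \<Longrightarrow> (\<integral>\<^sup>+x\<in>Q. ennreal (w x) \<partial>lebesgue) < \<infinity>"
proof (elim dyadic_Icc)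
  fix a b assume Q: "Q = {a..<b}"
  have "(\<integral>\<^sup>+x\<in>Q. ennreal (w x) \<partial>lebesgue) \<le> (\<integral>\<^sup>+x\<in>{a..b}. ennreal (w x) \<partial>lebesgue)"
    unfolding Q by (intro nn_integral_mono) (auto split: split_indicator)
  also have "\<dots> = (\<integral>\<^sup>+x. ennreal (norm (indicator {a..b} x *\<^sub>R w x)) \<partial>lebesgue)"
    using w_nonneg by (intro nn_integral_cong) (auto split: split_indicator)
  also have "\<dots> < \<infinity>"
    using w_int[of a b] unfolding set_integrable_def integrable_iff_bounded by blast
  finally show ?thesis .
qed

lemma pos_integral:
  assumes E: "E \<in> sets lebesgue" "0 < emeasure lebesgue E" and v: "v \<in> borel_measurable lebesgue"
    and pos: "AE x in lebesgue. 0 < v x"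
  shows "0 < (\<integral>\<^sup>+x\<in>E. ennreal (v x) \<partial>lebesgue)"
proof (rule ccontr)
  assume "\<not> ?thesis"
  then have "(\<integral>\<^sup>+x\<in>E. ennreal (v x) \<partial>lebesgue) = 0" by simp
  then have "AE x in lebesgue. ennreal (v x) * indicator E x = 0"
    using E v by (subst (asm) nn_integral_0_iff_AE) auto
  with pos have "AE x in lebesgue. x \<notin> E"
    by eventually_elim (auto simp: indicator_def split: if_splits)
  then have "E \<in> null_sets lebesgue" using E by (simp add: AE_iff_null_sets)
  then show False using E by auto
qed

lemma dual_weight_pos: "AE x in lebesgue. 0 < dual_weight x"
  using w_pos by eventually_elim (simp add: dual_weight_def)

lemma Ap_bound:
  "\<exists>B>0. \<forall>Q\<in>dyadic. (\<integral>\<^sup>+x\<in>Q. ennreal (dual_weight x) \<partial>lebesgue) < \<infinity> \<and> w_mass Q * dual_mass Q powr (p - 1) \<le> B * len Q powr p"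
proof -
  have "Ap_const p w < \<infinity>" using w by (simp add: Ap_def)
  then obtain k where k: "Ap_const p w = ennreal k" "0 \<le> k" by (cases "Ap_const p w") auto
  have "(\<integral>\<^sup>+x\<in>Q. ennreal (dual_weight x) \<partial>lebesgue) < \<infinity> \<and> w_mass Q * dual_mass Q powr (p - 1) \<le> (k + 1) * len Q powr p"
    if Qd: "Q \<in> dyadic" for Q
  proof -
    obtain a b where ab: "a < b" "Q = {a..<b}" "len Q = b - a" using dyadic_Icc[OF Qd] by metis
    have eq: "(\<integral>\<^sup>+x\<in>{a..b}. v x \<partial>lebesgue) = (\<integral>\<^sup>+x\<in>Q. v x \<partial>lebesgue)" for v :: "real \<Rightarrow> ennreal"
    proof (rule nn_integral_cong_AE)
      have "AE x in lebesgue. x \<noteq> b"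
        using AE_lborel_singleton[of b] by (rule AE_completion)
      then show "AE x in lebesgue. v x * indicator {a..b} x = v x * indicator Q x"
        by eventually_elim (auto simp: ab split: split_indicator)
    qed
    define W where "W = (\<integral>\<^sup>+x\<in>Q. ennreal (w x) \<partial>lebesgue)"
    define S where "S = (\<integral>\<^sup>+x\<in>Q. ennreal (dual_weight x) \<partial>lebesgue)"
    have "(W / ennreal (b - a)) * epowr (S / ennreal (b - a)) (p / q) \<le> Ap_const p w"
      unfolding Ap_const_def Let_def W_def S_def eq[symmetric] dual_weight_def q_def[symmetric]
      by (rule SUP_upper2[of "(a, b)"]) (use ab in auto)
    then have le: "(W / ennreal (b - a)) * epowr (S / ennreal (b - a)) (p - 1) \<le> ennreal k"
      by (simp add: k q)
    have W0: "W \<noteq> 0"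
      using pos_integral[OF sets_lebesgue_dyadic[OF Qd] _ w_meas w_pos] len_dyadic_pos[OF Qd]
      unfolding W_def emeasure_dyadic[OF Qd] by simp
    obtain r where r: "W = ennreal r" "0 \<le> r"
      using w_mass_finite[OF Qd] by (cases W) (auto simp: W_def)
    with W0 have r0: "0 < r" by auto
    \<comment> \<open>An infinite dual mass makes the product in the Ap condition infinite only
      because \<open>W\<close> is not 0, as infinity times 0 is 0 in \<open>ennreal\<close>. This is
      where positivity of the weight almost everywhere enters.\<close>
    have Sfin: "S \<noteq> \<infinity>"
    proof
      assume "S = \<infinity>"
      then have "(W / ennreal (b - a)) * epowr (S / ennreal (b - a)) (p - 1) = \<infinity>"
        using ab r r0 by (simp add: epowr_def ennreal_top_divide divide_ennreal ennreal_mult_top)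
      with le show False by (simp add: top_unique)
    qed
    then obtain s where s: "S = ennreal s" "0 \<le> s" by (cases S) auto
    have "ennreal ((r / (b - a)) * (s / (b - a)) powr (p - 1)) \<le> ennreal k"
      using le ab r s by (simp add: epowr_def divide_ennreal ennreal_mult[symmetric])
    then have "(r / (b - a)) * (s / (b - a)) powr (p - 1) \<le> k" using k by (simp add: ennreal_le_iff)
    then have "(r * s powr (p - 1)) / ((b - a) * (b - a) powr (p - 1)) \<le> k"
      using s ab by (simp add: powr_divide)
    moreover have "(b - a) * (b - a) powr (p - 1) = (b - a) powr p"
      using ab powr_add[of "b - a" 1 "p - 1"] by simp
    moreover have "0 < (b - a) powr p" using ab by simp
    ultimately have "r * s powr (p - 1) \<le> k * (b - a) powr p"
      by (simp add: pos_divide_le_eq)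
    also have "\<dots> \<le> (k + 1) * (b - a) powr p" by (intro mult_right_mono) auto
    finally have "w_mass Q * dual_mass Q powr (p - 1) \<le> (k + 1) * len Q powr p"
      unfolding w_mass_def dual_mass_def W_def[symmetric] S_def[symmetric] using r s ab by simp
    then show ?thesis using Sfin unfolding S_def by (simp add: less_top)
  qed
  then show ?thesis using k by (intro exI[of _ "k + 1"]) auto
qed

lemma dual_mass_finite: "Q \<in> dyadic \<Longrightarrow> (\<integral>\<^sup>+x\<in>Q. ennreal (dual_weight x) \<partial>lebesgue) < \<infinity>"
  using Ap_bound by auto

lemma finite_subset_integral:
  fixes v :: "real \<Rightarrow> ennreal"
  assumes "E \<subseteq> Q" "(\<integral>\<^sup>+x\<in>Q. v x \<partial>lebesgue) < \<infinity>"
  shows "(\<integral>\<^sup>+x\<in>E. v x \<partial>lebesgue) \<le> (\<integral>\<^sup>+x\<in>Q. v x \<partial>lebesgue)" "(\<integral>\<^sup>+x\<in>E. v x \<partial>lebesgue) < \<infinity>"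
proof -
  show "(\<integral>\<^sup>+x\<in>E. v x \<partial>lebesgue) \<le> (\<integral>\<^sup>+x\<in>Q. v x \<partial>lebesgue)"
    using assms(1) by (intro nn_integral_mono) (auto split: split_indicator)
  then show "(\<integral>\<^sup>+x\<in>E. v x \<partial>lebesgue) < \<infinity>" using assms(2) by (rule le_less_trans)
qed

text \<open>Since \<open>w powr (1 / p) * dual_weight powr (1 / q)\<close> is 1 almost everywhere,
  its integral over E is the length of E, and the last claim is Hoelder's inequality raised to the
  power p.\<close>

lemma holder_weight:
  assumes Q: "Q \<in> dyadic" and E: "E \<in> sets lebesgue" "E \<subseteq> Q" "0 < len E"
  shows "0 < w_mass E" "0 < dual_mass E" "len E powr p \<le> w_mass E * dual_mass E powr (p - 1)"
proof -
  have em: "emeasure lebesgue E = ennreal (len E)"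
  proof -
    have "emeasure lebesgue E \<le> emeasure lebesgue Q" using E sets_lebesgue_dyadic[OF Q] by (intro emeasure_mono)
    then show ?thesis unfolding emeasure_dyadic[OF Q] by (intro emeasure_eq_ennreal_measure) (auto simp: top_unique)
  qed
  have epos: "0 < emeasure lebesgue E" unfolding em using E by simp
  note wf = finite_subset_integral[OF E(2) w_mass_finite[OF Q]]
  note sf = finite_subset_integral[OF E(2) dual_mass_finite[OF Q]]
  have W: "(\<integral>\<^sup>+x\<in>E. ennreal (w x) \<partial>lebesgue) = ennreal (w_mass E)" using wf by (simp add: w_mass_def less_top)
  have S: "(\<integral>\<^sup>+x\<in>E. ennreal (dual_weight x) \<partial>lebesgue) = ennreal (dual_mass E)" using sf by (simp add: dual_mass_def less_top)
  show wpos: "0 < w_mass E" using pos_integral[OF E(1) epos w_meas w_pos] unfolding W by simp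
  show spos: "0 < dual_mass E" using pos_integral[OF E(1) epos dual_weight_meas dual_weight_pos] unfolding S by simp
  \<comment> \<open>The value of t that optimizes Young's inequality: it equalizes
    \<open>t * w_mass E\<close> and \<open>t powr (- (q / p)) * dual_mass E\<close>, since 1 + q / p
    = q.\<close>
  define t where "t = (dual_mass E / w_mass E) powr (1 / q)"
  have t: "0 < t" using wpos spos by (simp add: t_def)
  have ptw: "AE x in lebesgue. 1 * indicator E x \<le> ennreal (t / p) * (ennreal (w x) * indicator E x) + ennreal (t powr (- (q / p)) / q) * (ennreal (dual_weight x) * indicator E x)"
    using w_pos
  proof eventually_elim
    fix x assume wx: "0 < w x"
    then have sx: "0 < dual_weight x" by (simp add: dual_weight_def)
    have "(t * w x) powr (1 / p) * (t powr (- (q / p)) * dual_weight x) powr (1 / q)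
      = (t powr (1 / p) * t powr (- (1 / p))) * (w x powr (1 / p) * dual_weight x powr (1 / q))"
      using t wx sx q(1) by (simp add: powr_mult powr_powr)
    also have "\<dots> = 1" using t powr_product_one[OF wx] by (simp add: powr_add[symmetric])
    finally have "1 \<le> 1 / p * (t * w x) + 1 / q * (t powr (- (q / p)) * dual_weight x)"
      using Youngs_inequality_0[of "1 / p" "1 / q" "t * w x" "t powr (- (q / p)) * dual_weight x"] p q t wx sx by simp
    then show "1 * indicator E x \<le> ennreal (t / p) * (ennreal (w x) * indicator E x) + ennreal (t powr (- (q / p)) / q) * (ennreal (dual_weight x) * indicator E x)"
      using p q(1) t wx sx
      by (auto simp: ennreal_mult[symmetric] ennreal_plus[symmetric] ennreal_1[symmetric] simp del: ennreal_plus ennreal_1 split: split_indicator)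
  qed
  have "ennreal (len E) = (\<integral>\<^sup>+x. 1 * indicator E x \<partial>lebesgue)" using E em by simp
  also have "\<dots> \<le> (\<integral>\<^sup>+x. ennreal (t / p) * (ennreal (w x) * indicator E x) + ennreal (t powr (- (q / p)) / q) * (ennreal (dual_weight x) * indicator E x) \<partial>lebesgue)"
    using ptw by (rule nn_integral_mono_AE)
  also have "\<dots> = ennreal (t / p) * ennreal (w_mass E) + ennreal (t powr (- (q / p)) / q) * ennreal (dual_mass E)"
    using E by (simp add: nn_integral_add nn_integral_cmult W S)
  also have "\<dots> = ennreal (t / p * w_mass E + t powr (- (q / p)) / q * dual_mass E)"
    using p q(1) t wpos spos by (simp add: ennreal_mult[symmetric] ennreal_plus[symmetric] del: ennreal_plus)
  finally have le: "len E \<le> t / p * w_mass E + t powr (- (q / p)) / q * dual_mass E"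
    using p q(1) t wpos spos by (subst (asm) ennreal_le_iff) auto
  have "t powr (- (q / p)) * dual_mass E = t * w_mass E"
  proof -
    have "t powr q = dual_mass E / w_mass E" using wpos spos q(1) by (simp add: t_def powr_powr)
    moreover have "t powr q = t powr (q / p) * t" using t q powr_add[of t "q - 1" 1] by simp
    ultimately show ?thesis using wpos t by (simp add: powr_minus field_simps)
  qed
  then have "t / p * w_mass E + t powr (- (q / p)) / q * dual_mass E = (1 / p + 1 / q) * (t * w_mass E)"
    by (simp add: field_simps)
  also have "\<dots> = t * w_mass E" by (simp only: q(2) mult_1)
  finally have "len E \<le> t * w_mass E" using le by simp
  then have "len E powr p \<le> (t * w_mass E) powr p" using E p by (intro powr_mono2) auto
  also have "\<dots> = (dual_mass E / w_mass E) powr (p - 1) * w_mass E powr p"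
    using wpos spos t q(3) by (simp add: powr_mult t_def powr_powr)
  also have "\<dots> = w_mass E * dual_mass E powr (p - 1)"
    using wpos spos powr_add[of "w_mass E" "p - 1" 1] by (simp add: powr_divide)
  finally show "len E powr p \<le> w_mass E * dual_mass E powr (p - 1)" .
qed

lemma mass_mono:
  assumes "Q \<in> dyadic" "E \<subseteq> Q"
  shows "w_mass E \<le> w_mass Q" "dual_mass E \<le> dual_mass Q"
  using finite_subset_integral[OF assms(2) w_mass_finite[OF assms(1)]] finite_subset_integral[OF assms(2) dual_mass_finite[OF assms(1)]]
    w_mass_finite[OF assms(1)] dual_mass_finite[OF assms(1)]
  unfolding w_mass_def dual_mass_def by (auto intro!: enn2real_mono)

text \<open>The Ap condition on Q and Hoelder's inequality on E compare the products of the two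
  masses on Q and on E. As both masses are monotone, either factor can be replaced and cancelled,
  leaving a bound for the other. This exchanges Q for its witness set, as the Carleson embedding
  requires.\<close>

lemma sparse_part_comparable:
  "\<exists>D>0. \<forall>Q\<in>dyadic. \<forall>E. E \<in> sets lebesgue \<longrightarrow> E \<subseteq> Q \<longrightarrow> len Q / 2 \<le> len E \<longrightarrow> w_mass Q \<le> D * w_mass E \<and> dual_mass Q \<le> D * dual_mass E"
proof -
  obtain B where B: "B > 0" "\<And>Q. Q \<in> dyadic \<Longrightarrow> w_mass Q * dual_mass Q powr (p - 1) \<le> B * len Q powr p"
    using Ap_bound by auto
  define b where "b = B * 2 powr p"
  have b: "0 < b" using B by (simp add: b_def)
  have *: "w_mass Q \<le> b * w_mass E \<and> dual_mass Q \<le> b powr (1 / (p - 1)) * dual_mass E"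
    if Q: "Q \<in> dyadic" and E: "E \<in> sets lebesgue" "E \<subseteq> Q" "len Q / 2 \<le> len E" for Q E
  proof -
    have lE: "0 < len E" using E len_dyadic_pos[OF Q] by linarith
    note h = holder_weight[OF Q E(1,2) lE]
    have hQ: "0 < w_mass Q" "0 < dual_mass Q" using h mass_mono[OF Q E(2)] by auto
    have "len Q powr p \<le> (2 * len E) powr p" using E len_dyadic_pos[OF Q] p by (intro powr_mono2) auto
    also have "\<dots> \<le> 2 powr p * (w_mass E * dual_mass E powr (p - 1))" using h lE by (simp add: powr_mult)
    finally have "w_mass Q * dual_mass Q powr (p - 1) \<le> B * (2 powr p * (w_mass E * dual_mass E powr (p - 1)))"
      using B(2)[OF Q] B(1) by (intro order_trans[OF B(2)[OF Q]] mult_left_mono) auto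
    then have main: "w_mass Q * dual_mass Q powr (p - 1) \<le> b * w_mass E * dual_mass E powr (p - 1)" by (simp add: b_def mult_ac)
    have "b * w_mass E * dual_mass E powr (p - 1) \<le> b * w_mass E * dual_mass Q powr (p - 1)"
      using mass_mono[OF Q E(2)] h b p by (intro mult_left_mono powr_mono2) auto
    with main have "w_mass Q * dual_mass Q powr (p - 1) \<le> (b * w_mass E) * dual_mass Q powr (p - 1)" by simp
    then have 1: "w_mass Q \<le> b * w_mass E" using hQ by (subst (asm) mult_le_cancel_right_pos) auto
    have "w_mass E * dual_mass Q powr (p - 1) \<le> w_mass Q * dual_mass Q powr (p - 1)"
      using mass_mono[OF Q E(2)] by (intro mult_right_mono) auto
    with main have "w_mass E * dual_mass Q powr (p - 1) \<le> w_mass E * (b * dual_mass E powr (p - 1))" by (simp add: mult_ac)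
    then have "dual_mass Q powr (p - 1) \<le> b * dual_mass E powr (p - 1)" using h by (subst (asm) mult_le_cancel_left_pos) auto
    then have "(dual_mass Q powr (p - 1)) powr (1 / (p - 1)) \<le> (b * dual_mass E powr (p - 1)) powr (1 / (p - 1))"
      using p by (intro powr_mono2) auto
    then have "dual_mass Q \<le> b powr (1 / (p - 1)) * dual_mass E" using p hQ h b by (simp add: powr_mult powr_powr)
    with 1 show ?thesis by simp
  qed
  define D where "D = b + b powr (1 / (p - 1))"
  have "D > 0" using b by (simp add: D_def add_pos_nonneg)
  moreover have "w_mass Q \<le> D * w_mass E \<and> dual_mass Q \<le> D * dual_mass E"
    if Q: "Q \<in> dyadic" and E: "E \<in> sets lebesgue" "E \<subseteq> Q" "len Q / 2 \<le> len E" for Q E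
  proof -
    have "b * w_mass E \<le> D * w_mass E" "b powr (1 / (p - 1)) * dual_mass E \<le> D * dual_mass E"
      using b unfolding D_def by (auto intro!: mult_right_mono simp: w_mass_def dual_mass_def)
    then show ?thesis using *[OF that] by linarith
  qed
  ultimately show ?thesis by blast
qed

text \<open>Where \<open>w\<close> is positive, \<open>f\<close> factors as
  \<open>(f powr p * w) powr (1 / p)\<close> times \<open>dual_weight powr (1 / q)\<close>, and
  Young's inequality bounds it pointwise by the sum of two functions integrable over Q.\<close>

lemma local_integral_finite:
  fixes f :: "real \<Rightarrow> real"
  assumes Q: "Q \<in> dyadic" and f [measurable]: "f \<in> borel_measurable lebesgue" and f0: "\<And>x. 0 \<le> f x"
    and fin: "(\<integral>\<^sup>+x. ennreal (f x powr p * w x) \<partial>lebesgue) < \<infinity>"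
  shows "(\<integral>\<^sup>+x\<in>Q. ennreal (f x) \<partial>lebesgue) < \<infinity>"
proof -
  note [measurable] = sets_lebesgue_dyadic[OF Q]
  have "AE x in lebesgue. ennreal (f x) * indicator Q x \<le> ennreal (f x powr p * w x) + ennreal (dual_weight x) * indicator Q x"
    using w_pos
  proof eventually_elim
    fix x assume wx: "0 < w x"
    then have sx: "0 < dual_weight x" by (simp add: dual_weight_def)
    have "f x \<le> f x powr p * w x + dual_weight x"
    proof (cases "f x = 0")
      case True then show ?thesis using wx sx by simp
    next
      case False
      then have fx: "0 < f x" using f0[of x] by simp
      have "(f x powr p * w x) powr (1 / p) * dual_weight x powr (1 / q) = f x * (w x powr (1 / p) * dual_weight x powr (1 / q))"
        using fx wx sx p by (simp add: powr_mult powr_powr)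
      then have "f x = (f x powr p * w x) powr (1 / p) * dual_weight x powr (1 / q)" using powr_product_one[OF wx] by simp
      also have "\<dots> \<le> 1 / p * (f x powr p * w x) + 1 / q * dual_weight x"
        using fx wx sx p q by (intro Youngs_inequality_0) auto
      also have "\<dots> \<le> 1 * (f x powr p * w x) + 1 * dual_weight x"
        using fx wx sx p q by (intro add_mono mult_right_mono) auto
      finally show ?thesis by simp
    qed
    then show "ennreal (f x) * indicator Q x \<le> ennreal (f x powr p * w x) + ennreal (dual_weight x) * indicator Q x"
      using wx sx by (auto simp: ennreal_plus[symmetric] simp del: ennreal_plus intro!: ennreal_leI split: split_indicator)
  qed
  then have "(\<integral>\<^sup>+x\<in>Q. ennreal (f x) \<partial>lebesgue) \<le> (\<integral>\<^sup>+x. ennreal (f x powr p * w x) + ennreal (dual_weight x) * indicator Q x \<partial>lebesgue)"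
    by (rule nn_integral_mono_AE)
  also have "\<dots> = (\<integral>\<^sup>+x. ennreal (f x powr p * w x) \<partial>lebesgue) + (\<integral>\<^sup>+x\<in>Q. ennreal (dual_weight x) \<partial>lebesgue)"
    by (rule nn_integral_add) measurable
  also have "\<dots> < \<infinity>" using fin dual_mass_finite[OF Q] by simp
  finally show ?thesis .
qed

lemma nn_integral_dual_density:
  assumes "v \<in> borel_measurable lebesgue"
  shows "(\<integral>\<^sup>+x. v x \<partial>density lebesgue (\<lambda>x. ennreal (dual_weight x))) = (\<integral>\<^sup>+x. ennreal (dual_weight x) * v x \<partial>lebesgue)"
  using assms by (intro nn_integral_density) auto

text \<open>With A the sparse sum and g = A powr (p - 1), the integral IA of \<open>A powr p * w\<close> is a sum over S of products of
  averages of f and of g. Young's inequality with the weight K splits each product, the Carleson embedding bounds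
  both parts, and K makes the g part IA / 2, which is absorbed because IA is finite.\<close>

lemma sparse_operator_estimate:
  "\<exists>C\<ge>0. \<forall>S f. finite S \<longrightarrow> sparse_collection (1 / 2) S \<longrightarrow> f \<in> borel_measurable lebesgue \<longrightarrow> (\<forall>x. 0 \<le> f x) \<longrightarrow>
    (\<integral>\<^sup>+x. ennreal (f x powr p * w x) \<partial>lebesgue) < \<infinity> \<longrightarrow>
    (\<integral>\<^sup>+x. ennreal ((\<Sum>Q\<in>S. ravg f Q * indicator Q x) powr p * w x) \<partial>lebesgue)
      \<le> ennreal C * (\<integral>\<^sup>+x. ennreal (f x powr p * w x) \<partial>lebesgue)"
proof -
  obtain D where D: "D > 0" "\<And>Q E. Q \<in> dyadic \<Longrightarrow> E \<in> sets lebesgue \<Longrightarrow> E \<subseteq> Q \<Longrightarrow> len Q / 2 \<le> len E \<Longrightarrow> w_mass Q \<le> D * w_mass E \<and> dual_mass Q \<le> D * dual_mass E"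
    using sparse_part_comparable by blast
  obtain B where B: "B > 0" "\<And>Q. Q \<in> dyadic \<Longrightarrow> w_mass Q * dual_mass Q powr (p - 1) \<le> B * len Q powr p"
    using Ap_bound by auto
  define b where "b = B powr (1 / p)"
  have b: "0 < b" using B by (simp add: b_def)
  define Cp where "Cp = p * 2 powr p / (p - 1)"
  define Cq where "Cq = q * 2 powr q / (q - 1)"
  have Cpq: "0 < Cp" "0 < Cq" using p q(1) by (auto simp: Cp_def Cq_def)
  define K where "K = (2 * b * D * Cq) powr (1 / q)"
  have K: "0 < K" "K powr q = 2 * b * D * Cq" using b D Cpq q(1) by (auto simp: K_def powr_powr)
  define C where "C = 2 * b * K powr p * D * Cp"
  have C: "0 \<le> C" using b D Cpq by (simp add: C_def)
  have bound: "(\<integral>\<^sup>+x. ennreal ((\<Sum>Q\<in>S. ravg f Q * indicator Q x) powr p * w x) \<partial>lebesgue)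
      \<le> ennreal C * (\<integral>\<^sup>+x. ennreal (f x powr p * w x) \<partial>lebesgue)"
    if S: "finite S" "sparse_collection (1 / 2) S" and f [measurable]: "f \<in> borel_measurable lebesgue" and f0: "\<forall>x. 0 \<le> f x"
      and fin: "(\<integral>\<^sup>+x. ennreal (f x powr p * w x) \<partial>lebesgue) < \<infinity>" for S f
  proof -
    from S obtain E where E: "\<And>Q. Q \<in> S \<Longrightarrow> E Q \<in> sets lebesgue" "\<And>Q. Q \<in> S \<Longrightarrow> E Q \<subseteq> Q"
      "\<And>Q. Q \<in> S \<Longrightarrow> len Q / 2 \<le> len (E Q)" "disjoint_family_on E S" and Sd: "S \<subseteq> dyadic"
      unfolding sparse_collection_def by auto
    have dy: "\<And>Q. Q \<in> S \<Longrightarrow> Q \<in> dyadic" using Sd by blast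
    have [measurable]: "\<And>Q. Q \<in> S \<Longrightarrow> Q \<in> sets lebesgue" using dy sets_lebesgue_dyadic by blast
    define A where "A x = (\<Sum>Q\<in>S. ravg f Q * indicator Q x)" for x
    have A0: "0 \<le> A x" for x unfolding A_def by (intro sum_nonneg) (simp add: ravg_nonneg)
    have [measurable]: "A \<in> borel_measurable lebesgue"
      unfolding A_def by (intro borel_measurable_sum borel_measurable_times borel_measurable_indicator) auto
    \<comment> \<open>A finite collection has a bounded sparse sum. With the local integrability of
      \<open>w\<close> this makes each \<open>G Q\<close>, and so \<open>IA\<close>, finite before
      any estimate of it is known.\<close>
    define c where "c = (\<Sum>Q\<in>S. ravg f Q)"
    have Ac: "A x \<le> c" for x
      unfolding A_def c_def by (intro sum_mono) (auto simp: ravg_nonneg indicator_def)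
    define F where "F Q = enn2real (\<integral>\<^sup>+x\<in>Q. ennreal (f x) \<partial>lebesgue)" for Q
    have F: "(\<integral>\<^sup>+x\<in>Q. ennreal (f x) \<partial>lebesgue) = ennreal (F Q)" "0 \<le> F Q" if "Q \<in> S" for Q
      using local_integral_finite[OF dy[OF that] f _ fin] f0 by (auto simp: F_def less_top)
    define g where "g x = A x powr (p - 1)" for x
    have g_meas [measurable]: "g \<in> borel_measurable lebesgue" unfolding g_def by measurable
    have gc: "g x \<le> c powr (p - 1)" for x
      unfolding g_def using Ac[of x] A0[of x] p by (intro powr_mono2) auto
    define G where "G Q = enn2real (\<integral>\<^sup>+x\<in>Q. ennreal (g x * w x) \<partial>lebesgue)" for Q
    have G: "(\<integral>\<^sup>+x\<in>Q. ennreal (g x * w x) \<partial>lebesgue) = ennreal (G Q)" if "Q \<in> S" for Q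
    proof -
      have "(\<integral>\<^sup>+x\<in>Q. ennreal (g x * w x) \<partial>lebesgue) \<le> (\<integral>\<^sup>+x. ennreal (c powr (p - 1)) * (ennreal (w x) * indicator Q x) \<partial>lebesgue)"
        using gc w_nonneg
        by (intro nn_integral_mono) (auto simp: ennreal_mult[symmetric] intro!: ennreal_leI mult_right_mono split: split_indicator)
      also have "\<dots> = ennreal (c powr (p - 1)) * (\<integral>\<^sup>+x\<in>Q. ennreal (w x) \<partial>lebesgue)"
        using that by (intro nn_integral_cmult) measurable
      also have "\<dots> < \<infinity>" using w_mass_finite[OF dy[OF that]] by (simp add: ennreal_mult_less_top)
      finally show ?thesis by (simp add: G_def less_top)
    qed
    have G0: "0 \<le> G Q" for Q by (simp add: G_def)
    have W: "(\<integral>\<^sup>+x\<in>Q. ennreal (w x) \<partial>lebesgue) = ennreal (w_mass Q)" "0 < w_mass Q"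
      and Sm: "(\<integral>\<^sup>+x\<in>Q. ennreal (dual_weight x) \<partial>lebesgue) = ennreal (dual_mass Q)" "0 < dual_mass Q" if "Q \<in> S" for Q
      using w_mass_finite[OF dy[OF that]] dual_mass_finite[OF dy[OF that]]
        holder_weight[OF dy[OF that] sets_lebesgue_dyadic[OF dy[OF that]] subset_refl len_dyadic_pos[OF dy[OF that]]]
      by (auto simp: w_mass_def dual_mass_def less_top)
    have WE: "(\<integral>\<^sup>+x\<in>E Q. ennreal (w x) \<partial>lebesgue) = ennreal (w_mass (E Q))"
      and SE: "(\<integral>\<^sup>+x\<in>E Q. ennreal (dual_weight x) \<partial>lebesgue) = ennreal (dual_mass (E Q))" if "Q \<in> S" for Q
      using finite_subset_integral(2)[OF E(2)[OF that] w_mass_finite[OF dy[OF that]]]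
        finite_subset_integral(2)[OF E(2)[OF that] dual_mass_finite[OF dy[OF that]]]
      by (auto simp: w_mass_def dual_mass_def less_top)
    have wsE0: "0 \<le> w_mass (E Q)" "0 \<le> dual_mass (E Q)" for Q by (auto simp: w_mass_def dual_mass_def)
    define IA where "IA = (\<Sum>Q\<in>S. F Q / len Q * G Q)"
    have IA0: "0 \<le> IA" unfolding IA_def using F(2) G0 by (intro sum_nonneg) (auto intro!: divide_nonneg_nonneg mult_nonneg_nonneg)
    have Apg: "A x powr p = A x * g x" for x
      using A0[of x] powr_add[of "A x" 1 "p - 1"] p by (simp add: g_def)
    have IA: "(\<integral>\<^sup>+x. ennreal (A x powr p * w x) \<partial>lebesgue) = ennreal IA"
    proof -
      have "ennreal (A x powr p * w x) = (\<Sum>Q\<in>S. ennreal (F Q / len Q) * (ennreal (g x * w x) * indicator Q x))" for x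
      proof -
        have "A x powr p * w x = (\<Sum>Q\<in>S. F Q / len Q * (g x * w x * indicator Q x))"
          unfolding Apg unfolding A_def by (simp add: sum_distrib_left sum_distrib_right F_def ravg_def mult_ac)
        also have "ennreal \<dots> = (\<Sum>Q\<in>S. ennreal (F Q / len Q * (g x * w x * indicator Q x)))"
          using F(2) w_nonneg[of x] by (intro sum_ennreal[symmetric]) (auto simp: g_def)
        also have "\<dots> = (\<Sum>Q\<in>S. ennreal (F Q / len Q) * (ennreal (g x * w x) * indicator Q x))"
          using F(2) w_nonneg[of x] by (intro sum.cong) (auto simp: g_def ennreal_mult[symmetric] split: split_indicator)
        finally show ?thesis .
      qed
      then have "(\<integral>\<^sup>+x. ennreal (A x powr p * w x) \<partial>lebesgue)
        = (\<integral>\<^sup>+x. (\<Sum>Q\<in>S. ennreal (F Q / len Q) * (ennreal (g x * w x) * indicator Q x)) \<partial>lebesgue)" by simp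
      also have "\<dots> = (\<Sum>Q\<in>S. \<integral>\<^sup>+x. ennreal (F Q / len Q) * (ennreal (g x * w x) * indicator Q x) \<partial>lebesgue)"
        by (intro nn_integral_sum) measurable
      also have "\<dots> = (\<Sum>Q\<in>S. ennreal (F Q / len Q) * ennreal (G Q))"
      proof (intro sum.cong refl)
        fix Q assume "Q \<in> S"
        then show "(\<integral>\<^sup>+x. ennreal (F Q / len Q) * (ennreal (g x * w x) * indicator Q x) \<partial>lebesgue) = ennreal (F Q / len Q) * ennreal (G Q)"
          by (subst nn_integral_cmult) (auto simp: G)
      qed
      also have "\<dots> = (\<Sum>Q\<in>S. ennreal (F Q / len Q * G Q))"
        using F(2) G0 by (intro sum.cong refl ennreal_mult[symmetric]) auto
      also have "\<dots> = ennreal IA" unfolding IA_def using F(2) G0 by (intro sum_ennreal) auto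
      finally show ?thesis .
    qed
    obtain If where If: "(\<integral>\<^sup>+x. ennreal (f x powr p * w x) \<partial>lebesgue) = ennreal If" "0 \<le> If"
      using fin by (cases "\<integral>\<^sup>+x. ennreal (f x powr p * w x) \<partial>lebesgue") auto
    have nested: "\<And>Q R. Q \<in> S \<Longrightarrow> R \<in> S \<Longrightarrow> Q \<subseteq> R \<or> R \<subseteq> Q \<or> Q \<inter> R = {}"
      using dyadic_cases dy by blast
    \<comment> \<open>Weighted averages: \<open>x Q\<close> is the average of
      \<open>f / dual_weight\<close> for the dual weight, and \<open>y Q\<close> is that of
      \<open>g\<close> for \<open>w\<close>. Each goes into the Carleson embedding of its own
      measure.\<close>
    define x y where "x Q = F Q / dual_mass Q" and "y Q = G Q / w_mass Q" for Q
    have xy0: "0 \<le> x Q" "0 \<le> y Q" if "Q \<in> S" for Q using F(2)[OF that] G0 by (auto simp: x_def y_def w_mass_def dual_mass_def)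
    have c1: "(\<Sum>Q\<in>S. x Q powr p * dual_mass (E Q)) \<le> Cp * If"
    proof -
      let ?M = "density lebesgue (\<lambda>x. ennreal (dual_weight x))"
      have em: "emeasure ?M Q = ennreal (dual_mass Q)" if "Q \<in> S" for Q
        using that Sm(1)[OF that] by (subst emeasure_density) auto
      have emE: "emeasure ?M (E Q) = ennreal (dual_mass (E Q))" if "Q \<in> S" for Q
        using that SE[OF that] E(1)[OF that] by (subst emeasure_density) auto
      have "(\<Sum>Q\<in>S. ennreal (x Q powr p) * emeasure ?M (E Q))
        \<le> ennreal Cp * (\<integral>\<^sup>+t. ennreal ((f t / dual_weight t) powr p) \<partial>?M)"
        unfolding Cp_def
      proof (rule carleson_embedding)
        show "sigma_finite_measure ?M" by (rule sigma_finite_density_real) simp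
        show "(\<lambda>t. f t / dual_weight t) \<in> borel_measurable ?M" by measurable
        show "\<And>t. 0 \<le> f t / dual_weight t" using f0 dual_weight_nonneg by auto
        show "S \<subseteq> sets ?M" by auto
        show "\<And>Q. Q \<in> S \<Longrightarrow> emeasure ?M Q < \<infinity>" by (simp add: em)
        show "ennreal (x Q) * emeasure ?M Q \<le> (\<integral>\<^sup>+t\<in>Q. ennreal (f t / dual_weight t) \<partial>?M)" if Q: "Q \<in> S" for Q
        proof -
          have "ennreal (x Q) * emeasure ?M Q = ennreal (F Q)"
            using F(2)[OF Q] Sm(2)[OF Q] by (simp add: em[OF Q] x_def ennreal_mult[symmetric])
          also have "\<dots> = (\<integral>\<^sup>+t. ennreal (dual_weight t) * (ennreal (f t / dual_weight t) * indicator Q t) \<partial>lebesgue)"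
            unfolding F(1)[OF Q, symmetric]
          proof (rule nn_integral_cong_AE)
            show "AE t in lebesgue. ennreal (f t) * indicator Q t = ennreal (dual_weight t) * (ennreal (f t / dual_weight t) * indicator Q t)"
              using dual_weight_pos by eventually_elim (use f0 in \<open>auto simp: ennreal_mult[symmetric] split: split_indicator\<close>)
          qed
          also have "\<dots> = (\<integral>\<^sup>+t\<in>Q. ennreal (f t / dual_weight t) \<partial>?M)"
            using Q by (intro nn_integral_dual_density[symmetric]) measurable
          finally show ?thesis by simp
        qed
      qed (use p S E nested xy0 in auto)
      also have "(\<integral>\<^sup>+t. ennreal ((f t / dual_weight t) powr p) \<partial>?M) = (\<integral>\<^sup>+t. ennreal (dual_weight t) * ennreal ((f t / dual_weight t) powr p) \<partial>lebesgue)"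
        by (intro nn_integral_dual_density) measurable
      also have "\<dots> = (\<integral>\<^sup>+t. ennreal (f t powr p * w t) \<partial>lebesgue)"
      proof (rule nn_integral_cong_AE)
        show "AE t in lebesgue. ennreal (dual_weight t) * ennreal ((f t / dual_weight t) powr p) = ennreal (f t powr p * w t)"
          using w_pos
        proof eventually_elim
          fix t assume wt: "0 < w t"
          then have st: "0 < dual_weight t" by (simp add: dual_weight_def)
          have "dual_weight t powr (1 - p) = w t powr (- q / p * (1 - p))" using wt by (simp add: dual_weight_def powr_powr)
          also have "- q / p * (1 - p) = 1" using q(5) p by (simp add: field_simps)
          finally have *: "dual_weight t powr (1 - p) = w t" using wt by simp
          have "dual_weight t * (f t / dual_weight t) powr p = f t powr p * (dual_weight t powr 1 / dual_weight t powr p)"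
            using st f0 by (simp add: powr_divide)
          also have "dual_weight t powr 1 / dual_weight t powr p = w t" using * by (simp add: powr_diff)
          finally show "ennreal (dual_weight t) * ennreal ((f t / dual_weight t) powr p) = ennreal (f t powr p * w t)"
            using st by (simp add: ennreal_mult[symmetric])
        qed
      qed
      also have "\<dots> = ennreal If" by (rule If(1))
      finally have "(\<Sum>Q\<in>S. ennreal (x Q powr p) * emeasure ?M (E Q)) \<le> ennreal (Cp * If)"
        using Cpq If by (simp add: ennreal_mult)
      also have "(\<Sum>Q\<in>S. ennreal (x Q powr p) * emeasure ?M (E Q)) = (\<Sum>Q\<in>S. ennreal (x Q powr p * dual_mass (E Q)))"
        using wsE0 by (intro sum.cong) (auto simp: emE ennreal_mult)
      also have "\<dots> = ennreal (\<Sum>Q\<in>S. x Q powr p * dual_mass (E Q))"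
        using wsE0 by (intro sum_ennreal) auto
      finally show ?thesis using Cpq If by (subst (asm) ennreal_le_iff) auto
    qed
    have c2: "(\<Sum>Q\<in>S. y Q powr q * w_mass (E Q)) \<le> Cq * IA"
    proof -
      let ?M = "density lebesgue (\<lambda>x. ennreal (w x))"
      have em: "emeasure ?M Q = ennreal (w_mass Q)" if "Q \<in> S" for Q
        using that W(1)[OF that] by (subst emeasure_density) auto
      have emE: "emeasure ?M (E Q) = ennreal (w_mass (E Q))" if "Q \<in> S" for Q
        using that WE[OF that] E(1)[OF that] by (subst emeasure_density) auto
      have "(\<Sum>Q\<in>S. ennreal (y Q powr q) * emeasure ?M (E Q))
        \<le> ennreal Cq * (\<integral>\<^sup>+t. ennreal (g t powr q) \<partial>?M)"
        unfolding Cq_def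
      proof (rule carleson_embedding)
        show "sigma_finite_measure ?M" by (rule sigma_finite_density_real) simp
        show "g \<in> borel_measurable ?M" by measurable
        show "\<And>t. 0 \<le> g t" by (simp add: g_def)
        show "S \<subseteq> sets ?M" by auto
        show "\<And>Q. Q \<in> S \<Longrightarrow> emeasure ?M Q < \<infinity>" by (simp add: em)
        show "ennreal (y Q) * emeasure ?M Q \<le> (\<integral>\<^sup>+t\<in>Q. ennreal (g t) \<partial>?M)" if Q: "Q \<in> S" for Q
        proof -
          have "ennreal (y Q) * emeasure ?M Q = ennreal (G Q)"
            using G0 W(2)[OF Q] by (simp add: em[OF Q] y_def ennreal_mult[symmetric])
          also have "\<dots> = (\<integral>\<^sup>+t. ennreal (w t) * (ennreal (g t) * indicator Q t) \<partial>lebesgue)"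
            unfolding G[OF Q, symmetric] using w_nonneg
            by (intro nn_integral_cong) (auto simp: g_def ennreal_mult[symmetric] mult.commute split: split_indicator)
          also have "\<dots> = (\<integral>\<^sup>+t\<in>Q. ennreal (g t) \<partial>?M)"
            using Q by (intro nn_integral_density[symmetric]) measurable
          finally show ?thesis by simp
        qed
      qed (use q(1) S E nested xy0 in auto)
      also have "(\<integral>\<^sup>+t. ennreal (g t powr q) \<partial>?M) = (\<integral>\<^sup>+t. ennreal (w t) * ennreal (g t powr q) \<partial>lebesgue)"
        by (intro nn_integral_density) measurable
      \<comment> \<open>Because (p - 1) q = p, the power \<open>g powr q\<close> is
        \<open>A powr p\<close>; so the embedding for \<open>g\<close> returns the quantity
        \<open>IA\<close> that is being estimated.\<close>
      also have "\<dots> = ennreal IA"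
        unfolding IA[symmetric] using w_nonneg q(5)
        by (intro nn_integral_cong) (auto simp: g_def powr_powr ennreal_mult[symmetric] mult.commute)
      finally have "(\<Sum>Q\<in>S. ennreal (y Q powr q) * emeasure ?M (E Q)) \<le> ennreal (Cq * IA)"
        using Cpq IA0 by (simp add: ennreal_mult)
      also have "(\<Sum>Q\<in>S. ennreal (y Q powr q) * emeasure ?M (E Q)) = (\<Sum>Q\<in>S. ennreal (y Q powr q * w_mass (E Q)))"
        using wsE0 by (intro sum.cong) (auto simp: emE ennreal_mult)
      also have "\<dots> = ennreal (\<Sum>Q\<in>S. y Q powr q * w_mass (E Q))"
        using wsE0 by (intro sum_ennreal) auto
      finally show ?thesis using Cpq IA0 by (subst (asm) ennreal_le_iff) auto
    qed
    have est: "F Q / len Q * G Q \<le> b * K powr p * D * (x Q powr p * dual_mass (E Q)) + b * K powr (- q) * D * (y Q powr q * w_mass (E Q))"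
      if Q: "Q \<in> S" for Q
    proof -
      have l: "0 < len Q" by (rule len_dyadic_pos[OF dy[OF Q]])
      have pos: "0 < w_mass Q" "0 < dual_mass Q" using W(2)[OF Q] Sm(2)[OF Q] .
      have "(w_mass Q * dual_mass Q powr (p - 1)) powr (1 / p) \<le> (B * len Q powr p) powr (1 / p)"
        using B(2)[OF dy[OF Q]] pos p by (intro powr_mono2) auto
      then have ws: "w_mass Q powr (1 / p) * dual_mass Q powr (1 / q) \<le> b * len Q"
        using l p pos B(1) by (simp add: powr_mult powr_powr b_def q(6))
      \<comment> \<open>The product of the masses is regrouped into two factors. The Ap condition
        bounds \<open>w_mass Q powr (1 / p) * dual_mass Q powr (1 / q)\<close> by
        \<open>b * len Q\<close>, and the remaining powers become one full mass with
        \<open>x Q powr p\<close> and one with \<open>y Q powr q\<close>.\<close>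
      have spl: "w_mass Q = w_mass Q powr (1 / p) * w_mass Q powr (1 / q)" "dual_mass Q = dual_mass Q powr (1 / p) * dual_mass Q powr (1 / q)"
        using pos q(2) by (simp_all only: powr_add[symmetric], simp_all)
      have "F Q / len Q * G Q = x Q * y Q * ((w_mass Q * dual_mass Q) / len Q)"
        using pos l by (simp add: x_def y_def field_simps)
      also have "w_mass Q * dual_mass Q = (w_mass Q powr (1 / p) * dual_mass Q powr (1 / q)) * (w_mass Q powr (1 / q) * dual_mass Q powr (1 / p))"
        by (subst spl(1), subst spl(2)) (simp only: mult_ac)
      also have "x Q * y Q * (\<dots> / len Q) \<le> x Q * y Q * ((b * len Q) * (w_mass Q powr (1 / q) * dual_mass Q powr (1 / p)) / len Q)"
        using xy0[OF Q] l ws by (intro mult_left_mono divide_right_mono mult_right_mono) auto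
      also have "\<dots> = b * ((K * x Q * dual_mass Q powr (1 / p)) * (inverse K * y Q * w_mass Q powr (1 / q)))"
        using l K(1) by (simp add: field_simps)
      also have "\<dots> \<le> b * ((K * x Q * dual_mass Q powr (1 / p)) powr p / p + (inverse K * y Q * w_mass Q powr (1 / q)) powr q / q)"
        using p q(1,2) K(1) xy0[OF Q] b by (intro mult_left_mono Youngs_inequality) auto
      also have "(K * x Q * dual_mass Q powr (1 / p)) powr p = K powr p * x Q powr p * dual_mass Q"
        using p K(1) xy0[OF Q] pos by (simp add: powr_mult powr_powr)
      also have "(inverse K * y Q * w_mass Q powr (1 / q)) powr q = K powr (- q) * y Q powr q * w_mass Q"
        using q(1) K(1) xy0[OF Q] pos by (simp add: powr_mult powr_powr powr_minus inverse_powr)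
      also have "b * (K powr p * x Q powr p * dual_mass Q / p + K powr (- q) * y Q powr q * w_mass Q / q)
        \<le> b * (K powr p * x Q powr p * dual_mass Q / 1 + K powr (- q) * y Q powr q * w_mass Q / 1)"
        using p q(1) b pos K(1) by (intro mult_left_mono add_mono divide_left_mono) auto
      also have "\<dots> \<le> b * (K powr p * x Q powr p * (D * dual_mass (E Q)) + K powr (- q) * y Q powr q * (D * w_mass (E Q)))"
        using D(2)[OF dy[OF Q] E(1,2,3)[OF Q]] b unfolding div_by_1 by (intro mult_left_mono add_mono) auto
      also have "\<dots> = b * K powr p * D * (x Q powr p * dual_mass (E Q)) + b * K powr (- q) * D * (y Q powr q * w_mass (E Q))"
        by (simp add: algebra_simps)
      finally show ?thesis .
    qed
    have "IA \<le> (\<Sum>Q\<in>S. b * K powr p * D * (x Q powr p * dual_mass (E Q)) + b * K powr (- q) * D * (y Q powr q * w_mass (E Q)))"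
      unfolding IA_def by (intro sum_mono est)
    also have "\<dots> = b * K powr p * D * (\<Sum>Q\<in>S. x Q powr p * dual_mass (E Q)) + b * K powr (- q) * D * (\<Sum>Q\<in>S. y Q powr q * w_mass (E Q))"
      by (simp add: sum.distrib sum_distrib_left)
    also have "\<dots> \<le> b * K powr p * D * (Cp * If) + b * K powr (- q) * D * (Cq * IA)"
      using c1 c2 b D(1) by (intro add_mono mult_left_mono) auto
    also have "b * K powr (- q) * D * (Cq * IA) = IA / 2"
      unfolding powr_minus K(2) using b D(1) Cpq by (simp add: field_simps)
    finally have "IA \<le> C * If" by (simp add: C_def)
    then show ?thesis
      unfolding A_def[symmetric] IA If(1) using C If(2) by (simp add: ennreal_mult[symmetric] ennreal_leI)
  qed
  show ?thesis using C bound by blast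
qed

end

section \<open>The sequences of the hypotheses\<close>

definition dyadic_sum :: "(real set \<Rightarrow> complex) \<Rightarrow> real set \<Rightarrow> complex" where
  "dyadic_sum a I = (\<Sum>\<^sub>\<infinity>J\<in>{J \<in> dyadic. J \<subseteq> I}. a J)"

lemma E_seq_eq: "E_seq a I = dyadic_sum a I / of_real (len I)"
  by (simp add: E_seq_def dyadic_sum_def)

text \<open>The value type is general because the splitting is applied both to complex sums, in
  \<open>dyadic_sum_split\<close>, and to energies in \<open>ennreal\<close>, in
  \<open>S_energy_split\<close>.\<close>

lemma infsum_dyadic_split:
  fixes a :: "real set \<Rightarrow> 'b::{topological_comm_monoid_add, t2_space}"
  assumes I: "I \<in> dyadic" and L: "a summable_on {J \<in> dyadic. J \<subseteq> left_child I}"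
    and R: "a summable_on {J \<in> dyadic. J \<subseteq> right_child I}"
  shows "(\<Sum>\<^sub>\<infinity>J\<in>{J \<in> dyadic. J \<subseteq> I}. a J) = a I +
    ((\<Sum>\<^sub>\<infinity>J\<in>{J \<in> dyadic. J \<subseteq> left_child I}. a J) + (\<Sum>\<^sub>\<infinity>J\<in>{J \<in> dyadic. J \<subseteq> right_child I}. a J))"
proof -
  have "a summable_on {J \<in> dyadic. J \<subset> I}"
    unfolding dyadic_subset_split(1)[OF I] by (rule summable_on_Un_disjoint[OF L R dyadic_subset_split(3)[OF I]])
  then have "(\<Sum>\<^sub>\<infinity>J\<in>{J \<in> dyadic. J \<subseteq> I}. a J) = a I + (\<Sum>\<^sub>\<infinity>J\<in>{J \<in> dyadic. J \<subset> I}. a J)"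
    unfolding dyadic_subset_split(2)[OF I] by (rule infsum_insert) simp
  also have "(\<Sum>\<^sub>\<infinity>J\<in>{J \<in> dyadic. J \<subset> I}. a J) = (\<Sum>\<^sub>\<infinity>J\<in>{J \<in> dyadic. J \<subseteq> left_child I}. a J) + (\<Sum>\<^sub>\<infinity>J\<in>{J \<in> dyadic. J \<subseteq> right_child I}. a J)"
    unfolding dyadic_subset_split(1)[OF I] by (rule infsum_Un_disjoint[OF L R dyadic_subset_split(3)[OF I]])
  finally show ?thesis .
qed

lemma dyadic_sum_split:
  assumes "locally_summable a" "I \<in> dyadic"
  shows "dyadic_sum a I = a I + (dyadic_sum a (left_child I) + dyadic_sum a (right_child I))"
  unfolding dyadic_sum_def
  using assms dyadic_children[OF assms(2)] by (intro infsum_dyadic_split) (auto simp: locally_summable_def)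

lemma haar_on_child:
  assumes I: "I \<in> dyadic" and J: "J \<in> dyadic"
  shows "J \<subseteq> left_child I \<Longrightarrow> haar_on I J = len I powr (- 1 / 2)"
    and "J \<subseteq> right_child I \<Longrightarrow> haar_on I J = - (len I powr (- 1 / 2))"
  using Inf_dyadic_mem[OF J] dyadic_children(4)[OF I]
  by (auto simp: haar_on_def haar_def indicator_def)

lemma S_hat_eq:
  assumes a: "locally_summable a" and I: "I \<in> dyadic"
  shows "S_hat a I = of_real (len I powr (- 1 / 2)) * (dyadic_sum a (left_child I) - dyadic_sum a (right_child I))"
proof -
  note ch = dyadic_children[OF I]
  let ?h = "of_real (len I powr (- 1 / 2)) :: complex"
  let ?g = "\<lambda>J. a J * of_real (haar_on I J)"
  let ?L = "{J \<in> dyadic. J \<subseteq> left_child I}" and ?R = "{J \<in> dyadic. J \<subseteq> right_child I}"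
  have sL: "a summable_on ?L" and sR: "a summable_on ?R" using a ch by (auto simp: locally_summable_def)
  have gL: "?g J = a J * ?h" if "J \<in> ?L" for J using that haar_on_child[OF I, of J] by simp
  have gR: "?g J = a J * (- ?h)" if "J \<in> ?R" for J using that haar_on_child[OF I, of J] by simp
  have "S_hat a I = infsum ?g ?L + infsum ?g ?R"
    unfolding S_hat_def dyadic_subset_split(1)[OF I]
    by (rule infsum_Un_disjoint[OF iffD2[OF summable_on_cong[OF gL] summable_on_cmult_left[OF sL]]
      iffD2[OF summable_on_cong[OF gR] summable_on_cmult_left[OF sR]] dyadic_subset_split(3)[OF I]])
  also have "infsum ?g ?L = dyadic_sum a (left_child I) * ?h"
    unfolding dyadic_sum_def infsum_cmult_left'[symmetric] by (rule infsum_cong) (rule gL)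
  also have "infsum ?g ?R = dyadic_sum a (right_child I) * (- ?h)"
    unfolding dyadic_sum_def infsum_cmult_left'[symmetric] by (rule infsum_cong) (rule gR)
  finally show ?thesis by (simp add: algebra_simps)
qed

lemma E_seq_increment:
  assumes "locally_summable a" "I \<in> dyadic"
  shows "E_seq a I - (E_seq a (left_child I) + E_seq a (right_child I)) / 2 = a I / of_real (len I)"
  unfolding E_seq_eq dyadic_sum_split[OF assms] dyadic_children(5,6)[OF assms(2)]
  using len_dyadic_pos[OF assms(2)] by (simp add: field_simps)

lemma S_hat_norm:
  assumes "locally_summable a" and I: "I \<in> dyadic"
  shows "(cmod (S_hat a I))\<^sup>2 = len I * (cmod ((E_seq a (left_child I) - E_seq a (right_child I)) / 2))\<^sup>2"
proof -
  have l: "0 < len I" by (rule len_dyadic_pos[OF I])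
  have "(E_seq a (left_child I) - E_seq a (right_child I)) / 2
     = (dyadic_sum a (left_child I) - dyadic_sum a (right_child I)) / of_real (len I)"
    unfolding E_seq_eq dyadic_children(5,6)[OF I] using l by (simp add: field_simps)
  then have "cmod (dyadic_sum a (left_child I) - dyadic_sum a (right_child I))
     = len I * cmod ((E_seq a (left_child I) - E_seq a (right_child I)) / 2)"
    using l by (simp only: norm_divide) simp
  then have "cmod (S_hat a I) = (len I powr (- 1 / 2) * len I) * cmod ((E_seq a (left_child I) - E_seq a (right_child I)) / 2)"
    unfolding S_hat_eq[OF assms] norm_mult using l by simp
  moreover have "(len I powr (- 1 / 2) * len I)\<^sup>2 = len I"
  proof -
    have "len I powr (- 1 / 2) * len I = len I powr (1 / 2)"
      using l powr_add[of "len I" "- 1 / 2" 1] by simp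
    then show ?thesis using l by (simp add: power2_eq_square powr_add[symmetric])
  qed
  ultimately show ?thesis by (simp only: power_mult_distrib)
qed

text \<open>The real form of the Carleson quotient, playing the role of \<open>s\<close> in
  \<open>dyadic_averages\<close>. The bound on \<open>CM_norm\<close> makes the sum finite, so
  \<open>enn2real\<close> loses nothing.\<close>

definition S_energy :: "(real set \<Rightarrow> complex) \<Rightarrow> real set \<Rightarrow> real" where
  "S_energy a I = enn2real (\<Sum>\<^sub>\<infinity>J\<in>{J \<in> dyadic. J \<subseteq> I}. ennreal ((cmod (S_hat a J))\<^sup>2)) / len I"

lemma epowr_ennreal: "0 \<le> t \<Longrightarrow> epowr (ennreal t) r = ennreal (t powr r)"
  by (simp add: epowr_def)

lemma epowr_le_iff:
  assumes "0 < r" "0 \<le> t"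
  shows "epowr x r \<le> ennreal t \<longleftrightarrow> x \<le> ennreal (t powr (1 / r))"
proof (cases x)
  case (real s)
  have "s powr r \<le> t \<longleftrightarrow> s \<le> t powr (1 / r)"
  proof
    assume "s powr r \<le> t"
    then have "(s powr r) powr (1 / r) \<le> t powr (1 / r)" using assms by (intro powr_mono2) auto
    then show "s \<le> t powr (1 / r)" using assms real by (simp add: powr_powr)
  next
    assume "s \<le> t powr (1 / r)"
    then have "s powr r \<le> (t powr (1 / r)) powr r" using assms real by (intro powr_mono2) auto
    then show "s powr r \<le> t" using assms by (simp add: powr_powr)
  qed
  then show ?thesis using real assms by (simp add: epowr_ennreal ennreal_le_iff)
next
  case top
  then show ?thesis by (simp add: epowr_def top_unique)
qed

lemma S_energy_bound:
  assumes M: "CM_norm (S_hat a) \<le> ennreal M" "0 \<le> M" and I: "I \<in> dyadic"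
  shows "(\<Sum>\<^sub>\<infinity>J\<in>{J \<in> dyadic. J \<subseteq> I}. ennreal ((cmod (S_hat a J))\<^sup>2)) \<le> ennreal (M\<^sup>2 * len I)"
    and "0 \<le> S_energy a I" "S_energy a I \<le> M\<^sup>2"
proof -
  let ?X = "\<Sum>\<^sub>\<infinity>J\<in>{J \<in> dyadic. J \<subseteq> I}. ennreal ((cmod (S_hat a J))\<^sup>2)"
  have l: "0 < len I" by (rule len_dyadic_pos[OF I])
  have "(SUP I\<in>dyadic. (\<Sum>\<^sub>\<infinity>J\<in>{J \<in> dyadic. J \<subseteq> I}. ennreal ((cmod (S_hat a J))\<^sup>2)) / ennreal (len I)) \<le> ennreal (M powr (1 / (1 / 2)))"
    using M epowr_le_iff[of "1 / 2" M] unfolding CM_norm_def by simp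
  moreover have "M powr (1 / (1 / 2)) = M\<^sup>2"
    using M(2) by (cases "M = 0") (auto simp: powr_numeral)
  ultimately have "?X / ennreal (len I) \<le> ennreal (M\<^sup>2)"
    using I by (simp only: SUP_le_iff)
  then have "?X / ennreal (len I) * ennreal (len I) \<le> ennreal (M\<^sup>2) * ennreal (len I)"
    by (rule mult_right_mono) simp
  also have "?X / ennreal (len I) * ennreal (len I) = ?X"
    using l by (simp add: divide_ennreal_def mult.assoc inverse_ennreal ennreal_mult[symmetric])
  finally show *: "?X \<le> ennreal (M\<^sup>2 * len I)" using l by (simp add: ennreal_mult)
  show "0 \<le> S_energy a I" by (simp add: S_energy_def)
  have "enn2real ?X \<le> M\<^sup>2 * len I" using enn2real_mono[OF *] l by simp
  then show "S_energy a I \<le> M\<^sup>2" unfolding S_energy_def using l by (simp add: pos_divide_le_eq)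
qed

lemma S_energy_split:
  assumes a: "locally_summable a" and M: "CM_norm (S_hat a) \<le> ennreal M" "0 \<le> M" and I: "I \<in> dyadic"
  shows "S_energy a I = (cmod ((E_seq a (left_child I) - E_seq a (right_child I)) / 2))\<^sup>2
    + (S_energy a (left_child I) + S_energy a (right_child I)) / 2"
proof -
  note ch = dyadic_children[OF I]
  have l: "0 < len I" by (rule len_dyadic_pos[OF I])
  let ?X = "\<lambda>I. \<Sum>\<^sub>\<infinity>J\<in>{J \<in> dyadic. J \<subseteq> I}. ennreal ((cmod (S_hat a J))\<^sup>2)"
  have fin: "?X J < \<infinity>" if "J \<in> dyadic" for J using S_energy_bound(1)[OF M that] by (simp add: le_less_trans)
  have "enn2real (?X I) = (cmod (S_hat a I))\<^sup>2 + (enn2real (?X (left_child I)) + enn2real (?X (right_child I)))"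
  proof -
    have "?X I = ennreal ((cmod (S_hat a I))\<^sup>2) + (?X (left_child I) + ?X (right_child I))"
      by (rule infsum_dyadic_split[OF I]) (simp_all add: nonneg_summable_on_complete)
    then show ?thesis using fin[OF ch(1)] fin[OF ch(2)] by (simp add: enn2real_plus)
  qed
  then show ?thesis
    unfolding S_energy_def S_hat_norm[OF a I] ch(5,6) using l by (simp add: field_simps)
qed

section \<open>Exhaustion of the dyadic grid\<close>

definition pos_tower :: "nat \<Rightarrow> real set" where "pos_tower n = {0 ..< 2 ^ n}"
definition neg_tower :: "nat \<Rightarrow> real set" where "neg_tower n = {- (2 ^ n) ..< 0}"

text \<open>No dyadic interval contains points on both sides of 0, so the grid has two increasing chains of top
  intervals.\<close>

definition dyadic_tower :: "(nat \<Rightarrow> real set) \<Rightarrow> bool" where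
  "dyadic_tower G \<longleftrightarrow> (\<forall>n. G n \<in> dyadic \<and> len (G n) = 2 ^ n \<and> G n \<subseteq> G (Suc n) \<and>
     (\<forall>I\<in>dyadic. G n \<subseteq> I \<longrightarrow> I \<in> range G))"

lemma pos_tower_eq: "pos_tower n = {of_int 0 * 2 powi int n ..< of_int (0 + 1) * 2 powi int n}"
  by (simp add: pos_tower_def)

lemma neg_tower_eq: "neg_tower n = {of_int (- 1) * 2 powi int n ..< of_int (- 1 + 1) * 2 powi int n}"
  by (simp add: neg_tower_def)

lemma powi_le_imp_le: "(2::real) ^ n \<le> 2 powi m \<Longrightarrow> int n \<le> m"
proof (rule ccontr)
  assume le: "(2::real) ^ n \<le> 2 powi m" and "\<not> int n \<le> m"
  then have "(2::real) powi m < 2 powi int n" by (intro power_int_strict_increasing) auto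
  with le show False by simp
qed

lemma tower_pos: "dyadic_tower pos_tower"
  unfolding dyadic_tower_def
proof (intro allI conjI ballI impI)
  fix n
  show "pos_tower n \<in> dyadic" unfolding pos_tower_eq by (rule dyadicI)
  show "len (pos_tower n) = 2 ^ n" by (simp add: pos_tower_def)
  show "pos_tower n \<subseteq> pos_tower (Suc n)" by (auto simp: pos_tower_def intro: less_le_trans)
  fix I assume I: "I \<in> dyadic" "pos_tower n \<subseteq> I"
  then obtain k m :: int where km: "I = {of_int k * 2 powi m ..< of_int (k + 1) * 2 powi m}" by (elim dyadicE)
  have "0 \<in> I" using I by (auto simp: pos_tower_def)
  then have k: "k = 0" unfolding km dyadic_mem_iff_floor by simp
  have "(2::real) ^ n \<le> 2 powi m"
    using len_mono_dyadic[OF _ I, unfolded km len_dyadic] \<open>pos_tower n \<in> dyadic\<close> \<open>len (pos_tower n) = 2 ^ n\<close> by simp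
  then have "int n \<le> m" by (rule powi_le_imp_le)
  then have "I = pos_tower (nat m)" unfolding km k pos_tower_eq by simp
  then show "I \<in> range pos_tower" by simp
qed

lemma tower_neg: "dyadic_tower neg_tower"
  unfolding dyadic_tower_def
proof (intro allI conjI ballI impI)
  fix n
  show "neg_tower n \<in> dyadic" unfolding neg_tower_eq by (rule dyadicI)
  show "len (neg_tower n) = 2 ^ n" by (simp add: neg_tower_def)
  show "neg_tower n \<subseteq> neg_tower (Suc n)"
  proof -
    have "- (2 ^ Suc n) \<le> - (2 ^ n :: real)" by simp
    then show ?thesis by (auto simp: neg_tower_def)
  qed
  fix I assume I: "I \<in> dyadic" "neg_tower n \<subseteq> I"
  then obtain k m :: int where km: "I = {of_int k * 2 powi m ..< of_int (k + 1) * 2 powi m}" by (elim dyadicE)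
  have "(2::real) ^ n \<le> 2 powi m"
    using len_mono_dyadic[OF _ I, unfolded km len_dyadic] \<open>neg_tower n \<in> dyadic\<close> \<open>len (neg_tower n) = 2 ^ n\<close> by simp
  then have nm: "int n \<le> m" by (rule powi_le_imp_le)
  have "- 1 \<in> I" using I by (auto simp: neg_tower_def)
  then have "k = \<lfloor>- 1 / (2::real) powi m\<rfloor>" unfolding km dyadic_mem_iff_floor by simp
  also have "\<dots> = - 1"
  proof -
    have "(1::real) \<le> 2 powi m" using nm by (simp add: one_le_power_int)
    then show ?thesis by (simp add: floor_eq_iff field_simps)
  qed
  finally have k: "k = - 1" .
  have "I = neg_tower (nat m)" unfolding km k neg_tower_eq using nm by simp
  then show "I \<in> range neg_tower" by simp
qed

lemma tower_mono:
  assumes "dyadic_tower G" "m \<le> n"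
  shows "G m \<subseteq> G n"
proof (rule lift_Suc_mono_le[OF _ assms(2)])
  show "G n \<subseteq> G (Suc n)" for n using assms(1) by (simp add: dyadic_tower_def)
qed

lemma tower_inj: "dyadic_tower G \<Longrightarrow> inj G"
proof (rule injI)
  fix m n assume "dyadic_tower G" "G m = G n"
  then have "(2::real) ^ m = 2 ^ n" by (metis dyadic_tower_def)
  then show "m = n" by simp
qed

lemma towers_disjoint: "pos_tower n \<inter> neg_tower m = {}"
  by (auto simp: pos_tower_def neg_tower_def)

lemma pow2_unbounded: "\<exists>n. x < (2::real) ^ n"
  using real_arch_pow[of 2 x] by auto

lemma towers_cover: "\<exists>n. x \<in> pos_tower n \<or> x \<in> neg_tower n"
proof -
  obtain n where "\<bar>x\<bar> < (2::real) ^ n" using pow2_unbounded by blast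
  then show ?thesis by (intro exI[of _ n]) (auto simp: pos_tower_def neg_tower_def)
qed

text \<open>Depth \<open>2 * N\<close> below an interval of length 2^N reaches all lengths above
  2^(-N), so growing N widens the window and refines the scale at once. Each frame is a union of two
  trees to which the domination applies.\<close>

definition frame :: "nat \<Rightarrow> real set set" where
  "frame N = descendants (2 * N) (pos_tower N) \<union> descendants (2 * N) (neg_tower N)"

lemma finite_frame [simp]: "finite (frame N)"
  by (simp add: frame_def)

lemma mem_frame: "K \<in> frame N \<longleftrightarrow> K \<in> dyadic \<and> (K \<subseteq> pos_tower N \<or> K \<subseteq> neg_tower N) \<and> 1 < 2 ^ N * len K"
proof -
  have t: "pos_tower N \<in> dyadic" "neg_tower N \<in> dyadic" "len (pos_tower N) = 2 ^ N" "len (neg_tower N) = 2 ^ N"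
    using tower_pos tower_neg by (auto simp: dyadic_tower_def)
  have "2 ^ N < 2 ^ (2 * N) * len K \<longleftrightarrow> 1 < 2 ^ N * len K"
  proof -
    have "2 ^ (2 * N) * len K = 2 ^ N * (2 ^ N * len K)" unfolding mult_2 power_add by (rule mult.assoc)
    then have "2 ^ N < 2 ^ (2 * N) * len K \<longleftrightarrow> 2 ^ N * 1 < 2 ^ N * (2 ^ N * len K)" by (simp only: mult_1_right)
    also have "\<dots> \<longleftrightarrow> 1 < 2 ^ N * len K" by (rule mult_less_cancel_left_pos) simp
    finally show ?thesis .
  qed
  then show ?thesis
    unfolding frame_def by (auto simp: descendants_eq[OF t(1)] descendants_eq[OF t(2)] t(3,4))
qed

lemma frame_mono: "N \<le> N' \<Longrightarrow> frame N \<subseteq> frame N'"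
proof
  fix K assume N: "N \<le> N'" and K: "K \<in> frame N"
  then have "2 ^ N * len K \<le> 2 ^ N' * len K" by (intro mult_right_mono power_increasing) auto
  then show "K \<in> frame N'"
    using K N tower_mono[OF tower_pos N] tower_mono[OF tower_neg N] unfolding mem_frame by fastforce
qed

lemma frame_dyadic: "frame N \<subseteq> dyadic"
  by (auto simp: mem_frame)

lemma frame_exhausts:
  assumes K: "K \<in> dyadic"
  shows "\<exists>N. K \<in> frame N"
proof -
  obtain k n :: int where kn: "K = {of_int k * 2 powi n ..< of_int (k + 1) * 2 powi n}" using K by (elim dyadicE)
  have p: "(0::real) < 2 powi n" by simp
  obtain N1 where N1: "\<bar>of_int k * 2 powi n\<bar> + 2 powi n < (2::real) ^ N1" using pow2_unbounded by blast
  obtain N2 where N2: "1 / len K < 2 ^ N2" using pow2_unbounded by blast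
  define N where "N = max N1 N2"
  have l: "0 < len K" by (rule len_dyadic_pos[OF K])
  have "(2::real) ^ N1 \<le> 2 ^ N" "(2::real) ^ N2 \<le> 2 ^ N" by (auto simp: N_def intro: power_increasing)
  then have N: "\<bar>of_int k * 2 powi n\<bar> + 2 powi n < (2::real) ^ N" "1 / len K < 2 ^ N"
    using less_le_trans[OF N1] less_le_trans[OF N2] by blast+
  have e: "of_int (k + 1) * 2 powi n = of_int k * 2 powi n + (2 powi n :: real)" by (simp add: algebra_simps)
  have "K \<subseteq> pos_tower N \<or> K \<subseteq> neg_tower N"
  proof (cases "0 \<le> k")
    case True
    then have "0 \<le> of_int k * (2 powi n :: real)" by simp
    then show ?thesis using N unfolding kn e pos_tower_def by auto
  next
    case False
    then have "of_int (k + 1) * (2 powi n :: real) \<le> 0" by (intro mult_nonpos_nonneg) auto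
    then show ?thesis using N p unfolding kn e neg_tower_def by auto
  qed
  then show ?thesis using K N(2) l by (intro exI[of _ N]) (simp add: mem_frame field_simps)
qed

text \<open>This turns unordered sums over the grid into limits of a sequence, the form that
  measurability of the operator and Fatou's lemma need.\<close>

lemma filterlim_frame: "filterlim frame (finite_subsets_at_top dyadic) sequentially"
  unfolding filterlim_finite_subsets_at_top
proof (intro allI impI)
  fix X assume X: "finite X \<and> X \<subseteq> dyadic"
  then have "\<forall>K\<in>X. \<exists>N. K \<in> frame N" using frame_exhausts by blast
  then obtain n where n: "\<And>K. K \<in> X \<Longrightarrow> K \<in> frame (n K)" by metis
  have "X \<subseteq> frame N" if "Max (insert 0 (n ` X)) \<le> N" for N
  proof
    fix K assume K: "K \<in> X"
    then have "n K \<le> N" using that X by auto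
    then show "K \<in> frame N" using n[OF K] frame_mono by blast
  qed
  then show "\<forall>\<^sub>F N in sequentially. finite (frame N) \<and> X \<subseteq> frame N \<and> frame N \<subseteq> dyadic"
    using frame_dyadic by (intro eventually_sequentiallyI[of "Max (insert 0 (n ` X))"]) auto
qed

text \<open>Each interval of the tower is half as long as the next one, so the other half of the
  larger interval is free to be its witness set.\<close>

lemma sparse_tower:
  assumes G: "dyadic_tower G"
  shows "sparse_below (G N) (G ` {..N})"
proof (induction N)
  case 0
  have g: "G 0 \<in> dyadic" using G by (auto simp: dyadic_tower_def)
  have "sparse_below (G 0) (insert (G 0) {})"
    by (rule sparse_below_insert[OF sparse_below_empty, of "{}"]) (use g in auto)
  then show ?case by simp
next
  case (Suc N)
  have g: "G (Suc N) \<in> dyadic" "G N \<in> dyadic" "G N \<subseteq> G (Suc N)" "len (G n) = 2 ^ n" for n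
    using G by (auto simp: dyadic_tower_def)
  have "G (Suc N) \<notin> G ` {..N}"
  proof
    assume "G (Suc N) \<in> G ` {..N}"
    then obtain n where "n \<le> N" "G (Suc N) = G n" by auto
    then have "(2::real) ^ Suc N = 2 ^ n" using g(4)[of "Suc N"] g(4)[of n] by simp
    then show False using \<open>n \<le> N\<close> by (subst (asm) power_inject_exp) auto
  qed
  then have "sparse_below (G (Suc N)) (insert (G (Suc N)) (G ` {..N}))"
    using sets_lebesgue_dyadic[OF g(2)] g(3) g(4)[of N] g(4)[of "Suc N"] g(1)
    by (intro sparse_below_insert[OF Suc]) auto
  then show ?case by (simp add: atMost_Suc)
qed

section \<open>Averages of a locally integrable function\<close>

context
  fixes f :: "real \<Rightarrow> complex"
  assumes f [measurable]: "f \<in> borel_measurable lebesgue"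
    and fin: "\<And>Q. Q \<in> dyadic \<Longrightarrow> (\<integral>\<^sup>+x\<in>Q. ennreal (cmod (f x)) \<partial>lebesgue) < \<infinity>"
begin

lemma dyadic_set_integrable: "Q \<in> dyadic \<Longrightarrow> set_integrable lebesgue Q f"
proof -
  assume Q: "Q \<in> dyadic"
  note [measurable] = sets_lebesgue_dyadic[OF Q]
  have "(\<integral>\<^sup>+x. ennreal (norm (indicator Q x *\<^sub>R f x)) \<partial>lebesgue) = (\<integral>\<^sup>+x\<in>Q. ennreal (cmod (f x)) \<partial>lebesgue)"
    by (intro nn_integral_cong) (auto split: split_indicator)
  then show ?thesis unfolding set_integrable_def integrable_iff_bounded using fin[OF Q] by simp
qed

lemma avg_split:
  assumes I: "I \<in> dyadic"
  shows "avg f I = (avg f (left_child I) + avg f (right_child I)) / 2"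
proof -
  note ch = dyadic_children[OF I]
  have "(LINT x:I|lebesgue. f x) = (LINT x:left_child I|lebesgue. f x) + (LINT x:right_child I|lebesgue. f x)"
    using set_integral_Un[OF ch(4) dyadic_set_integrable[OF ch(1)] dyadic_set_integrable[OF ch(2)]] unfolding ch(3) .
  then show ?thesis unfolding avg_def ch(5,6) using len_dyadic_pos[OF I] by (simp add: field_simps)
qed

lemma ravg_split:
  assumes I: "I \<in> dyadic"
  shows "ravg (\<lambda>x. cmod (f x)) I = (ravg (\<lambda>x. cmod (f x)) (left_child I) + ravg (\<lambda>x. cmod (f x)) (right_child I)) / 2"
proof -
  note ch = dyadic_children[OF I]
  have "(\<integral>\<^sup>+x\<in>I. ennreal (cmod (f x)) \<partial>lebesgue)
    = (\<integral>\<^sup>+x\<in>left_child I. ennreal (cmod (f x)) \<partial>lebesgue) + (\<integral>\<^sup>+x\<in>right_child I. ennreal (cmod (f x)) \<partial>lebesgue)"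
    using nn_integral_disjoint_pair[OF _ sets_lebesgue_dyadic[OF ch(1)] sets_lebesgue_dyadic[OF ch(2)] ch(4), of "\<lambda>x. ennreal (cmod (f x))"]
    unfolding ch(3) by simp
  then show ?thesis
    unfolding ravg_def ch(5,6) using len_dyadic_pos[OF I] fin[OF ch(1)] fin[OF ch(2)] by (simp add: enn2real_plus field_simps)
qed

lemma set_integral_norm_eq:
  assumes Q: "Q \<in> dyadic"
  shows "(LINT x:Q|lebesgue. cmod (f x)) = ravg (\<lambda>x. cmod (f x)) Q * len Q"
proof -
  note [measurable] = sets_lebesgue_dyadic[OF Q]
  have "(LINT x:Q|lebesgue. cmod (f x)) = enn2real (\<integral>\<^sup>+x. ennreal (indicator Q x *\<^sub>R cmod (f x)) \<partial>lebesgue)"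
    unfolding set_lebesgue_integral_def by (rule integral_eq_nn_integral) auto
  also have "(\<integral>\<^sup>+x. ennreal (indicator Q x *\<^sub>R cmod (f x)) \<partial>lebesgue) = (\<integral>\<^sup>+x\<in>Q. ennreal (cmod (f x)) \<partial>lebesgue)"
    by (intro nn_integral_cong) (auto split: split_indicator)
  finally show ?thesis using len_dyadic_pos[OF Q] by (simp add: ravg_def)
qed

lemma avg_le_ravg:
  assumes Q: "Q \<in> dyadic"
  shows "cmod (avg f Q) \<le> ravg (\<lambda>x. cmod (f x)) Q"
proof -
  have "cmod (LINT x:Q|lebesgue. f x) \<le> (LINT x:Q|lebesgue. cmod (f x))"
    by (rule set_integral_norm_bound[OF dyadic_set_integrable[OF Q]])
  then show ?thesis
    unfolding avg_def set_integral_norm_eq[OF Q] using len_dyadic_pos[OF Q] by (simp add: norm_divide pos_divide_le_eq)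
qed

lemma avg_norm_eq:
  assumes Q: "Q \<in> dyadic"
  shows "avg (\<lambda>x. of_real (cmod (f x))) Q = of_real (ravg (\<lambda>x. cmod (f x)) Q)"
  unfolding avg_def using set_integral_norm_eq[OF Q] len_dyadic_pos[OF Q] set_integral_complex_of_real[of lebesgue Q "\<lambda>x. cmod (f x)"]
  by (simp add: field_simps)

end

section \<open>Integrals of p-th powers and sparse sums\<close>

context Ap_weight
begin

text \<open>The p-th power of the norm. Estimates are made on this level, and
  \<open>Lp_norm_le_iff\<close> translates them to norms.\<close>

definition Lp_int :: "(real \<Rightarrow> complex) \<Rightarrow> ennreal" where
  "Lp_int f = (\<integral>\<^sup>+x. ennreal (cmod (f x) powr p * w x) \<partial>lebesgue)"

lemma Lp_norm_eq: "Lp_norm p w f = epowr (Lp_int f) (1 / p)"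
  by (simp add: Lp_norm_def Lp_int_def)

lemma Lp_iff: "f \<in> Lp p w \<longleftrightarrow> f \<in> borel_measurable lebesgue \<and> Lp_int f < \<infinity>"
  unfolding Lp_def Lp_norm_eq epowr_def by (auto simp: less_top)

lemma Lp_norm_le_iff: "0 \<le> t \<Longrightarrow> Lp_norm p w f \<le> ennreal t \<longleftrightarrow> Lp_int f \<le> ennreal (t powr p)"
  unfolding Lp_norm_eq using p by (subst epowr_le_iff) auto

lemma Lp_measurable: "f \<in> Lp p w \<Longrightarrow> f \<in> borel_measurable lebesgue"
  by (simp add: Lp_iff)

lemma Lp_local:
  assumes f: "f \<in> Lp p w" and Q: "Q \<in> dyadic"
  shows "(\<integral>\<^sup>+x\<in>Q. ennreal (cmod (f x)) \<partial>lebesgue) < \<infinity>"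
  using f Q unfolding Lp_iff Lp_int_def by (intro local_integral_finite) auto

definition sparse_sum :: "(real \<Rightarrow> complex) \<Rightarrow> real set set \<Rightarrow> real \<Rightarrow> real" where
  "sparse_sum f S x = (\<Sum>Q\<in>S. ravg (\<lambda>x. cmod (f x)) Q * indicator Q x)"

lemma sparse_sum_nonneg: "0 \<le> sparse_sum f S x"
  unfolding sparse_sum_def by (intro sum_nonneg) (simp add: ravg_nonneg)

lemma sparse_sum_measurable:
  assumes "S \<subseteq> dyadic"
  shows "sparse_sum f S \<in> borel_measurable lebesgue"
  unfolding sparse_sum_def
  by (intro borel_measurable_sum borel_measurable_times borel_measurable_indicator borel_measurable_const)
    (use assms sets_lebesgue_dyadic in auto)

lemma sparse_sum_estimate:
  "\<exists>C\<ge>0. \<forall>S. finite S \<longrightarrow> sparse_collection (1 / 2) S \<longrightarrow> (\<forall>f \<in> Lp p w.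
    (\<integral>\<^sup>+x. ennreal (sparse_sum f S x powr p * w x) \<partial>lebesgue) \<le> ennreal C * Lp_int f)"
proof -
  obtain C where C: "C \<ge> 0" "\<forall>S f. finite S \<longrightarrow> sparse_collection (1 / 2) S \<longrightarrow> f \<in> borel_measurable lebesgue \<longrightarrow> (\<forall>x. 0 \<le> f x) \<longrightarrow>
    (\<integral>\<^sup>+x. ennreal (f x powr p * w x) \<partial>lebesgue) < \<infinity> \<longrightarrow>
    (\<integral>\<^sup>+x. ennreal ((\<Sum>Q\<in>S. ravg f Q * indicator Q x) powr p * w x) \<partial>lebesgue)
      \<le> ennreal C * (\<integral>\<^sup>+x. ennreal (f x powr p * w x) \<partial>lebesgue)"
    using sparse_operator_estimate by blast
  show ?thesis
  proof (intro exI[of _ C] conjI allI impI ballI)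
    fix S f assume S: "finite S" "sparse_collection (1 / 2) S" and f: "f \<in> Lp p w"
    show "(\<integral>\<^sup>+x. ennreal (sparse_sum f S x powr p * w x) \<partial>lebesgue) \<le> ennreal C * Lp_int f"
      unfolding sparse_sum_def Lp_int_def
      by (rule C(2)[rule_format, OF S]) (use f in \<open>auto simp: Lp_iff Lp_int_def\<close>)
  qed (rule C(1))
qed

end

section \<open>Convergence and norm bounds\<close>

text \<open>A single \<open>M\<close> bounds both norms; it is strictly positive since the potential
  divides by its square.\<close>

locale bounded_symbol = Ap_weight p w for p :: real and w :: "real \<Rightarrow> real" +
  fixes a :: "real set \<Rightarrow> complex" and M :: real
  assumes ls: "locally_summable a" and M_pos: "0 < M"
    and cm: "CM_norm (S_hat a) \<le> ennreal M" and li: "linf_norm (E_seq a) \<le> ennreal M"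
begin

lemma E_seq_le: "I \<in> dyadic \<Longrightarrow> cmod (E_seq a I) \<le> M"
  using li M_pos unfolding linf_norm_def by (auto simp: SUP_le_iff)

text \<open>The quotient is a value of \<open>E_seq a\<close> minus a mean of two others, each
  bounded by \<open>M\<close>. This controls the large intervals, where local summability of the
  symbol gives no uniform bound.\<close>

lemma coefficient_le: "I \<in> dyadic \<Longrightarrow> cmod (a I) / len I \<le> 2 * M"
proof -
  assume I: "I \<in> dyadic"
  note ch = dyadic_children[OF I]
  have "cmod (a I) / len I = cmod (E_seq a I - (E_seq a (left_child I) + E_seq a (right_child I)) / 2)"
    unfolding E_seq_increment[OF ls I] using len_dyadic_pos[OF I] by (simp add: norm_divide)
  also have "\<dots> \<le> cmod (E_seq a I) + cmod ((E_seq a (left_child I) + E_seq a (right_child I)) / 2)"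
    by (rule norm_triangle_ineq4)
  also have "cmod ((E_seq a (left_child I) + E_seq a (right_child I)) / 2) \<le> M"
    using norm_triangle_ineq[of "E_seq a (left_child I)" "E_seq a (right_child I)"] E_seq_le[OF ch(1)] E_seq_le[OF ch(2)]
    by (simp add: norm_divide)
  finally show ?thesis using E_seq_le[OF I] by linarith
qed

lemma averages:
  assumes f: "f \<in> Lp p w"
  shows "dyadic_averages (E_seq a) (avg f) (ravg (\<lambda>x. cmod (f x))) (S_energy a) M"
proof
  fix I assume I: "I \<in> dyadic"
  show "cmod (E_seq a I) \<le> M" by (rule E_seq_le[OF I])
  show "avg f I = (avg f (left_child I) + avg f (right_child I)) / 2"
    by (rule avg_split[OF Lp_measurable[OF f] Lp_local[OF f] I])
  show "ravg (\<lambda>x. cmod (f x)) I = (ravg (\<lambda>x. cmod (f x)) (left_child I) + ravg (\<lambda>x. cmod (f x)) (right_child I)) / 2"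
    by (rule ravg_split[OF Lp_measurable[OF f] Lp_local[OF f] I])
  show "cmod (avg f I) \<le> ravg (\<lambda>x. cmod (f x)) I"
    by (rule avg_le_ravg[OF Lp_measurable[OF f] Lp_local[OF f] I])
  show "(cmod ((E_seq a (left_child I) - E_seq a (right_child I)) / 2))\<^sup>2 + (S_energy a (left_child I) + S_energy a (right_child I)) / 2
    \<le> S_energy a I"
    using S_energy_split[OF ls cm _ I] M_pos by simp
  show "0 \<le> S_energy a I \<and> S_energy a I \<le> M\<^sup>2"
    using S_energy_bound(2,3)[OF cm _ I] M_pos by simp
qed (rule M_pos)

definition comp_term :: "(real \<Rightarrow> complex) \<Rightarrow> real \<Rightarrow> real set \<Rightarrow> complex" where
  "comp_term f x I = a I * avg f I * of_real (indicator I x / len I)"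

lemma descendants_domination:
  assumes f: "f \<in> Lp p w" and I: "I \<in> dyadic"
  shows "\<exists>S. sparse_below I S \<and>
    (\<forall>x. cmod (\<Sum>J\<in>descendants m I. comp_term f x J) \<le> 304 * M * sparse_sum f S x) \<and>
    (\<forall>K\<in>descendants m I. \<forall>x\<in>K. ravg (\<lambda>x. cmod (f x)) K \<le> 4 * sparse_sum f S x)"
proof -
  interpret dyadic_averages "E_seq a" "avg f" "ravg (\<lambda>x. cmod (f x))" "S_energy a" M
    by (rule averages[OF f])
  have "(\<Sum>J\<in>descendants m I. comp_term f x J) = trunc m I x" for x
    unfolding trunc_def
  proof (rule sum.cong[OF refl])
    fix J assume "J \<in> descendants m I"
    then have J: "J \<in> dyadic" using descendants_dyadic[OF I] by blast
    show "comp_term f x J = coeff J * indicator J x"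
      unfolding coeff_def E_seq_increment[OF ls J] comp_term_def by (simp add: indicator_def)
  qed
  then show ?thesis using sparse_domination[OF I, of m] unfolding sparse_sum_def by simp
qed

lemma frame_domination:
  assumes f: "f \<in> Lp p w"
  shows "\<exists>S. finite S \<and> sparse_collection (1 / 2) S \<and>
    (\<forall>x. cmod (\<Sum>J\<in>frame N. comp_term f x J) \<le> 304 * M * sparse_sum f S x) \<and>
    (\<forall>K\<in>frame N. \<forall>x\<in>K. ravg (\<lambda>x. cmod (f x)) K \<le> 4 * sparse_sum f S x)"
proof -
  let ?P = "pos_tower N" and ?Q = "neg_tower N"
  have t: "?P \<in> dyadic" "?Q \<in> dyadic"
    using tower_pos tower_neg by (auto simp: dyadic_tower_def)
  obtain S1 where S1: "sparse_below ?P S1"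
    "\<And>x. cmod (\<Sum>J\<in>descendants (2 * N) ?P. comp_term f x J) \<le> 304 * M * sparse_sum f S1 x"
    "\<And>K x. K \<in> descendants (2 * N) ?P \<Longrightarrow> x \<in> K \<Longrightarrow> ravg (\<lambda>x. cmod (f x)) K \<le> 4 * sparse_sum f S1 x"
    using descendants_domination[OF f t(1), of "2 * N"] by blast
  obtain S2 where S2: "sparse_below ?Q S2"
    "\<And>x. cmod (\<Sum>J\<in>descendants (2 * N) ?Q. comp_term f x J) \<le> 304 * M * sparse_sum f S2 x"
    "\<And>K x. K \<in> descendants (2 * N) ?Q \<Longrightarrow> x \<in> K \<Longrightarrow> ravg (\<lambda>x. cmod (f x)) K \<le> 4 * sparse_sum f S2 x"
    using descendants_domination[OF f t(2), of "2 * N"] by blast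
  have PQ: "?P \<inter> ?Q = {}" "?P \<noteq> ?Q" using towers_disjoint[of N N] dyadic_nonempty[OF t(1)] by auto
  let ?S = "\<lambda>K. if K = ?P then S1 else S2"
  have sb: "sparse_below (\<Union>{?P, ?Q}) (\<Union>K\<in>{?P, ?Q}. ?S K)"
    by (rule sparse_below_UN) (use S1(1) S2(1) PQ in \<open>auto simp: disjoint_family_on_def\<close>)
  have SU: "(\<Union>K\<in>{?P, ?Q}. ?S K) = S1 \<union> S2" using PQ(2) by auto
  have S: "finite (S1 \<union> S2)" "sparse_collection (1 / 2) (S1 \<union> S2)"
    using sb unfolding SU sparse_below_def by blast+
  have disj: "S1 \<inter> S2 = {}"
  proof -
    have "Q = {}" if "Q \<in> S1" "Q \<in> S2" for Q
      using that S1(1) S2(1) PQ(1) unfolding sparse_below_def by blast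
    moreover have "S1 \<subseteq> dyadic" using S1(1) by (auto simp: sparse_below_def sparse_collection_def)
    ultimately show ?thesis using dyadic_nonempty by blast
  qed
  have sum: "sparse_sum f (S1 \<union> S2) x = sparse_sum f S1 x + sparse_sum f S2 x" for x
    unfolding sparse_sum_def using S(1) disj by (intro sum.union_disjoint) auto
  have fdisj: "descendants (2 * N) ?P \<inter> descendants (2 * N) ?Q = {}"
  proof -
    have "K = {}" "K \<in> dyadic" if "K \<in> descendants (2 * N) ?P" "K \<in> descendants (2 * N) ?Q" for K
      using descendants_dyadic[OF t(1) that(1)] descendants_dyadic[OF t(2) that(2)] PQ(1) by auto
    then show ?thesis using dyadic_nonempty by auto
  qed
  have "cmod (\<Sum>J\<in>frame N. comp_term f x J) \<le> 304 * M * sparse_sum f (S1 \<union> S2) x" for x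
  proof -
    have "(\<Sum>J\<in>frame N. comp_term f x J) = (\<Sum>J\<in>descendants (2 * N) ?P. comp_term f x J) + (\<Sum>J\<in>descendants (2 * N) ?Q. comp_term f x J)"
      unfolding frame_def by (rule sum.union_disjoint[OF _ _ fdisj]) auto
    also have "cmod \<dots> \<le> 304 * M * sparse_sum f S1 x + 304 * M * sparse_sum f S2 x"
      using norm_triangle_ineq S1(2)[of x] S2(2)[of x] by (meson add_mono order_trans)
    finally show ?thesis unfolding sum by (simp add: distrib_left)
  qed
  moreover have "ravg (\<lambda>x. cmod (f x)) K \<le> 4 * sparse_sum f (S1 \<union> S2) x" if "K \<in> frame N" "x \<in> K" for K x
    using that S1(3)[of K x] S2(3)[of K x] sparse_sum_nonneg[of f S1 x] sparse_sum_nonneg[of f S2 x]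
    unfolding frame_def sum by auto
  ultimately show ?thesis using S by blast
qed

text \<open>On each frame the truncated maximal function is at most 4 times some sparse sum. The
  sums vary with the frame, but their weighted bound does not, so monotone convergence gives a
  finite integral for the full supremum.\<close>

lemma maximal_function_finite:
  assumes f: "f \<in> Lp p w"
  shows "AE x in lebesgue. \<exists>B. \<forall>K\<in>dyadic. x \<in> K \<longrightarrow> ravg (\<lambda>x. cmod (f x)) K \<le> B"
proof -
  let ?u = "ravg (\<lambda>x. cmod (f x))"
  obtain C where C: "C \<ge> 0" "\<And>S. finite S \<Longrightarrow> sparse_collection (1 / 2) S \<Longrightarrow>
    (\<integral>\<^sup>+x. ennreal (sparse_sum f S x powr p * w x) \<partial>lebesgue) \<le> ennreal C * Lp_int f"
    using sparse_sum_estimate f by blast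
  define g where "g N x = (SUP K\<in>frame N. ennreal (?u K powr p * w x) * indicator K x)" for N x
  have g_meas: "g N \<in> borel_measurable lebesgue" for N
  proof -
    have m: "(\<lambda>x. ennreal (?u K powr p * w x) * indicator K x) \<in> borel_measurable lebesgue" if "K \<in> frame N" for K
    proof -
      have [measurable]: "K \<in> sets lebesgue" using that frame_dyadic sets_lebesgue_dyadic by blast
      show ?thesis by measurable
    qed
    show ?thesis unfolding g_def by (rule borel_measurable_SUP[OF countable_finite[OF finite_frame] m])
  qed
  have g_le: "(\<integral>\<^sup>+x. g N x \<partial>lebesgue) \<le> ennreal (4 powr p) * (ennreal C * Lp_int f)" for N
  proof -
    obtain S where S: "finite S" "sparse_collection (1 / 2) S"
      and mx: "\<And>K x. K \<in> frame N \<Longrightarrow> x \<in> K \<Longrightarrow> ?u K \<le> 4 * sparse_sum f S x"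
      using frame_domination[OF f, of N] by blast
    have Sd: "S \<subseteq> dyadic" using S by (simp add: sparse_collection_def)
    note [measurable] = sparse_sum_measurable[OF Sd]
    have "g N x \<le> ennreal (4 powr p) * ennreal (sparse_sum f S x powr p * w x)" for x
      unfolding g_def
    proof (rule SUP_least)
      fix K assume K: "K \<in> frame N"
      show "ennreal (?u K powr p * w x) * indicator K x \<le> ennreal (4 powr p) * ennreal (sparse_sum f S x powr p * w x)"
      proof (cases "x \<in> K")
        case True
        have "?u K powr p \<le> (4 * sparse_sum f S x) powr p"
          using mx[OF K True] p by (intro powr_mono2) (auto simp: ravg_nonneg)
        then have "?u K powr p * w x \<le> 4 powr p * (sparse_sum f S x powr p * w x)"
          using w_nonneg[of x] sparse_sum_nonneg[of f S x] by (simp add: powr_mult mult_right_mono mult.assoc[symmetric])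
        then show ?thesis using True w_nonneg[of x] by (simp add: ennreal_mult[symmetric] ennreal_leI)
      qed simp
    qed
    then have "(\<integral>\<^sup>+x. g N x \<partial>lebesgue) \<le> (\<integral>\<^sup>+x. ennreal (4 powr p) * ennreal (sparse_sum f S x powr p * w x) \<partial>lebesgue)"
      by (intro nn_integral_mono) auto
    also have "\<dots> = ennreal (4 powr p) * (\<integral>\<^sup>+x. ennreal (sparse_sum f S x powr p * w x) \<partial>lebesgue)"
      by (rule nn_integral_cmult) measurable
    also have "\<dots> \<le> ennreal (4 powr p) * (ennreal C * Lp_int f)"
      using C(2)[OF S] by (rule mult_left_mono) simp
    finally show ?thesis .
  qed
  have "incseq g"
    unfolding incseq_def le_fun_def g_def by (intro allI impI SUP_subset_mono frame_mono) auto
  then have "(\<integral>\<^sup>+x. (SUP N. g N x) \<partial>lebesgue) = (SUP N. \<integral>\<^sup>+x. g N x \<partial>lebesgue)"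
    using g_meas by (rule nn_integral_monotone_convergence_SUP)
  also have "\<dots> \<le> ennreal (4 powr p) * (ennreal C * Lp_int f)" by (rule SUP_least) (rule g_le)
  also have "\<dots> < \<infinity>" using f by (simp add: Lp_iff ennreal_mult_less_top)
  finally have "(\<integral>\<^sup>+x. (SUP N. g N x) \<partial>lebesgue) \<noteq> \<infinity>" by simp
  then have "AE x in lebesgue. (SUP N. g N x) \<noteq> \<infinity>"
    using g_meas by (intro nn_integral_PInf_AE borel_measurable_SUP) auto
  with w_pos show ?thesis
  proof eventually_elim
    fix x assume wx: "0 < w x" and "(SUP N. g N x) \<noteq> \<infinity>"
    then obtain r where r: "(SUP N. g N x) = ennreal r" "0 \<le> r" by (cases "SUP N. g N x") auto
    have "?u K \<le> (r / w x) powr (1 / p)" if K: "K \<in> dyadic" "x \<in> K" for K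
    proof -
      obtain N where N: "K \<in> frame N" using frame_exhausts[OF K(1)] by blast
      have "ennreal (?u K powr p * w x) = ennreal (?u K powr p * w x) * indicator K x" using K by simp
      also have "\<dots> \<le> g N x" unfolding g_def by (rule SUP_upper[OF N])
      also have "\<dots> \<le> ennreal r" unfolding r(1)[symmetric] by (rule SUP_upper) simp
      finally have "?u K powr p * w x \<le> r" using r by (simp add: ennreal_le_iff)
      then have "?u K powr p \<le> r / w x" using wx by (simp add: pos_le_divide_eq)
      then have "(?u K powr p) powr (1 / p) \<le> (r / w x) powr (1 / p)" using p by (intro powr_mono2) auto
      then show ?thesis using p by (simp add: powr_powr ravg_nonneg)
    qed
    then show "\<exists>B. \<forall>K\<in>dyadic. x \<in> K \<longrightarrow> ?u K \<le> B" by blast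
  qed
qed

text \<open>Each term has integral \<open>cmod (a I)\<close>, and unordered summability of complex
  numbers is absolute. Exchanging sum and integral shows that the series has a finite
  integral.\<close>

lemma local_coefficients_summable:
  assumes I0: "I0 \<in> dyadic"
  shows "AE x in lebesgue. (\<lambda>I. cmod (a I) / len I * indicator I x) summable_on {I \<in> dyadic. I \<subseteq> I0}"
proof -
  let ?D = "{I \<in> dyadic. I \<subseteq> I0}"
  have cD: "countable ?D" using countable_dyadic by (rule countable_subset[rotated]) auto
  have meas: "(\<lambda>x. ennreal (cmod (a I) / len I * indicator I x)) \<in> borel_measurable lebesgue" if "I \<in> ?D" for I
  proof -
    have [measurable]: "I \<in> sets lebesgue" using that sets_lebesgue_dyadic by blast
    show ?thesis by measurable
  qed
  have one: "(\<integral>\<^sup>+x. ennreal (cmod (a I) / len I * indicator I x) \<partial>lebesgue) = ennreal (norm (a I))" if "I \<in> ?D" for I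
  proof -
    have I: "I \<in> dyadic" using that by simp
    have "(\<integral>\<^sup>+x. ennreal (cmod (a I) / len I * indicator I x) \<partial>lebesgue) = (\<integral>\<^sup>+x. ennreal (cmod (a I) / len I) * indicator I x \<partial>lebesgue)"
      by (intro nn_integral_cong) (auto split: split_indicator)
    also have "\<dots> = ennreal (cmod (a I) / len I) * ennreal (len I)"
      using sets_lebesgue_dyadic[OF I] unfolding emeasure_dyadic[OF I, symmetric] by (rule nn_integral_cmult_indicator)
    also have "\<dots> = ennreal (norm (a I))"
      using len_dyadic_pos[OF I] by (simp add: ennreal_mult[symmetric])
    finally show ?thesis .
  qed
  have "a summable_on ?D" using ls I0 by (simp add: locally_summable_def)
  then have "Infinite_Sum.abs_summable_on a ?D" by (simp add: summable_on_iff_abs_summable_on_complex)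
  then have "integrable (count_space ?D) a"
    unfolding abs_summable_equivalent Infinite_Set_Sum.abs_summable_on_def .
  then have fin: "(\<integral>\<^sup>+I. ennreal (norm (a I)) \<partial>count_space ?D) < \<infinity>"
    by (simp add: integrable_iff_bounded)
  have "(\<integral>\<^sup>+x. (\<integral>\<^sup>+I. ennreal (cmod (a I) / len I * indicator I x) \<partial>count_space ?D) \<partial>lebesgue)
    = (\<integral>\<^sup>+I. (\<integral>\<^sup>+x. ennreal (cmod (a I) / len I * indicator I x) \<partial>lebesgue) \<partial>count_space ?D)"
    by (rule nn_integral_count_space_nn_integral[OF cD meas])
  also have "\<dots> = (\<integral>\<^sup>+I. ennreal (norm (a I)) \<partial>count_space ?D)"
    by (intro nn_integral_cong one) simp
  finally have "(\<integral>\<^sup>+x. (\<integral>\<^sup>+I. ennreal (cmod (a I) / len I * indicator I x) \<partial>count_space ?D) \<partial>lebesgue) \<noteq> \<infinity>"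
    using fin by simp
  moreover have "(\<lambda>x. \<integral>\<^sup>+I. ennreal (cmod (a I) / len I * indicator I x) \<partial>count_space ?D) \<in> borel_measurable lebesgue"
  proof (rule sigma_finite_measure.borel_measurable_nn_integral[OF sigma_finite_measure_count_space_countable[OF cD]])
    have "(\<lambda>z. ennreal (cmod (a (snd z)) / len (snd z) * indicator (snd z) (fst z))) \<in> borel_measurable (lebesgue \<Otimes>\<^sub>M count_space ?D)"
      by (rule measurable_compose_countable'[where f="\<lambda>I z. ennreal (cmod (a I) / len I * indicator I (fst z))" and g=snd,
          OF measurable_compose[OF measurable_fst meas] measurable_snd cD])
    then show "(\<lambda>(x, I). ennreal (cmod (a I) / len I * indicator I x)) \<in> borel_measurable (lebesgue \<Otimes>\<^sub>M count_space ?D)"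
      by (simp add: case_prod_beta')
  qed
  ultimately have "AE x in lebesgue. (\<integral>\<^sup>+I. ennreal (cmod (a I) / len I * indicator I x) \<partial>count_space ?D) \<noteq> \<infinity>"
    by (intro nn_integral_PInf_AE) auto
  then show ?thesis
  proof eventually_elim
    fix x
    let ?h = "\<lambda>I. cmod (a I) / len I * indicator I x"
    assume "(\<integral>\<^sup>+I. ennreal (?h I) \<partial>count_space ?D) \<noteq> \<infinity>"
    then have "integrable (count_space ?D) ?h"
      using len_dyadic_pos by (intro integrableI_nonneg) (auto simp: less_top AE_count_space intro!: mult_nonneg_nonneg)
    then have "Infinite_Sum.abs_summable_on ?h ?D"
      unfolding abs_summable_equivalent Infinite_Set_Sum.abs_summable_on_def .
    then show "?h summable_on ?D" by (rule abs_summable_summable)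
  qed
qed

text \<open>The first N intervals of a tower form a sparse collection whose sparse sum is constant on the smallest
  one.\<close>

lemma tower_averages_summable:
  assumes f: "f \<in> Lp p w" and G: "dyadic_tower G"
  shows "summable (\<lambda>n. ravg (\<lambda>x. cmod (f x)) (G n))"
proof -
  let ?u = "ravg (\<lambda>x. cmod (f x))"
  obtain C where C: "C \<ge> 0" "\<And>S. finite S \<Longrightarrow> sparse_collection (1 / 2) S \<Longrightarrow>
    (\<integral>\<^sup>+x. ennreal (sparse_sum f S x powr p * w x) \<partial>lebesgue) \<le> ennreal C * Lp_int f"
    using sparse_sum_estimate f by blast
  obtain r where r: "ennreal C * Lp_int f = ennreal r" "0 \<le> r"
    using f by (cases "ennreal C * Lp_int f") (auto simp: Lp_iff ennreal_mult_eq_top_iff)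
  have G0: "G 0 \<in> dyadic" using G by (simp add: dyadic_tower_def)
  have W: "0 < w_mass (G 0)" "(\<integral>\<^sup>+x\<in>G 0. ennreal (w x) \<partial>lebesgue) = ennreal (w_mass (G 0))"
    using holder_weight(1)[OF G0 sets_lebesgue_dyadic[OF G0] subset_refl len_dyadic_pos[OF G0]] w_mass_finite[OF G0]
    by (auto simp: w_mass_def less_top)
  have bound: "(\<Sum>n\<le>N. ?u (G n)) \<le> (r / w_mass (G 0)) powr (1 / p)" for N
  proof -
    have S: "finite (G ` {..N})" "sparse_collection (1 / 2) (G ` {..N})"
      using sparse_tower[OF G, of N] by (auto simp: sparse_below_def)
    have inj: "inj_on G {..N}" by (rule inj_on_subset[OF tower_inj[OF G]]) simp
    define t where "t = (\<Sum>n\<le>N. ?u (G n))"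
    have t0: "0 \<le> t" unfolding t_def by (intro sum_nonneg ravg_nonneg)
    have eq: "sparse_sum f (G ` {..N}) x = t" if "x \<in> G 0" for x
    proof -
      have "x \<in> G n" for n using tower_mono[OF G, of 0 n] that by auto
      then show ?thesis unfolding sparse_sum_def t_def by (simp add: sum.reindex[OF inj])
    qed
    have "ennreal (t powr p) * ennreal (w_mass (G 0)) = (\<integral>\<^sup>+x. ennreal (t powr p) * (ennreal (w x) * indicator (G 0) x) \<partial>lebesgue)"
      unfolding W(2)[symmetric] using sets_lebesgue_dyadic[OF G0] by (subst nn_integral_cmult) auto
    also have "\<dots> \<le> (\<integral>\<^sup>+x. ennreal (sparse_sum f (G ` {..N}) x powr p * w x) \<partial>lebesgue)"
      using eq w_nonneg by (intro nn_integral_mono) (auto simp: ennreal_mult split: split_indicator)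
    also have "\<dots> \<le> ennreal r" using C(2)[OF S] r by simp
    finally have "t powr p * w_mass (G 0) \<le> r" using W(1) r by (simp add: ennreal_mult[symmetric] ennreal_le_iff)
    then have "t powr p \<le> r / w_mass (G 0)" using W(1) by (simp add: pos_le_divide_eq)
    then have "(t powr p) powr (1 / p) \<le> (r / w_mass (G 0)) powr (1 / p)" using p by (intro powr_mono2) auto
    then show ?thesis using p t0 by (simp add: powr_powr t_def)
  qed
  show ?thesis by (rule bounded_imp_summable[OF ravg_nonneg bound])
qed

end

section \<open>Almost everywhere convergence and passage to the limit\<close>

context bounded_symbol
begin

lemma comp_term_norm: "cmod (comp_term f x I) = cmod (avg f I) * (cmod (a I) / len I * indicator I x)"
  by (simp add: comp_term_def norm_mult norm_divide indicator_def)

text \<open>A dyadic interval meeting \<open>G n\<close> at x lies inside \<open>G n\<close> or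
  belongs to the tower. Inside, the maximal function at x is finite and the coefficients are
  summable; along the tower, the coefficients are bounded and the averages are summable.\<close>

lemma converges_on_tower:
  assumes f: "f \<in> Lp p w" and G: "dyadic_tower G"
  shows "AE x in lebesgue. \<forall>n. x \<in> G n \<longrightarrow> comp_term f x summable_on dyadic"
proof -
  let ?u = "ravg (\<lambda>x. cmod (f x))"
  have Gd: "G n \<in> dyadic" for n using G by (simp add: dyadic_tower_def)
  have avg: "cmod (avg f I) \<le> ?u I" if "I \<in> dyadic" for I
    by (rule avg_le_ravg[OF Lp_measurable[OF f] Lp_local[OF f] that])
  have "AE x in lebesgue. \<forall>n. (\<lambda>I. cmod (a I) / len I * indicator I x) summable_on {I \<in> dyadic. I \<subseteq> G n}"
    unfolding AE_all_countable using local_coefficients_summable[OF Gd] by blast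
  with maximal_function_finite[OF f] show ?thesis
  proof eventually_elim
    fix x
    assume "\<exists>B. \<forall>K\<in>dyadic. x \<in> K \<longrightarrow> ?u K \<le> B"
      and loc: "\<forall>n. (\<lambda>I. cmod (a I) / len I * indicator I x) summable_on {I \<in> dyadic. I \<subseteq> G n}"
    then obtain B where B: "\<And>K. K \<in> dyadic \<Longrightarrow> x \<in> K \<Longrightarrow> ?u K \<le> B" by blast
    show "\<forall>n. x \<in> G n \<longrightarrow> comp_term f x summable_on dyadic"
    proof (intro allI impI)
      fix n assume x: "x \<in> G n"
      let ?A = "{I \<in> dyadic. I \<subseteq> G n}"
      have "(\<lambda>I. norm (comp_term f x I)) summable_on ?A"
      proof (rule summable_on_comparison_test)
        show "(\<lambda>I. B * (cmod (a I) / len I * indicator I x)) summable_on ?A"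
          by (rule summable_on_cmult_right) (rule loc[rule_format])
        fix I assume "I \<in> ?A"
        then have I: "I \<in> dyadic" by simp
        show "norm (comp_term f x I) \<le> B * (cmod (a I) / len I * indicator I x)"
        proof (cases "x \<in> I")
          case True
          then have "cmod (avg f I) \<le> B" using avg[OF I] B[OF I] by fastforce
          then show ?thesis unfolding comp_term_norm using len_dyadic_pos[OF I] by (intro mult_right_mono) auto
        qed (simp add: comp_term_norm)
      qed simp
      then have sA: "comp_term f x summable_on ?A" by (rule abs_summable_summable)
      have "summable (\<lambda>k. norm (comp_term f x (G k)))"
      proof (rule summable_comparison_test')
        show "summable (\<lambda>k. 2 * M * ?u (G k))"
          by (intro summable_mult tower_averages_summable[OF f G])
        fix k :: nat
        have c: "cmod (a (G k)) / len (G k) * indicator (G k) x \<le> 2 * M"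
          using coefficient_le[OF Gd[of k]] M_pos by (cases "x \<in> G k") auto
        have "norm (comp_term f x (G k)) \<le> ?u (G k) * (2 * M)"
          unfolding comp_term_norm by (rule mult_mono[OF avg[OF Gd] c ravg_nonneg]) simp
        then show "norm (norm (comp_term f x (G k))) \<le> 2 * M * ?u (G k)" by (simp add: mult_ac)
      qed
      then have "(comp_term f x \<circ> G) summable_on UNIV"
        unfolding o_def by (rule norm_summable_imp_summable_on)
      then have "comp_term f x summable_on range G" using summable_on_reindex[OF tower_inj[OF G]] by blast
      then have "comp_term f x summable_on (range G - ?A)" by (rule summable_on_subset) auto
      with sA have s: "comp_term f x summable_on (?A \<union> (range G - ?A))" by (rule summable_on_Un_disjoint) auto
      have "comp_term f x summable_on dyadic \<longleftrightarrow> comp_term f x summable_on (?A \<union> (range G - ?A))"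
      proof (rule summable_on_cong_neutral)
        fix I assume I: "I \<in> dyadic - (?A \<union> (range G - ?A))"
        have "x \<notin> I"
        proof
          assume "x \<in> I"
          then have "I \<subseteq> G n \<or> G n \<subseteq> I" using dyadic_cases[of I "G n"] I Gd[of n] x by blast
          then show False using I G unfolding dyadic_tower_def by blast
        qed
        then show "comp_term f x I = 0" by (simp add: comp_term_def)
      qed (use Gd in auto)
      then show "comp_term f x summable_on dyadic" using s by simp
    qed
  qed
qed

lemma converges:
  assumes f: "f \<in> Lp p w"
  shows "AE x in lebesgue. comp_term f x summable_on dyadic"
  using converges_on_tower[OF f tower_pos] converges_on_tower[OF f tower_neg]
  by eventually_elim (use towers_cover in blast)

definition comp_op :: "(real \<Rightarrow> complex) \<Rightarrow> real \<Rightarrow> complex" where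
  "comp_op f x = (\<Sum>\<^sub>\<infinity>I\<in>dyadic. comp_term f x I)"

lemma frame_sums_tendsto:
  assumes "comp_term f x summable_on dyadic"
  shows "(\<lambda>N. \<Sum>I\<in>frame N. comp_term f x I) \<longlonglongrightarrow> comp_op f x"
proof -
  have "(comp_term f x has_sum comp_op f x) dyadic" unfolding comp_op_def using assms by (rule has_sum_infsum)
  then show ?thesis unfolding has_sum_def by (rule filterlim_compose[OF _ filterlim_frame])
qed

lemma frame_sum_measurable: "(\<lambda>x. \<Sum>I\<in>frame N. comp_term f x I) \<in> borel_measurable lebesgue"
proof (rule borel_measurable_sum)
  fix I assume "I \<in> frame N"
  then have [measurable]: "I \<in> sets lebesgue" using frame_dyadic sets_lebesgue_dyadic by blast
  show "(\<lambda>x. comp_term f x I) \<in> borel_measurable lebesgue" unfolding comp_term_def by measurable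
qed

lemma comp_op_measurable:
  assumes f: "f \<in> Lp p w"
  shows "comp_op f \<in> borel_measurable lebesgue"
proof -
  let ?g = "{x. comp_term f x summable_on dyadic}"
  have "{x \<in> space lebesgue. \<not> comp_term f x summable_on dyadic} \<in> null_sets lebesgue"
    using converges[OF f] by (simp only: completion.AE_iff_null_sets)
  then have "- ?g \<in> sets lebesgue" by (simp add: Collect_neg_eq null_sets_def)
  then have g: "?g \<in> sets lebesgue" using sets.compl_sets[of "- ?g" lebesgue] by (simp add: Diff_eq)
  show ?thesis
  proof (rule borel_measurable_LIMSEQ_metric)
    \<comment> \<open>Where the series diverges, \<open>infsum\<close> has its default value 0.
      Masking the partial sums by the set of convergence therefore makes them converge everywhere;
      the set is measurable because its complement is null and the measure is complete.\<close>
    show "(\<lambda>x. indicator ?g x * (\<Sum>I\<in>frame N. comp_term f x I)) \<in> borel_measurable lebesgue" for N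
      by (intro borel_measurable_times borel_measurable_indicator g frame_sum_measurable)
    show "(\<lambda>N. indicator ?g x * (\<Sum>I\<in>frame N. comp_term f x I)) \<longlonglongrightarrow> comp_op f x" for x
    proof (cases "x \<in> ?g")
      case True
      then show ?thesis using frame_sums_tendsto[of f x] by simp
    next
      case False
      then have "comp_op f x = 0" unfolding comp_op_def by (simp add: infsum_not_exists)
      then show ?thesis using False by simp
    qed
  qed
qed

text \<open>The sparse family that dominates a partial sum depends on N, so no pointwise domination
  survives in the limit. A bound on the integrals that is uniform in N does, by Fatou's
  lemma.\<close>

lemma comp_op_fatou:
  assumes f: "f \<in> Lp p w" and X: "\<And>N. Lp_int (\<lambda>x. \<Sum>I\<in>frame N. comp_term f x I) \<le> X"
  shows "Lp_int (comp_op f) \<le> X"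
proof -
  let ?F = "\<lambda>N x. \<Sum>I\<in>frame N. comp_term f x I"
  note [measurable] = frame_sum_measurable
  have "AE x in lebesgue. ennreal (cmod (comp_op f x) powr p * w x) = liminf (\<lambda>N. ennreal (cmod (?F N x) powr p * w x))"
    using converges[OF f]
  proof eventually_elim
    fix x assume "comp_term f x summable_on dyadic"
    then have "(\<lambda>N. cmod (?F N x)) \<longlonglongrightarrow> cmod (comp_op f x)" by (intro tendsto_norm frame_sums_tendsto)
    then have "(\<lambda>N. cmod (?F N x) powr p) \<longlonglongrightarrow> cmod (comp_op f x) powr p"
      using p by (intro tendsto_powr2) auto
    then have "(\<lambda>N. ennreal (cmod (?F N x) powr p * w x)) \<longlonglongrightarrow> ennreal (cmod (comp_op f x) powr p * w x)"
      by (intro tendsto_ennrealI tendsto_mult tendsto_const)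
    then show "ennreal (cmod (comp_op f x) powr p * w x) = liminf (\<lambda>N. ennreal (cmod (?F N x) powr p * w x))"
      by (intro lim_imp_Liminf[symmetric]) auto
  qed
  then have "Lp_int (comp_op f) = (\<integral>\<^sup>+x. liminf (\<lambda>N. ennreal (cmod (?F N x) powr p * w x)) \<partial>lebesgue)"
    unfolding Lp_int_def by (rule nn_integral_cong_AE)
  also have "\<dots> \<le> liminf (\<lambda>N. \<integral>\<^sup>+x. ennreal (cmod (?F N x) powr p * w x) \<partial>lebesgue)"
    by (rule nn_integral_liminf) measurable
  also have "\<dots> \<le> liminf (\<lambda>N. X)"
    by (intro Liminf_mono always_eventually allI X[unfolded Lp_int_def])
  also have "\<dots> = X" by (simp add: Liminf_const)
  finally show ?thesis .
qed

text \<open>The bound \<open>X\<close> stays open because it is taken in two ways: from the uniform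
  sparse estimate to prove membership in the weighted space, and from operator norms of sparse
  operators to prove the sharp inequality.\<close>

lemma frame_sum_bound:
  assumes f: "f \<in> Lp p w"
    and X: "\<And>S. finite S \<Longrightarrow> sparse_collection (1 / 2) S \<Longrightarrow> (\<integral>\<^sup>+x. ennreal (sparse_sum f S x powr p * w x) \<partial>lebesgue) \<le> X"
  shows "Lp_int (\<lambda>x. \<Sum>I\<in>frame N. comp_term f x I) \<le> ennreal ((304 * M) powr p) * X"
proof -
  obtain S where S: "finite S" "sparse_collection (1 / 2) S"
    and dom: "\<And>x. cmod (\<Sum>J\<in>frame N. comp_term f x J) \<le> 304 * M * sparse_sum f S x"
    using frame_domination[OF f, of N] by blast
  have [measurable]: "sparse_sum f S \<in> borel_measurable lebesgue"
    using S(2) by (intro sparse_sum_measurable) (simp add: sparse_collection_def)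
  have "ennreal (cmod (\<Sum>J\<in>frame N. comp_term f x J) powr p * w x) \<le> ennreal ((304 * M) powr p) * ennreal (sparse_sum f S x powr p * w x)" for x
  proof -
    have "cmod (\<Sum>J\<in>frame N. comp_term f x J) powr p \<le> (304 * M * sparse_sum f S x) powr p"
      using dom[of x] p by (intro powr_mono2) auto
    also have "\<dots> = (304 * M) powr p * sparse_sum f S x powr p"
      using M_pos sparse_sum_nonneg[of f S x] by (intro powr_mult)
    finally have "cmod (\<Sum>J\<in>frame N. comp_term f x J) powr p * w x \<le> (304 * M) powr p * sparse_sum f S x powr p * w x"
      using w_nonneg by (rule mult_right_mono)
    then show ?thesis using w_nonneg[of x] by (simp add: ennreal_mult[symmetric] ennreal_leI mult.assoc)
  qed
  then have "Lp_int (\<lambda>x. \<Sum>I\<in>frame N. comp_term f x I) \<le> (\<integral>\<^sup>+x. ennreal ((304 * M) powr p) * ennreal (sparse_sum f S x powr p * w x) \<partial>lebesgue)"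
    unfolding Lp_int_def by (rule nn_integral_mono)
  also have "\<dots> = ennreal ((304 * M) powr p) * (\<integral>\<^sup>+x. ennreal (sparse_sum f S x powr p * w x) \<partial>lebesgue)"
    by (rule nn_integral_cmult) measurable
  also have "\<dots> \<le> ennreal ((304 * M) powr p) * X"
    using X[OF S] by (rule mult_left_mono) simp
  finally show ?thesis .
qed

lemma comp_op_in_Lp:
  assumes f: "f \<in> Lp p w"
  shows "comp_op f \<in> Lp p w"
proof -
  obtain C where C: "C \<ge> 0" "\<And>S. finite S \<Longrightarrow> sparse_collection (1 / 2) S \<Longrightarrow>
    (\<integral>\<^sup>+x. ennreal (sparse_sum f S x powr p * w x) \<partial>lebesgue) \<le> ennreal C * Lp_int f"
    using sparse_sum_estimate f by blast
  have "Lp_int (comp_op f) \<le> ennreal ((304 * M) powr p) * (ennreal C * Lp_int f)"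
    by (intro comp_op_fatou f frame_sum_bound C(2))
  also have "\<dots> < \<infinity>" using f by (simp add: Lp_iff ennreal_mult_less_top)
  finally show ?thesis using comp_op_measurable[OF f] by (simp add: Lp_iff)
qed

end

section \<open>From sparse sums to norms of sparse operators\<close>

context Ap_weight
begin

text \<open>The dominating sum is the sparse operator applied to the modulus of f, which has the
  same norm as f. This is how operator norms of sparse operators bound the dominating sums.\<close>

lemma sparse_op_norm_eq:
  assumes f: "f \<in> Lp p w" and S: "finite S" "S \<subseteq> dyadic"
  shows "sparse_op S (\<lambda>x. of_real (cmod (f x))) x = of_real (sparse_sum f S x)"
proof -
  have "avg (\<lambda>x. of_real (cmod (f x))) Q = of_real (ravg (\<lambda>x. cmod (f x)) Q)" if "Q \<in> S" for Q
    using that S by (intro avg_norm_eq[OF Lp_measurable[OF f] Lp_local[OF f]]) auto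
  then show ?thesis
    unfolding sparse_op_def sparse_sum_def infsum_finite[OF S(1)] of_real_sum
    by (intro sum.cong) (auto simp: indicator_def)
qed

lemma sparse_op_le:
  assumes f: "f \<in> Lp p w" and S: "finite S" "S \<subseteq> dyadic"
  shows "cmod (sparse_op S f x) \<le> sparse_sum f S x"
proof -
  have "cmod (sparse_op S f x) \<le> (\<Sum>Q\<in>S. cmod (avg f Q * indicator Q x))"
    unfolding sparse_op_def infsum_finite[OF S(1)] by (rule norm_sum)
  also have "\<dots> \<le> sparse_sum f S x"
    unfolding sparse_sum_def
  proof (rule sum_mono)
    fix Q assume "Q \<in> S"
    then show "cmod (avg f Q * indicator Q x) \<le> ravg (\<lambda>x. cmod (f x)) Q * indicator Q x"
      using avg_le_ravg[OF Lp_measurable[OF f] Lp_local[OF f], of Q] S(2) by (auto simp: indicator_def)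
  qed
  finally show ?thesis .
qed

lemma norm_in_Lp: "f \<in> Lp p w \<Longrightarrow> (\<lambda>x. of_real (cmod (f x))) \<in> Lp p w"
  and Lp_int_norm: "Lp_int (\<lambda>x. of_real (cmod (f x))) = Lp_int f"
  by (auto simp: Lp_iff Lp_int_def)

lemma sparse_ops_bounded:
  "\<exists>K\<ge>0. \<forall>S. finite S \<longrightarrow> sparse_collection (1 / 2) S \<longrightarrow> op_norm p w (sparse_op S) \<le> ennreal K"
proof -
  obtain C where C: "C \<ge> 0" "\<And>S f. finite S \<Longrightarrow> sparse_collection (1 / 2) S \<Longrightarrow> f \<in> Lp p w \<Longrightarrow>
    (\<integral>\<^sup>+x. ennreal (sparse_sum f S x powr p * w x) \<partial>lebesgue) \<le> ennreal C * Lp_int f"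
    using sparse_sum_estimate by blast
  have "op_norm p w (sparse_op S) \<le> ennreal (C powr (1 / p))" if S: "finite S" "sparse_collection (1 / 2) S" for S
    unfolding op_norm_def
  proof (rule SUP_least)
    fix f assume "f \<in> {f \<in> Lp p w. Lp_norm p w f \<le> 1}"
    then have f: "f \<in> Lp p w" "Lp_int f \<le> 1"
      using Lp_norm_le_iff[of 1 f] by auto
    have Sd: "S \<subseteq> dyadic" using S(2) by (simp add: sparse_collection_def)
    have "Lp_int (sparse_op S f) \<le> (\<integral>\<^sup>+x. ennreal (sparse_sum f S x powr p * w x) \<partial>lebesgue)"
      unfolding Lp_int_def using sparse_op_le[OF f(1) S(1) Sd] p w_nonneg
      by (intro nn_integral_mono ennreal_leI mult_right_mono powr_mono2) auto
    also have "\<dots> \<le> ennreal C * Lp_int f" by (rule C(2)[OF S f(1)])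
    also have "\<dots> \<le> ennreal C * 1" using f(2) by (rule mult_left_mono) simp
    finally show "Lp_norm p w (sparse_op S f) \<le> ennreal (C powr (1 / p))"
      using C(1) p by (subst Lp_norm_le_iff) (auto simp: powr_powr)
  qed
  then show ?thesis by (intro exI[of _ "C powr (1 / p)"]) auto
qed

end

lemma (in bounded_symbol) op_norm_comp_op_le:
  assumes K: "0 \<le> K" "\<And>S. finite S \<Longrightarrow> sparse_collection (1 / 2) S \<Longrightarrow> op_norm p w (sparse_op S) \<le> ennreal K"
  shows "op_norm p w comp_op \<le> ennreal (304 * M * K)"
  unfolding op_norm_def
proof (rule SUP_least)
  fix f assume "f \<in> {f \<in> Lp p w. Lp_norm p w f \<le> 1}"
  then have f: "f \<in> Lp p w" "Lp_norm p w f \<le> 1" by auto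
  let ?f = "\<lambda>x. of_real (cmod (f x)) :: complex"
  have nf: "?f \<in> Lp p w" "Lp_norm p w ?f \<le> 1"
    using norm_in_Lp[OF f(1)] f(2) by (simp_all add: Lp_norm_eq Lp_int_norm)
  have "(\<integral>\<^sup>+x. ennreal (sparse_sum f S x powr p * w x) \<partial>lebesgue) \<le> ennreal (K powr p)"
    if S: "finite S" "sparse_collection (1 / 2) S" for S
  proof -
    have Sd: "S \<subseteq> dyadic" using S(2) by (simp add: sparse_collection_def)
    have "Lp_norm p w (sparse_op S ?f) \<le> op_norm p w (sparse_op S)"
      unfolding op_norm_def by (rule SUP_upper) (use nf in simp)
    also have "\<dots> \<le> ennreal K" by (rule K(2)[OF S])
    finally have "Lp_int (sparse_op S ?f) \<le> ennreal (K powr p)" using K(1) by (simp add: Lp_norm_le_iff)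
    then show ?thesis
      unfolding Lp_int_def sparse_op_norm_eq[OF f(1) S(1) Sd] using sparse_sum_nonneg[of f S] by simp
  qed
  then have "Lp_int (comp_op f) \<le> ennreal ((304 * M) powr p) * ennreal (K powr p)"
    by (intro comp_op_fatou f frame_sum_bound)
  also have "\<dots> = ennreal ((304 * M * K) powr p)"
    using M_pos K(1) by (simp add: powr_mult ennreal_mult)
  finally show "Lp_norm p w (comp_op f) \<le> ennreal (304 * M * K)"
    using M_pos K(1) by (subst Lp_norm_le_iff) auto
qed

section \<open>Selecting one sparse collection\<close>

lemma paraproduct_term_eq:
  "adj_paraproduct_term b (paraproduct_coeff d f) x I = b I * d I * avg f I * of_real (indicator I x / len I)"
  by (simp add: adj_paraproduct_term_def paraproduct_coeff_def)

lemma sparse_collection_empty: "sparse_collection \<eta> {}"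
  by (simp add: sparse_collection_def disjoint_family_on_def)

lemma paraproduct_composition_bound:
  fixes p :: real and w :: "real \<Rightarrow> real" and b d :: "real set \<Rightarrow> complex"
  assumes p: "1 < p" and w: "w \<in> Ap p" and ls: "locally_summable (\<lambda>I. b I * d I)"
    and cm: "CM_norm (S_hat (\<lambda>I. b I * d I)) < \<infinity>" and li: "linf_norm (E_seq (\<lambda>I. b I * d I)) < \<infinity>"
  shows "\<forall>f \<in> Lp p w. paraproduct_comp_converges b d f"
    and "bounded_on_Lp p w (paraproduct_comp b d)"
    and "\<exists>S. sparse_collection (1 / 2) S \<and>
      op_norm p w (paraproduct_comp b d)
        \<le> ennreal 608 * (CM_norm (S_hat (\<lambda>I. b I * d I)) + linf_norm (E_seq (\<lambda>I. b I * d I)))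
            * op_norm p w (sparse_op S)"
proof -
  define a where "a = (\<lambda>I. b I * d I)"
  define N where "N = CM_norm (S_hat a) + linf_norm (E_seq a)"
  obtain m where m: "N = ennreal m" "0 \<le> m"
    using cm li by (cases N) (auto simp: N_def a_def)
  \<comment> \<open>All M > m are used because m may be 0, which the locale excludes.\<close>
  have bs: "bounded_symbol p w a M" if "m < M" for M
  proof
    show "1 < p" "w \<in> Ap p" "locally_summable a" using p w ls by (auto simp: a_def)
    show "0 < M" using m that by simp
    have "N \<le> ennreal M" using m that by (simp add: ennreal_leI)
    then show "CM_norm (S_hat a) \<le> ennreal M" "linf_norm (E_seq a) \<le> ennreal M"
      unfolding N_def by (meson add_increasing2 add_increasing order_trans zero_le order_refl le_add_same_cancel1)+
  qed
  interpret B: bounded_symbol p w a "m + 1" by (rule bs) simp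
  have comp_term_eq: "adj_paraproduct_term b (paraproduct_coeff d f) x = B.comp_term f x" for f x
    unfolding paraproduct_term_eq B.comp_term_def by (simp add: a_def)
  show "\<forall>f \<in> Lp p w. paraproduct_comp_converges b d f"
    unfolding paraproduct_comp_converges_def comp_term_eq using B.converges by blast
  have comp_op_eq: "paraproduct_comp b d = B.comp_op"
    by (intro ext) (simp add: paraproduct_comp_def B.comp_op_def comp_term_eq)
  \<comment> \<open>Domination of partial sums produces finite collections only, so the supremum is
    taken over these, where a sparse operator is a finite sum.\<close>
  let ?\<S> = "{S. finite S \<and> sparse_collection (1 / 2) S}"
  define K where "K = (SUP S\<in>?\<S>. op_norm p w (sparse_op S))"
  obtain K0 where K0: "\<And>S. S \<in> ?\<S> \<Longrightarrow> op_norm p w (sparse_op S) \<le> ennreal K0"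
    using B.sparse_ops_bounded by blast
  have "K \<le> ennreal K0" unfolding K_def by (rule SUP_least) (rule K0)
  then obtain k where k: "K = ennreal k" "0 \<le> k" by (cases K) (auto simp: top_unique)
  have Kup: "op_norm p w (sparse_op S) \<le> ennreal k" if "finite S" "sparse_collection (1 / 2) S" for S
    unfolding k(1)[symmetric] K_def by (rule SUP_upper) (use that in simp)
  have opM: "op_norm p w (paraproduct_comp b d) \<le> ennreal (304 * M * k)" if M: "m < M" for M
  proof -
    interpret B': bounded_symbol p w a M by (rule bs[OF M])
    have "B'.comp_op = B.comp_op" by (intro ext) (simp add: B.comp_op_def B'.comp_op_def B.comp_term_def B'.comp_term_def)
    then show ?thesis using B'.op_norm_comp_op_le[OF k(2) Kup] comp_op_eq by simp
  qed
  have fin: "op_norm p w (paraproduct_comp b d) < \<infinity>"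
    using opM[of "m + 1"] by (auto intro: le_less_trans)
  show "bounded_on_Lp p w (paraproduct_comp b d)"
    unfolding bounded_on_Lp_def using fin B.comp_op_in_Lp comp_op_eq by simp
  obtain t where t: "op_norm p w (paraproduct_comp b d) = ennreal t" "0 \<le> t"
    using fin by (cases "op_norm p w (paraproduct_comp b d)") auto
  have "t \<le> 304 * m * k"
  proof (rule field_le_epsilon)
    fix e :: real assume e: "0 < e"
    \<comment> \<open>The excess over m is chosen so that 304 times it times k is at most e;
      \<open>k + 1\<close> in the denominator covers k = 0.\<close>
    define M where "M = m + e / (304 * (k + 1))"
    have "m < M" using e k(2) by (simp add: M_def)
    then have "t \<le> 304 * M * k" using opM[of M] t m k(2) by (simp add: ennreal_le_iff)
    also have "304 * M * k = 304 * m * k + e * (k / (k + 1))"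
      using k(2) by (simp add: M_def field_simps)
    also have "\<dots> \<le> 304 * m * k + e * 1" using e k(2) by (intro add_left_mono mult_left_mono) auto
    finally show "t \<le> 304 * m * k + e" by simp
  qed
  then have op: "op_norm p w (paraproduct_comp b d) \<le> ennreal (304 * m * k)"
    using t by (simp add: ennreal_leI)
  show "\<exists>S. sparse_collection (1 / 2) S \<and>
      op_norm p w (paraproduct_comp b d)
        \<le> ennreal 608 * (CM_norm (S_hat (\<lambda>I. b I * d I)) + linf_norm (E_seq (\<lambda>I. b I * d I)))
            * op_norm p w (sparse_op S)"
  proof (cases "k = 0")
    \<comment> \<open>Here the paraproduct composition has norm 0, and the empty collection
      serves.\<close>
    case True
    then show ?thesis using op sparse_collection_empty by (intro exI[of _ "{}"]) simp
  next
    case False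
    \<comment> \<open>Halving gives a value strictly below the finite positive supremum, so some
      collection exceeds it. The lost factor 2 turns 304 into 608.\<close>
    then have "ennreal (k / 2) < K" using k by (simp add: ennreal_lessI)
    then obtain S where S: "S \<in> ?\<S>" "ennreal (k / 2) < op_norm p w (sparse_op S)"
      unfolding K_def less_SUP_iff by blast
    have "ennreal (304 * m * k) = ennreal 608 * ennreal m * ennreal (k / 2)"
      using m k ennreal_mult'[of "608 * m" "k / 2"] ennreal_mult'[of 608 m] by (simp add: mult_ac)
    also have "\<dots> \<le> ennreal 608 * ennreal m * op_norm p w (sparse_op S)"
      using S(2) by (intro mult_left_mono) auto
    finally have "op_norm p w (paraproduct_comp b d) \<le> ennreal 608 * N * op_norm p w (sparse_op S)"
      using op m(1) by (metis order_trans)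
    then show ?thesis using S(1) unfolding N_def a_def by blast
  qed
qed

theorem theorem1p3:
  shows "\<exists>(\<eta>::real) (C::real). 0 < \<eta> \<and> \<eta> < 1 \<and> 0 \<le> C \<and>
    (\<forall>(p::real) (w :: real \<Rightarrow> real) (b :: real set \<Rightarrow> complex) (d :: real set \<Rightarrow> complex).
       1 < p \<longrightarrow> w \<in> Ap p \<longrightarrow>
       locally_summable (\<lambda>I. b I * d I) \<longrightarrow>
       CM_norm (S_hat (\<lambda>I. b I * d I)) < \<infinity> \<longrightarrow>
       linf_norm (E_seq (\<lambda>I. b I * d I)) < \<infinity> \<longrightarrow>
         (\<forall>f \<in> Lp p w. paraproduct_comp_converges b d f) \<and>
         bounded_on_Lp p w (paraproduct_comp b d) \<and>
         (\<exists>S. sparse_collection \<eta> S \<and>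
            op_norm p w (paraproduct_comp b d)
              \<le> ennreal C * (CM_norm (S_hat (\<lambda>I. b I * d I)) + linf_norm (E_seq (\<lambda>I. b I * d I)))
                  * op_norm p w (sparse_op S)))"
  by (rule exI[of _ "1 / 2"], rule exI[of _ 608])
    (intro conjI allI impI paraproduct_composition_bound; simp)

end
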